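(* Let $h$ be the Haar functional on $\mathcal F_R(\mathrm{SU}(2))$. For $M,N\in\mathbb Z_{\ge0}$, $0\le j,k\le M$, $0\le l,m\le N$, the following Schur orthogonality relations hold: $$h\bigl(t_{jk}^M(t_{lm}^N)^*\bigr)=\delta_{MN}\,\delta_{jl}\,\delta_{km}\,q^{2(M-k)}\,\frac{1-q^2}{1-q^{2(M+1)}}$$ $$\times\frac{(q^2,q^{-2\lambda};q^2)_j\,(q^2;q^2)_{M-j}\,(q^{-2(\mu+1+M-k)};q^2)_{M-k}}{(q^{-2(\lambda+M+1-j)};q^2)_j\,(q^2;q^2)_k\,(q^2,q^{-2(\mu+M-2k)};q^2)_{M-k}}.$$
   Context: Fix $0<q<1$ and put $q^x=e^{x\log q}$. $\mathcal M$ is the field of meromorphic functions on $\mathbb C$. Put $$F(\lambda)=\frac{q^{2(\lambda+1)}-q^{-2}}{q^{2(\lambda+1)}-1},\quad G(\lambda)=\frac{(q^{2(\lambda+1)}-q^2)(q^{2(\lambda+1)}-q^{-2})}{(q^{2(\lambda+1)}-1)^2},$$ $$H(\lambda,\mu)=\frac{(q-q^{-1})(q^{2(\lambda+\mu+2)}-1)}{(q^{2(\lambda+1)}-1)(q^{2(\mu+1)}-1)},\quad I(\lambda,\mu)=\frac{(q-q^{-1})(q^{2(\mu+1)}-q^{2(\lambda+1)})}{(q^{2(\lambda+1)}-1)(q^{2(\mu+1)}-1)}.$$ $\mathcal F_R(\mathrm M(2))$ is the unital associative complex algebra generated by $\alpha,\beta,\gamma,\delta$ and two copies of $\mathcal M$,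 whose elements are written $f(\lambda)=\mu_l(f)$ and $f(\mu)=\mu_r(f)$, with relations $f(\lambda)g(\mu)=g(\mu)f(\lambda)$; $f(\lambda)\alpha=\alpha f(\lambda+1)$, $f(\mu)\alpha=\alpha f(\mu+1)$, $f(\lambda)\beta=\beta f(\lambda+1)$, $f(\mu)\beta=\beta f(\mu-1)$, $f(\lambda)\gamma=\gamma f(\lambda-1)$, $f(\mu)\gamma=\gamma f(\mu+1)$, $f(\lambda)\delta=\delta f(\lambda-1)$, $f(\mu)\delta=\delta f(\mu-1)$; $\alpha\beta=qF(\mu-1)\beta\alpha$, $\alpha\gamma=qF(\lambda)\gamma\alpha$, $\beta\delta=qF(\lambda)\delta\beta$, $\gamma\delta=qF(\mu-1)\delta\gamma$; $\alpha\delta-\delta\alpha=H(\lambda,\mu)\gamma\beta$, $G(\mu)\alpha\delta-G(\lambda)\delta\alpha=H(\lambda,\mu)\beta\gamma$, $\beta\gamma-G(\mu)\gamma\beta=I(\lambda,\mu)\delta\alpha$, $\beta\gamma-G(\lambda)\gamma\beta=I(\lambda,\mu)\alpha\delta$. It is bigraded by $\alpha\in\mathcal F_{11}$, $\beta\in\mathcal F_{1,-1}$, $\gamma\in\mathcal F_{-1,1}$, $\delta\in\mathcal F_{-1,-1}$, $f(\lambda),f(\mu)\in\mathcal F_{00}$. $\mathcal F_R(\mathrm{SL}(2))$ is its quotient by $c=1$, where $c=\alpha\delta-qF(\lambda)\gamma\beta$ is central. $\mathcal F_R(\mathrm{SU}(2))$ is $\mathcal F_R(\mathrm{SL}(2))$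 with the antilinear antimultiplicative involution $f(\lambda)^*=\bar f(\lambda)$, $f(\mu)^*=\bar f(\mu)$ (where $\bar f(\lambda)=\overline{f(\bar\lambda)}$), $\alpha^*=\delta$, $\beta^*=-q\gamma$, $\gamma^*=-q^{-1}\beta$, $\delta^*=\alpha$. For $A=\mathcal F_R(\mathrm{SL}(2))$, $A\widetilde\otimes A=\bigoplus_{a,b,c}A_{ac}\otimes A_{cb}$ modulo $f(\mu)x\otimes y=x\otimes f(\lambda)y$, with factorwise multiplication; the coproduct is the algebra homomorphism with $\Delta(\alpha)=\alpha\otimes\alpha+\beta\otimes\gamma$, $\Delta(\beta)=\alpha\otimes\beta+\beta\otimes\delta$, $\Delta(\gamma)=\gamma\otimes\alpha+\delta\otimes\gamma$, $\Delta(\delta)=\gamma\otimes\beta+\delta\otimes\delta$, $\Delta(f(\lambda))=f(\lambda)\otimes1$, $\Delta(f(\mu))=1\otimes f(\mu)$. The matrix elements $t_{kj}^N\in A$ ($0\le k,j\le N$) are defined by $\Delta(\gamma^{N-k}\alpha^k)=\sum_{j=0}^Nt_{kj}^N\otimes\gamma^{N-j}\alpha^j$; over all $N\ge0$ they form a basis of $A$ as a left module over $\mu_l(\mathcal M)\mu_r(\mathcal M)\simeq\mathcal M\otimes\mathcal M$. The Haar functional is the $\mathbb C$-linear map $h:A\to\mu_l(\mathcal M)\mu_r(\mathcal M)$ determined by $h(f(\lambda)g(\mu)t_{kj}^N)=f(\lambda)g(\mu)\delta_{0N}$ for $f,g\in\mathcal M$, $0\le j,k\le N$. Notation: $(a;q)_k=\prod_{i=0}^{k-1}(1-aq^i)$,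 $(a,b;q)_k=(a;q)_k(b;q)_k$. *)

theory Defs
  imports
    "HOL-Complex_Analysis.Complex_Analysis"
    "HOL-Algebra.QuotRing"
    "HOL-Library.Poly_Mapping"
    "HOL-Library.Product_Plus"
begin

section \<open>The field of meromorphic functions on the complex plane\<close>

text \<open>
  A meromorphic function is represented by its unique ``nicely meromorphic'' representative (all
  removable singularities removed, value 0 at the poles). Pointwise operations are therefore
  followed by \<^const>\<open>remove_sings\<close>.
\<close>

typedef mero = "{f. f nicely_meromorphic_on UNIV}"
  by (rule exI[of _ "\<lambda>_. 0"]) auto

definition to_mero :: "(complex \<Rightarrow> complex) \<Rightarrow> mero" where
  "to_mero f = Abs_mero (remove_sings f)"

lemma Rep_mero_nicely: "Rep_mero f nicely_meromorphic_on UNIV"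
  using Rep_mero[of f] by simp

lemma Rep_mero_meromorphic [meromorphic_intros]: "Rep_mero f meromorphic_on A"
  using Rep_mero_nicely[of f] meromorphic_on_subset[of "Rep_mero f" UNIV A]
  by (auto simp: nicely_meromorphic_on_def)

lemma Rep_to_mero:
  assumes "f meromorphic_on UNIV"
  shows   "Rep_mero (to_mero f) = remove_sings f"
  using remove_sings_nicely_meromorphic[OF assms]
  by (simp add: to_mero_def Abs_mero_inverse)

lemma ev_Rep_to_mero:
  assumes "f meromorphic_on UNIV"
  shows   "eventually (\<lambda>w. Rep_mero (to_mero f) w = f w) (at z)"
  unfolding Rep_to_mero[OF assms]
  by (rule eventually_remove_sings_eq_at) (use assms meromorphic_on_isolated_singularity meromorphic_on_subset in blast)

lemma remove_sings_Rep_mero: "remove_sings (Rep_mero f) = Rep_mero f"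
proof
  fix z
  show "remove_sings (Rep_mero f) z = Rep_mero f z"
  proof (cases "is_pole (Rep_mero f) z \<and> Rep_mero f z = 0")
    case True
    thus ?thesis using remove_sings_at_pole[of "Rep_mero f" z] by auto
  next
    case False
    thus ?thesis
      using Rep_mero_nicely[of f] by (intro remove_sings_eqI) (auto simp: nicely_meromorphic_on_def)
  qed
qed

lemma mero_eqI:
  assumes "\<And>z. eventually (\<lambda>w. Rep_mero f w = Rep_mero g w) (at z)"
  shows   "f = g"
proof -
  have "remove_sings (Rep_mero f) = remove_sings (Rep_mero g)"
    by (rule ext, rule remove_sings_cong) (use assms in auto)
  thus ?thesis
    by (simp add: remove_sings_Rep_mero Rep_mero_inject)
qed

instantiation mero :: field
begin

definition "0 = to_mero (\<lambda>_. 0)"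
definition "1 = to_mero (\<lambda>_. 1)"
definition "f + g = to_mero (\<lambda>z. Rep_mero f z + Rep_mero g z)"
definition "f - g = to_mero (\<lambda>z. Rep_mero f z - Rep_mero g z)"
definition "- f = to_mero (\<lambda>z. - Rep_mero f z)"
definition "f * g = to_mero (\<lambda>z. Rep_mero f z * Rep_mero g z)"
definition "inverse f = to_mero (\<lambda>z. inverse (Rep_mero f z))"
definition "f div g = to_mero (\<lambda>z. Rep_mero f z / Rep_mero g z)"

lemma ev_mero:
  "eventually (\<lambda>w. Rep_mero 0 w = 0) (at z)"
  "eventually (\<lambda>w. Rep_mero 1 w = 1) (at z)"
  "eventually (\<lambda>w. Rep_mero (f + g) w = Rep_mero f w + Rep_mero g w) (at z)"
  "eventually (\<lambda>w. Rep_mero (f - g) w = Rep_mero f w - Rep_mero g w) (at z)"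
  "eventually (\<lambda>w. Rep_mero (- f) w = - Rep_mero f w) (at z)"
  "eventually (\<lambda>w. Rep_mero (f * g) w = Rep_mero f w * Rep_mero g w) (at z)"
  "eventually (\<lambda>w. Rep_mero (inverse f) w = inverse (Rep_mero f w)) (at z)"
  "eventually (\<lambda>w. Rep_mero (f div g) w = Rep_mero f w / Rep_mero g w) (at z)"
  unfolding zero_mero_def one_mero_def plus_mero_def minus_mero_def uminus_mero_def
    times_mero_def inverse_mero_def divide_mero_def
  by (rule ev_Rep_to_mero; intro meromorphic_intros)+

instance
proof
  fix a b c :: mero
  show "a + b + c = a + (b + c)"
    by (rule mero_eqI, use ev_mero(3)[of "a+b" c] ev_mero(3)[of a b] ev_mero(3)[of a "b+c"]
          ev_mero(3)[of b c] in eventually_elim) simp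
  show "a + b = b + a" by (simp add: plus_mero_def add.commute)
  show "0 + a = a"
    by (rule mero_eqI, use ev_mero(3)[of 0 a] ev_mero(1) in eventually_elim) simp
  show "- a + a = 0"
    by (rule mero_eqI, use ev_mero(3)[of "-a" a] ev_mero(5)[of a] ev_mero(1) in eventually_elim) simp
  show "a - b = a + - b"
    by (rule mero_eqI, use ev_mero(4)[of a b] ev_mero(3)[of a "-b"] ev_mero(5)[of b] in eventually_elim) simp
  show "a * b * c = a * (b * c)"
    by (rule mero_eqI, use ev_mero(6)[of "a*b" c] ev_mero(6)[of a b] ev_mero(6)[of a "b*c"]
          ev_mero(6)[of b c] in eventually_elim) simp
  show "a * b = b * a" by (simp add: times_mero_def mult.commute)
  show "1 * a = a"
    by (rule mero_eqI, use ev_mero(6)[of 1 a] ev_mero(2) in eventually_elim) simp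
  show "(a + b) * c = a * c + b * c"
    by (rule mero_eqI, use ev_mero(6)[of "a+b" c] ev_mero(3)[of a b] ev_mero(3)[of "a*c" "b*c"]
          ev_mero(6)[of a c] ev_mero(6)[of b c] in eventually_elim) (simp add: algebra_simps)
  show "a div b = a * inverse b"
    by (rule mero_eqI, use ev_mero(8)[of a b] ev_mero(6)[of a "inverse b"] ev_mero(7)[of b]
        in eventually_elim) (simp add: divide_inverse)
  show "inverse (0::mero) = 0"
    by (rule mero_eqI, use ev_mero(7)[of 0] ev_mero(1) in eventually_elim) simp
  show "(0::mero) \<noteq> 1"
  proof
    assume *: "(0::mero) = 1"
    have "eventually (\<lambda>w::complex. (0::complex) = 1) (at 0)"
      using ev_mero(1)[of 0] ev_mero(2)[of 0] unfolding * by eventually_elim simp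
    thus False by simp
  qed
  assume "a \<noteq> 0"
  have "(\<forall>x\<in>UNIV. Rep_mero a x = 0) \<or> (\<forall>\<^sub>\<approx>x\<in>UNIV. Rep_mero a x \<noteq> 0)"
    by (rule nicely_meromorphic_imp_constant_or_avoid) (auto simp: Rep_mero_nicely)
  moreover have "\<not>(\<forall>x\<in>UNIV. Rep_mero a x = 0)"
  proof
    assume *: "\<forall>x\<in>UNIV. Rep_mero a x = 0"
    have "a = 0"
      by (rule mero_eqI, use ev_mero(1) in eventually_elim) (use * in auto)
    with \<open>a \<noteq> 0\<close> show False by simp
  qed
  ultimately have ev: "eventually (\<lambda>x. Rep_mero a x \<noteq> 0) (at z)" for z
    by (auto simp: eventually_cosparse_open_eq)
  show "inverse a * a = 1"
    by (rule mero_eqI, use ev_mero(6)[of "inverse a" a] ev_mero(7)[of a] ev_mero(2) ev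
        in eventually_elim) simp
qed

end

definition shift_mero :: "complex \<Rightarrow> mero \<Rightarrow> mero" where
  "shift_mero c f = to_mero (\<lambda>x. Rep_mero f (x + c))"

definition cnj_mero :: "mero \<Rightarrow> mero" where
  "cnj_mero f = to_mero (\<lambda>x. cnj (Rep_mero f (cnj x)))"

lemma Rep_shift_mero: "Rep_mero (shift_mero c f) x = Rep_mero f (x + c)"
proof -
  have "(\<lambda>x. Rep_mero f (x + c)) meromorphic_on UNIV"
    by (rule meromorphic_on_compose[of _ UNIV])
       (auto intro!: Rep_mero_meromorphic analytic_intros)
  moreover have "filtermap (\<lambda>w. w + c) (at x) = at (x + c)"
    using filtermap_at_shift[of "-c" x] by simp
  hence "remove_sings (Rep_mero f \<circ> (\<lambda>w. w + c)) x = remove_sings (Rep_mero f) (x + c)"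
    by (rule remove_sings_compose)
  ultimately show ?thesis
    by (simp add: shift_mero_def Rep_to_mero o_def remove_sings_Rep_mero)
qed

lemma filtermap_cnj_at: "filtermap cnj (at x) = at (cnj x)"
proof (rule filtermap_fun_inverse[of cnj])
  have "eventually (\<lambda>w. cnj w \<noteq> cnj y) (at y)" for y
    unfolding eventually_at_filter by (rule always_eventually) simp
  hence *: "filterlim cnj (at (cnj y)) (at y)" for y
    by (auto simp: filterlim_at intro!: tendsto_eq_intros)
  show "filterlim cnj (at x) (at (cnj x))" "filterlim cnj (at (cnj x)) (at x)"
    using *[of "cnj x"] *[of x] by simp_all
qed simp

lemma Rep_cnj_mero: "Rep_mero (cnj_mero f) x = cnj (Rep_mero f (cnj x))"
proof -
  define g where "g = Rep_mero f"
  have g: "g meromorphic_on UNIV" unfolding g_def by (rule Rep_mero_meromorphic)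
  define h where "h = (\<lambda>x. cnj (g (cnj x)))"
  have "h meromorphic_on {z}" for z
  proof -
    have "g meromorphic_on {cnj z}" using g meromorphic_on_subset by blast
    hence iso: "isolated_singularity_at g (cnj z)" and ness: "not_essential g (cnj z)"
      by (auto simp: meromorphic_at_iff)
    from iso obtain r where r: "r > 0" "g analytic_on ball (cnj z) r - {cnj z}"
      by (auto simp: isolated_singularity_at_def)
    have img: "cnj ` (ball z r - {z}) = ball (cnj z) r - {cnj z}"
    proof (rule Set.set_eqI)
      fix w
      have "w \<in> cnj ` (ball z r - {z}) \<longleftrightarrow> cnj w \<in> ball z r - {z}"
        by (metis complex_cnj_cnj image_iff)
      also have "\<dots> \<longleftrightarrow> w \<in> ball (cnj z) r - {cnj z}"
        by (simp add: dist_norm) (metis complex_cnj_cnj complex_cnj_diff complex_mod_cnj)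
      finally show "w \<in> cnj ` (ball z r - {z}) \<longleftrightarrow> w \<in> ball (cnj z) r - {cnj z}" .
    qed
    have op: "open (ball z r - {z})" "open (ball (cnj z) r - {cnj z})"
      by (auto intro: open_delete)
    have "h holomorphic_on ball z r - {z}"
      unfolding holomorphic_on_open[OF op(1)]
    proof
      fix w assume w: "w \<in> ball z r - {z}"
      hence "cnj w \<in> ball (cnj z) r - {cnj z}" using img by blast
      then obtain d where d: "(g has_field_derivative d) (at (cnj w))"
        using r(2) holomorphic_on_open[OF op(2)] analytic_imp_holomorphic by blast
      have "(cnj \<circ> g \<circ> cnj has_field_derivative cnj d) (at w)"
        using has_field_derivative_cnj_cnj[OF d] by simp
      thus "\<exists>f'. (h has_field_derivative f') (at w)"
        by (auto simp: h_def o_def)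
    qed
    hence "isolated_singularity_at h z"
      unfolding isolated_singularity_at_def using r(1) op(1) by (auto simp: analytic_on_open)
    moreover have "not_essential h z"
    proof -
      from ness obtain l where "(g \<longlongrightarrow> l) (at (cnj z)) \<or> is_pole g (cnj z)"
        by (auto simp: not_essential_def)
      thus ?thesis
      proof
        assume "(g \<longlongrightarrow> l) (at (cnj z))"
        hence "((\<lambda>w. g (cnj w)) \<longlongrightarrow> l) (at z)"
          using filterlim_filtermap[of g "nhds l" cnj "at z"] by (simp add: filtermap_cnj_at)
        hence "(h \<longlongrightarrow> cnj l) (at z)" unfolding h_def by (rule tendsto_cnj)
        thus ?thesis by (auto simp: not_essential_def)
      next
        assume "is_pole g (cnj z)"
        hence "filterlim (\<lambda>w. g (cnj w)) at_infinity (at z)"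
          using filterlim_filtermap[of g at_infinity cnj "at z"] by (simp add: filtermap_cnj_at is_pole_def)
        hence "is_pole h z"
          by (simp add: is_pole_def h_def filterlim_at_infinity_conv_norm_at_top)
        thus ?thesis by (auto simp: not_essential_def)
      qed
    qed
    ultimately show ?thesis by (simp add: meromorphic_at_iff)
  qed
  hence mero: "h meromorphic_on UNIV"
    using meromorphic_on_meromorphic_at by blast
  have "remove_sings h x = h x"
  proof (cases "is_pole g (cnj x) \<and> g (cnj x) = 0")
    case True
    hence "filterlim (\<lambda>w. g (cnj w)) at_infinity (at x)"
      using filterlim_filtermap[of g at_infinity cnj "at x"] by (simp add: filtermap_cnj_at is_pole_def)
    hence "is_pole h x"
      by (simp add: is_pole_def h_def filterlim_at_infinity_conv_norm_at_top)
    thus ?thesis using True by (simp add: h_def)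
  next
    case False
    hence "(g \<longlongrightarrow> g (cnj x)) (at (cnj x))"
      using Rep_mero_nicely[of f] by (auto simp: nicely_meromorphic_on_def g_def)
    hence "((\<lambda>w. g (cnj w)) \<longlongrightarrow> g (cnj x)) (at x)"
      using filterlim_filtermap[of g "nhds (g (cnj x))" cnj "at x"] by (simp add: filtermap_cnj_at)
    hence "(h \<longlongrightarrow> h x) (at x)" unfolding h_def by (rule tendsto_cnj)
    thus ?thesis by (rule remove_sings_eqI)
  qed
  thus ?thesis
    using mero unfolding cnj_mero_def g_def [symmetric] h_def [symmetric]
    by (simp add: Rep_to_mero) (simp add: h_def)
qed

definition const_mero :: "complex \<Rightarrow> mero" where
  "const_mero c = to_mero (\<lambda>_. c)"


section \<open>The coefficient functions\<close>

definition qexp :: "real \<Rightarrow> complex \<Rightarrow> complex" where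
  "qexp q x = exp (x * of_real (ln q))"

definition qpoch :: "complex \<Rightarrow> complex \<Rightarrow> nat \<Rightarrow> complex" where
  "qpoch a p k = (\<Prod>i<k. 1 - a * p ^ i)"

definition fun_F :: "real \<Rightarrow> complex \<Rightarrow> complex" where
  "fun_F q x = (qexp q (2 * (x + 1)) - qexp q (-2)) / (qexp q (2 * (x + 1)) - 1)"

definition fun_G :: "real \<Rightarrow> complex \<Rightarrow> complex" where
  "fun_G q x =
     (qexp q (2 * (x + 1)) - qexp q 2) * (qexp q (2 * (x + 1)) - qexp q (-2)) /
     (qexp q (2 * (x + 1)) - 1)\<^sup>2"

definition fun_H :: "real \<Rightarrow> complex \<Rightarrow> complex \<Rightarrow> complex" where
  "fun_H q x y =
     (qexp q 1 - qexp q (-1)) * (qexp q (2 * (x + y + 2)) - 1) /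
     ((qexp q (2 * (x + 1)) - 1) * (qexp q (2 * (y + 1)) - 1))"

definition fun_I :: "real \<Rightarrow> complex \<Rightarrow> complex \<Rightarrow> complex" where
  "fun_I q x y =
     (qexp q 1 - qexp q (-1)) * (qexp q (2 * (y + 1)) - qexp q (2 * (x + 1))) /
     ((qexp q (2 * (x + 1)) - 1) * (qexp q (2 * (y + 1)) - 1))"

definition fun_P :: "real \<Rightarrow> complex \<Rightarrow> complex" where
  "fun_P q x = qexp q (2 * (x + 1)) / (qexp q (2 * (x + 1)) - 1)"

definition fun_R :: "real \<Rightarrow> complex \<Rightarrow> complex" where
  "fun_R q x = 1 / (qexp q (2 * (x + 1)) - 1)"

text \<open>
  In the algebra below, a function of both variables makes sense only as an element of
  \<open>\<M> \<otimes> \<M>\<close>. The following two identities exhibit \<open>H\<close> and \<open>I\<close> as such elements.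
\<close>

lemma fun_H_split:
  "fun_H q x y = (qexp q 1 - qexp q (-1)) * (fun_P q x * fun_P q y - fun_R q x * fun_R q y)"
proof -
  have "qexp q (2 * (x + y + 2)) = qexp q (2 * (x + 1)) * qexp q (2 * (y + 1))"
    by (simp add: qexp_def exp_add [symmetric] algebra_simps)
  thus ?thesis
    by (simp add: fun_H_def fun_P_def fun_R_def diff_divide_distrib right_diff_distrib)
qed

lemma fun_I_split:
  "fun_I q x y = (qexp q 1 - qexp q (-1)) * (fun_R q x * fun_P q y - fun_P q x * fun_R q y)"
  by (simp add: fun_I_def fun_P_def fun_R_def diff_divide_distrib right_diff_distrib)


section \<open>The free algebra\<close>

datatype fr_gen = Alpha | Beta | Gamma | Delta | MuL mero | MuR mero

text \<open>The free monoid on the generators, written additively as \<^type>\<open>poly_mapping\<close> requires.\<close>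

datatype fr_word = Word "fr_gen list"

instantiation fr_word :: monoid_add
begin

definition "0 = Word []"
fun plus_fr_word where "plus_fr_word (Word u) (Word v) = Word (u @ v)"

instance
proof
  fix a b c :: fr_word
  show "a + b + c = a + (b + c)" by (cases a; cases b; cases c) simp
  show "0 + a = a" by (cases a) (simp add: zero_fr_word_def)
  show "a + 0 = a" by (cases a) (simp add: zero_fr_word_def)
qed

end

type_synonym fr_free = "fr_word \<Rightarrow>\<^sub>0 complex"

definition gen :: "fr_gen \<Rightarrow> fr_free" where
  "gen g = Poly_Mapping.single (Word [g]) 1"

definition scal :: "complex \<Rightarrow> fr_free" where
  "scal c = Poly_Mapping.single 0 c"

abbreviation lam :: "mero \<Rightarrow> fr_free" where "lam f \<equiv> gen (MuL f)"
abbreviation mu :: "mero \<Rightarrow> fr_free" where "mu f \<equiv> gen (MuR f)"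

definition elem_H :: "real \<Rightarrow> fr_free" where
  "elem_H q = scal (qexp q 1 - qexp q (-1)) *
     (lam (to_mero (fun_P q)) * mu (to_mero (fun_P q)) -
      lam (to_mero (fun_R q)) * mu (to_mero (fun_R q)))"

definition elem_I :: "real \<Rightarrow> fr_free" where
  "elem_I q = scal (qexp q 1 - qexp q (-1)) *
     (lam (to_mero (fun_R q)) * mu (to_mero (fun_P q)) -
      lam (to_mero (fun_P q)) * mu (to_mero (fun_R q)))"


section \<open>The algebras \<open>F\<^sub>R(M(2))\<close> and \<open>F\<^sub>R(SL(2))\<close>\<close>

text \<open>
  The first six rules make \<open>\<mu>\<^sub>l\<close> and \<open>\<mu>\<^sub>r\<close> homomorphisms of unital complex algebras.
\<close>

inductive rel_M2 :: "real \<Rightarrow> fr_free \<Rightarrow> fr_free \<Rightarrow> bool" for q :: real where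
  lam_add:   "rel_M2 q (lam (f + g)) (lam f + lam g)"
| lam_mult:  "rel_M2 q (lam (f * g)) (lam f * lam g)"
| lam_const: "rel_M2 q (lam (const_mero c)) (scal c)"
| mu_add:    "rel_M2 q (mu (f + g)) (mu f + mu g)"
| mu_mult:   "rel_M2 q (mu (f * g)) (mu f * mu g)"
| mu_const:  "rel_M2 q (mu (const_mero c)) (scal c)"
| lam_mu:    "rel_M2 q (lam f * mu g) (mu g * lam f)"
| lam_alpha: "rel_M2 q (lam f * gen Alpha) (gen Alpha * lam (shift_mero 1 f))"
| mu_alpha:  "rel_M2 q (mu f * gen Alpha) (gen Alpha * mu (shift_mero 1 f))"
| lam_beta:  "rel_M2 q (lam f * gen Beta) (gen Beta * lam (shift_mero 1 f))"
| mu_beta:   "rel_M2 q (mu f * gen Beta) (gen Beta * mu (shift_mero (-1) f))"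
| lam_gamma: "rel_M2 q (lam f * gen Gamma) (gen Gamma * lam (shift_mero (-1) f))"
| mu_gamma:  "rel_M2 q (mu f * gen Gamma) (gen Gamma * mu (shift_mero 1 f))"
| lam_delta: "rel_M2 q (lam f * gen Delta) (gen Delta * lam (shift_mero (-1) f))"
| mu_delta:  "rel_M2 q (mu f * gen Delta) (gen Delta * mu (shift_mero (-1) f))"
| alpha_beta:
    "rel_M2 q (gen Alpha * gen Beta)
       (scal (of_real q) * mu (shift_mero (-1) (to_mero (fun_F q))) * gen Beta * gen Alpha)"
| alpha_gamma:
    "rel_M2 q (gen Alpha * gen Gamma)
       (scal (of_real q) * lam (to_mero (fun_F q)) * gen Gamma * gen Alpha)"
| beta_delta:
    "rel_M2 q (gen Beta * gen Delta)
       (scal (of_real q) * lam (to_mero (fun_F q)) * gen Delta * gen Beta)"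
| gamma_delta:
    "rel_M2 q (gen Gamma * gen Delta)
       (scal (of_real q) * mu (shift_mero (-1) (to_mero (fun_F q))) * gen Delta * gen Gamma)"
| alpha_delta:
    "rel_M2 q (gen Alpha * gen Delta - gen Delta * gen Alpha) (elem_H q * gen Gamma * gen Beta)"
| alpha_delta_G:
    "rel_M2 q
       (mu (to_mero (fun_G q)) * gen Alpha * gen Delta - lam (to_mero (fun_G q)) * gen Delta * gen Alpha)
       (elem_H q * gen Beta * gen Gamma)"
| beta_gamma_mu:
    "rel_M2 q (gen Beta * gen Gamma - mu (to_mero (fun_G q)) * gen Gamma * gen Beta)
       (elem_I q * gen Delta * gen Alpha)"
| beta_gamma_lam:
    "rel_M2 q (gen Beta * gen Gamma - lam (to_mero (fun_G q)) * gen Gamma * gen Beta)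
       (elem_I q * gen Alpha * gen Delta)"

definition det_c :: "real \<Rightarrow> fr_free" where
  "det_c q = gen Alpha * gen Delta - scal (of_real q) * lam (to_mero (fun_F q)) * gen Gamma * gen Beta"

text \<open>The quotient of \<open>F\<^sub>R(M(2))\<close> by \<open>c = 1\<close> is presented by adding the relation \<open>c = 1\<close> to those of \<open>F\<^sub>R(M(2))\<close>.\<close>

definition relators_SL2 :: "real \<Rightarrow> fr_free set" where
  "relators_SL2 q = {x - y |x y. rel_M2 q x y} \<union> {det_c q - 1}"

definition free_ring :: "fr_free ring" where
  "free_ring = \<lparr>carrier = UNIV, mult = (*), one = 1, zero = 0, add = (+)\<rparr>"

definition ideal_SL2 :: "real \<Rightarrow> fr_free set" where
  "ideal_SL2 q = genideal free_ring (relators_SL2 q)"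

definition FSL2 :: "real \<Rightarrow> fr_free set ring" where
  "FSL2 q = free_ring Quot ideal_SL2 q"

definition cls :: "real \<Rightarrow> fr_free \<Rightarrow> fr_free set" where
  "cls q x = ideal_SL2 q +>\<^bsub>free_ring\<^esub> x"

lemma ring_free_ring: "ring free_ring"
proof (rule ringI)
  show "abelian_group free_ring"
    by (rule abelian_groupI)
       (auto simp: free_ring_def algebra_simps intro: exI[of _ "- x" for x])
  show "monoid free_ring"
    by (rule monoidI) (auto simp: free_ring_def algebra_simps)
qed (auto simp: free_ring_def algebra_simps)

lemma ideal_ideal_SL2: "ideal (ideal_SL2 q) free_ring"
  unfolding ideal_SL2_def
  by (rule ring.genideal_ideal[OF ring_free_ring]) (simp add: free_ring_def)

lemma ring_FSL2: "ring (FSL2 q)"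
  unfolding FSL2_def by (rule ideal.quotient_is_ring[OF ideal_ideal_SL2])

lemma cls_simps:
  "cls q x \<otimes>\<^bsub>FSL2 q\<^esub> cls q y = cls q (x * y)"
  "cls q x \<oplus>\<^bsub>FSL2 q\<^esub> cls q y = cls q (x + y)"
  "cls q 1 = \<one>\<^bsub>FSL2 q\<^esub>"
  "cls q 0 = \<zero>\<^bsub>FSL2 q\<^esub>"
proof -
  interpret ideal "ideal_SL2 q" free_ring by (rule ideal_ideal_SL2)
  show "cls q x \<otimes>\<^bsub>FSL2 q\<^esub> cls q y = cls q (x * y)"
    using rcoset_mult_add[of x y] by (simp add: FSL2_def cls_def FactRing_def) (simp add: free_ring_def)
  show "cls q x \<oplus>\<^bsub>FSL2 q\<^esub> cls q y = cls q (x + y)"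
    using a_rcos_sum[of x y] by (simp add: FSL2_def cls_def FactRing_def) (simp add: free_ring_def)
  show "cls q 1 = \<one>\<^bsub>FSL2 q\<^esub>"
    by (simp add: FSL2_def cls_def FactRing_def free_ring_def)
  show "cls q 0 = \<zero>\<^bsub>FSL2 q\<^esub>"
    using a_rcos_zero[OF ideal_axioms additive_subgroup.zero_closed[OF additive_subgroup_axioms]]
    by (simp add: FSL2_def cls_def FactRing_def) (simp add: free_ring_def)
qed

fun gen_deg :: "fr_gen \<Rightarrow> int \<times> int" where
  "gen_deg Alpha = (1, 1)"
| "gen_deg Beta = (1, -1)"
| "gen_deg Gamma = (-1, 1)"
| "gen_deg Delta = (-1, -1)"
| "gen_deg (MuL _) = (0, 0)"
| "gen_deg (MuR _) = (0, 0)"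

fun word_deg :: "fr_word \<Rightarrow> int \<times> int" where
  "word_deg (Word gs) = sum_list (map gen_deg gs)"

definition homog :: "real \<Rightarrow> int \<Rightarrow> int \<Rightarrow> fr_free set set" where
  "homog q a b = cls q ` {x. \<forall>w\<in>Poly_Mapping.keys x. word_deg w = (a, b)}"

definition gen_cls :: "real \<Rightarrow> fr_gen \<Rightarrow> fr_free set" where
  "gen_cls q g = cls q (gen g)"

abbreviation scal_cls :: "real \<Rightarrow> complex \<Rightarrow> fr_free set" where
  "scal_cls q c \<equiv> cls q (scal c)"

abbreviation lam_cls :: "real \<Rightarrow> mero \<Rightarrow> fr_free set" where
  "lam_cls q f \<equiv> gen_cls q (MuL f)"

abbreviation mu_cls :: "real \<Rightarrow> mero \<Rightarrow> fr_free set" where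
  "mu_cls q f \<equiv> gen_cls q (MuR f)"

lemma word_deg_add: "word_deg (u + v) = word_deg u + word_deg v"
  by (cases u; cases v) simp

lemma homog_carrier: "homog q a b \<subseteq> carrier (FSL2 q)"
  by (auto simp: homog_def FSL2_def cls_def FactRing_def A_RCOSETS_defs a_r_coset_def r_coset_def free_ring_def)

lemma homog_mult:
  assumes "x \<in> homog q a b" "y \<in> homog q a' b'"
  shows   "x \<otimes>\<^bsub>FSL2 q\<^esub> y \<in> homog q (a + a') (b + b')"
proof -
  from assms obtain u v where
    u: "x = cls q u" "\<forall>w\<in>Poly_Mapping.keys u. word_deg w = (a, b)" and
    v: "y = cls q v" "\<forall>w\<in>Poly_Mapping.keys v. word_deg w = (a', b')"
    by (auto simp: homog_def)
  have "\<forall>w\<in>Poly_Mapping.keys (u * v). word_deg w = (a + a', b + b')"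
    using keys_mult[of u v] u(2) v(2) by (fastforce simp: word_deg_add)
  thus ?thesis
    unfolding u(1) v(1) cls_simps by (auto simp: homog_def)
qed

lemma homog_one: "\<one>\<^bsub>FSL2 q\<^esub> \<in> homog q 0 0"
  unfolding cls_simps(3) [symmetric]
  by (auto simp: homog_def zero_fr_word_def zero_prod_def intro!: imageI)


section \<open>The algebra \<open>A \<otimes>~ A\<close> and the coproduct\<close>

text \<open>
  The free complex vector space on the pairs \<open>(x, y) \<in> A\<^bsub>ac\<^esub> \<times> A\<^bsub>cb\<^esub>\<close>, with the product that
  extends the factorwise product of pairs bilinearly. Since the sum of the \<open>A\<^bsub>ab\<^esub>\<close> is direct, a pair
  of nonzero elements determines \<open>a\<close>, \<open>b\<close>, \<open>c\<close>, and pairs with a zero entry vanish by bilinearity;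
  hence no extra tag for the summand is needed.
\<close>

type_synonym fr_pairs = "(fr_free set \<times> fr_free set) \<Rightarrow>\<^sub>0 complex"

definition composable :: "real \<Rightarrow> (fr_free set \<times> fr_free set) set" where
  "composable q = (\<Union>a b c. homog q a c \<times> homog q c b)"

definition pair_mult :: "real \<Rightarrow> fr_free set \<times> fr_free set \<Rightarrow> fr_free set \<times> fr_free set \<Rightarrow> fr_free set \<times> fr_free set" where
  "pair_mult q p r = (fst p \<otimes>\<^bsub>FSL2 q\<^esub> fst r, snd p \<otimes>\<^bsub>FSL2 q\<^esub> snd r)"

definition pairs_mult :: "real \<Rightarrow> fr_pairs \<Rightarrow> fr_pairs \<Rightarrow> fr_pairs" where
  "pairs_mult q x y =
     (\<Sum>p\<in>Poly_Mapping.keys x. \<Sum>r\<in>Poly_Mapping.keys y.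
        Poly_Mapping.single (pair_mult q p r) (Poly_Mapping.lookup x p * Poly_Mapping.lookup y r))"

definition pairs_ring :: "real \<Rightarrow> fr_pairs ring" where
  "pairs_ring q =
     \<lparr>carrier = {x. Poly_Mapping.keys x \<subseteq> composable q}, mult = pairs_mult q,
      one = Poly_Mapping.single (\<one>\<^bsub>FSL2 q\<^esub>, \<one>\<^bsub>FSL2 q\<^esub>) 1, zero = 0, add = (+)\<rparr>"

inductive rel_tensor :: "real \<Rightarrow> fr_pairs \<Rightarrow> fr_pairs \<Rightarrow> bool" for q :: real where
  add_left:
    "x \<in> homog q a c \<Longrightarrow> x' \<in> homog q a c \<Longrightarrow> y \<in> homog q c b \<Longrightarrow>
     rel_tensor q (Poly_Mapping.single (x \<oplus>\<^bsub>FSL2 q\<^esub> x', y) 1)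
       (Poly_Mapping.single (x, y) 1 + Poly_Mapping.single (x', y) 1)"
| add_right:
    "x \<in> homog q a c \<Longrightarrow> y \<in> homog q c b \<Longrightarrow> y' \<in> homog q c b \<Longrightarrow>
     rel_tensor q (Poly_Mapping.single (x, y \<oplus>\<^bsub>FSL2 q\<^esub> y') 1)
       (Poly_Mapping.single (x, y) 1 + Poly_Mapping.single (x, y') 1)"
| scal_left:
    "x \<in> homog q a c \<Longrightarrow> y \<in> homog q c b \<Longrightarrow>
     rel_tensor q (Poly_Mapping.single (scal_cls q z \<otimes>\<^bsub>FSL2 q\<^esub> x, y) 1) (Poly_Mapping.single (x, y) z)"
| scal_right:
    "x \<in> homog q a c \<Longrightarrow> y \<in> homog q c b \<Longrightarrow>
     rel_tensor q (Poly_Mapping.single (x, scal_cls q z \<otimes>\<^bsub>FSL2 q\<^esub> y) 1) (Poly_Mapping.single (x, y) z)"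
| balanced:
    "x \<in> homog q a c \<Longrightarrow> y \<in> homog q c b \<Longrightarrow>
     rel_tensor q (Poly_Mapping.single (mu_cls q f \<otimes>\<^bsub>FSL2 q\<^esub> x, y) 1)
       (Poly_Mapping.single (x, lam_cls q f \<otimes>\<^bsub>FSL2 q\<^esub> y) 1)"

definition ideal_tensor :: "real \<Rightarrow> fr_pairs set" where
  "ideal_tensor q = genideal (pairs_ring q) {x - y |x y. rel_tensor q x y}"

definition FSL2_tensor :: "real \<Rightarrow> fr_pairs set ring" where
  "FSL2_tensor q = pairs_ring q Quot ideal_tensor q"

definition tensor :: "real \<Rightarrow> fr_free set \<Rightarrow> fr_free set \<Rightarrow> fr_pairs set" where
  "tensor q x y = ideal_tensor q +>\<^bsub>pairs_ring q\<^esub> Poly_Mapping.single (x, y) 1"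

lemma composable_mult:
  "p \<in> composable q \<Longrightarrow> r \<in> composable q \<Longrightarrow> pair_mult q p r \<in> composable q"
  unfolding composable_def pair_mult_def by (fastforce intro: homog_mult)

lemma pairs_mult_superset:
  assumes "finite A" "finite B" "Poly_Mapping.keys x \<subseteq> A" "Poly_Mapping.keys y \<subseteq> B"
  shows   "pairs_mult q x y = (\<Sum>p\<in>A. \<Sum>r\<in>B.
             Poly_Mapping.single (pair_mult q p r) (Poly_Mapping.lookup x p * Poly_Mapping.lookup y r))"
proof -
  have "(\<Sum>p\<in>A. \<Sum>r\<in>B. Poly_Mapping.single (pair_mult q p r) (Poly_Mapping.lookup x p * Poly_Mapping.lookup y r)) =
        (\<Sum>p\<in>A. \<Sum>r\<in>Poly_Mapping.keys y. Poly_Mapping.single (pair_mult q p r) (Poly_Mapping.lookup x p * Poly_Mapping.lookup y r))"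
    by (intro sum.cong refl sum.mono_neutral_right) (use assms in \<open>auto simp: in_keys_iff\<close>)
  also have "\<dots> = pairs_mult q x y"
    unfolding pairs_mult_def
    by (intro sum.mono_neutral_right) (use assms in \<open>auto simp: in_keys_iff\<close>)
  finally show ?thesis ..
qed

lemma pairs_mult_add_left: "pairs_mult q (x + x') y = pairs_mult q x y + pairs_mult q x' y"
proof -
  define A where "A = Poly_Mapping.keys x \<union> Poly_Mapping.keys x'"
  have A: "finite A" "Poly_Mapping.keys x \<subseteq> A" "Poly_Mapping.keys x' \<subseteq> A" "Poly_Mapping.keys (x + x') \<subseteq> A"
    using Poly_Mapping.keys_add[of x x'] by (auto simp: A_def)
  show ?thesis
    using pairs_mult_superset[OF A(1) _ A(2), of "Poly_Mapping.keys y" y q]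
      pairs_mult_superset[OF A(1) _ A(3), of "Poly_Mapping.keys y" y q]
      pairs_mult_superset[OF A(1) _ A(4), of "Poly_Mapping.keys y" y q]
    by (simp add: lookup_add single_add distrib_right sum.distrib)
qed

lemma pairs_mult_add_right: "pairs_mult q x (y + y') = pairs_mult q x y + pairs_mult q x y'"
proof -
  define A where "A = Poly_Mapping.keys y \<union> Poly_Mapping.keys y'"
  have A: "finite A" "Poly_Mapping.keys y \<subseteq> A" "Poly_Mapping.keys y' \<subseteq> A" "Poly_Mapping.keys (y + y') \<subseteq> A"
    using Poly_Mapping.keys_add[of y y'] by (auto simp: A_def)
  show ?thesis
    using pairs_mult_superset[OF _ A(1) _ A(2), of "Poly_Mapping.keys x" x q]
      pairs_mult_superset[OF _ A(1) _ A(3), of "Poly_Mapping.keys x" x q]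
      pairs_mult_superset[OF _ A(1) _ A(4), of "Poly_Mapping.keys x" x q]
    by (simp add: lookup_add single_add distrib_left sum.distrib)
qed

lemma pairs_mult_zero [simp]: "pairs_mult q 0 y = 0" "pairs_mult q x 0 = 0"
  by (simp_all add: pairs_mult_def)

lemma pairs_mult_sum_left: "pairs_mult q (sum f A) y = (\<Sum>i\<in>A. pairs_mult q (f i) y)"
  by (induction A rule: infinite_finite_induct) (simp_all add: pairs_mult_add_left)

lemma pairs_mult_sum_right: "pairs_mult q x (sum f A) = (\<Sum>i\<in>A. pairs_mult q x (f i))"
  by (induction A rule: infinite_finite_induct) (simp_all add: pairs_mult_add_right)

lemma pairs_mult_single:
  "pairs_mult q (Poly_Mapping.single p c) (Poly_Mapping.single r d) =
     Poly_Mapping.single (pair_mult q p r) (c * d)"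
  using pairs_mult_superset[of "{p}" "{r}" "Poly_Mapping.single p c" "Poly_Mapping.single r d" q] by simp

lemma fr_pairs_sum_single:
  fixes x :: fr_pairs
  shows "x = (\<Sum>p\<in>Poly_Mapping.keys x. Poly_Mapping.single p (Poly_Mapping.lookup x p))"
  by (rule poly_mapping_eqI)
     (auto simp: lookup_sum lookup_single when_def in_keys_iff sum.delta)

lemma pairs_mult_single_left:
  "pairs_mult q (Poly_Mapping.single p c) z = (\<Sum>s\<in>Poly_Mapping.keys z.
     Poly_Mapping.single (pair_mult q p s) (c * Poly_Mapping.lookup z s))"
  by (subst fr_pairs_sum_single[of z]) (simp add: pairs_mult_sum_right pairs_mult_single)

lemma pairs_mult_single_right:
  "pairs_mult q z (Poly_Mapping.single p c) = (\<Sum>s\<in>Poly_Mapping.keys z.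
     Poly_Mapping.single (pair_mult q s p) (Poly_Mapping.lookup z s * c))"
  by (subst fr_pairs_sum_single[of z]) (simp add: pairs_mult_sum_left pairs_mult_single)

lemma composable_carrier:
  "p \<in> composable q \<Longrightarrow> fst p \<in> carrier (FSL2 q) \<and> snd p \<in> carrier (FSL2 q)"
  using homog_carrier[of q] by (fastforce simp: composable_def)

lemma pair_mult_assoc:
  assumes "p \<in> composable q" "r \<in> composable q" "s \<in> composable q"
  shows   "pair_mult q (pair_mult q p r) s = pair_mult q p (pair_mult q r s)"
  using assms[THEN composable_carrier] monoid.m_assoc[OF ring.is_monoid[OF ring_FSL2[of q]]]
  by (simp add: pair_mult_def)

lemma ring_pairs_ring: "ring (pairs_ring q)"
proof (rule ringI)
  show "abelian_group (pairs_ring q)"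
  proof (rule abelian_groupI)
    fix x y assume "x \<in> carrier (pairs_ring q)" "y \<in> carrier (pairs_ring q)"
    thus "x \<oplus>\<^bsub>pairs_ring q\<^esub> y \<in> carrier (pairs_ring q)"
      using Poly_Mapping.keys_add[of x y] by (auto simp: pairs_ring_def)
  next
    fix x assume "x \<in> carrier (pairs_ring q)"
    thus "\<exists>y\<in>carrier (pairs_ring q). y \<oplus>\<^bsub>pairs_ring q\<^esub> x = \<zero>\<^bsub>pairs_ring q\<^esub>"
      by (intro bexI[of _ "-x"]) (auto simp: pairs_ring_def in_keys_iff)
  qed (auto simp: pairs_ring_def algebra_simps)
next
  let ?e = "(\<one>\<^bsub>FSL2 q\<^esub>, \<one>\<^bsub>FSL2 q\<^esub>)"
  interpret A: ring "FSL2 q" by (rule ring_FSL2)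
  have expand: "pairs_mult q x y = (\<Sum>p\<in>Poly_Mapping.keys x. \<Sum>r\<in>Poly_Mapping.keys y.
      Poly_Mapping.single (pair_mult q p r) (Poly_Mapping.lookup x p * Poly_Mapping.lookup y r))" for x y
    by (simp add: pairs_mult_def)
  have unit: "pair_mult q ?e p = p" "pair_mult q p ?e = p" if "p \<in> composable q" for p
    using composable_carrier[OF that] by (simp_all add: pair_mult_def)
  show "monoid (pairs_ring q)"
  proof (rule monoidI)
    fix x y assume "x \<in> carrier (pairs_ring q)" "y \<in> carrier (pairs_ring q)"
    hence xy: "Poly_Mapping.keys x \<subseteq> composable q" "Poly_Mapping.keys y \<subseteq> composable q"
      by (auto simp: pairs_ring_def)
    have "Poly_Mapping.keys (pairs_mult q x y) \<subseteq>
            (\<Union>p\<in>Poly_Mapping.keys x. \<Union>r\<in>Poly_Mapping.keys y. {pair_mult q p r})"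
      unfolding pairs_mult_def
      by (rule order.trans[OF keys_sum UN_mono[OF order.refl order.trans[OF keys_sum UN_mono[OF order.refl]]]]) auto
    also have "\<dots> \<subseteq> composable q"
      using xy composable_mult by blast
    finally show "x \<otimes>\<^bsub>pairs_ring q\<^esub> y \<in> carrier (pairs_ring q)"
      by (simp add: pairs_ring_def)
  next
    show "\<one>\<^bsub>pairs_ring q\<^esub> \<in> carrier (pairs_ring q)"
      using homog_one[of q] by (auto simp: pairs_ring_def composable_def)
  next
    fix x y z
    assume "x \<in> carrier (pairs_ring q)" "y \<in> carrier (pairs_ring q)" "z \<in> carrier (pairs_ring q)"
    hence xyz: "Poly_Mapping.keys x \<subseteq> composable q" "Poly_Mapping.keys y \<subseteq> composable q"
      "Poly_Mapping.keys z \<subseteq> composable q"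
      by (auto simp: pairs_ring_def)
    have "pairs_mult q (pairs_mult q x y) z =
          (\<Sum>p\<in>Poly_Mapping.keys x. \<Sum>r\<in>Poly_Mapping.keys y. \<Sum>s\<in>Poly_Mapping.keys z.
             Poly_Mapping.single (pair_mult q (pair_mult q p r) s)
               (Poly_Mapping.lookup x p * Poly_Mapping.lookup y r * Poly_Mapping.lookup z s))"
      unfolding expand[of x y]
      by (simp add: pairs_mult_sum_left pairs_mult_single_left)
    also have "\<dots> = (\<Sum>p\<in>Poly_Mapping.keys x. \<Sum>r\<in>Poly_Mapping.keys y. \<Sum>s\<in>Poly_Mapping.keys z.
             Poly_Mapping.single (pair_mult q p (pair_mult q r s))
               (Poly_Mapping.lookup x p * (Poly_Mapping.lookup y r * Poly_Mapping.lookup z s)))"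
      by (intro sum.cong refl) (use xyz pair_mult_assoc in \<open>auto simp: mult.assoc subset_iff\<close>)
    also have "\<dots> = pairs_mult q x (pairs_mult q y z)"
      unfolding expand[of y z] pairs_mult_sum_right pairs_mult_single_right
      by (subst sum.swap, subst (2) sum.swap) simp
    finally show "x \<otimes>\<^bsub>pairs_ring q\<^esub> y \<otimes>\<^bsub>pairs_ring q\<^esub> z =
      x \<otimes>\<^bsub>pairs_ring q\<^esub> (y \<otimes>\<^bsub>pairs_ring q\<^esub> z)"
      by (simp add: pairs_ring_def)
  next
    fix x assume "x \<in> carrier (pairs_ring q)"
    hence keys: "Poly_Mapping.keys x \<subseteq> composable q"
      by (auto simp: pairs_ring_def)
    have x: "x = (\<Sum>s\<in>Poly_Mapping.keys x. Poly_Mapping.single s (Poly_Mapping.lookup x s))"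
      by (rule fr_pairs_sum_single)
    have "pairs_mult q (Poly_Mapping.single ?e 1) x =
       (\<Sum>s\<in>Poly_Mapping.keys x. Poly_Mapping.single (pair_mult q ?e s) (Poly_Mapping.lookup x s))"
      by (simp add: pairs_mult_single_left)
    also have "\<dots> = (\<Sum>s\<in>Poly_Mapping.keys x. Poly_Mapping.single s (Poly_Mapping.lookup x s))"
      by (intro sum.cong refl) (use keys unit in auto)
    finally show "\<one>\<^bsub>pairs_ring q\<^esub> \<otimes>\<^bsub>pairs_ring q\<^esub> x = x"
      by (simp add: pairs_ring_def x [symmetric])
    have "pairs_mult q x (Poly_Mapping.single ?e 1) =
       (\<Sum>s\<in>Poly_Mapping.keys x. Poly_Mapping.single (pair_mult q s ?e) (Poly_Mapping.lookup x s))"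
      by (simp add: pairs_mult_single_right)
    also have "\<dots> = (\<Sum>s\<in>Poly_Mapping.keys x. Poly_Mapping.single s (Poly_Mapping.lookup x s))"
      by (intro sum.cong refl) (use keys unit in auto)
    finally show "x \<otimes>\<^bsub>pairs_ring q\<^esub> \<one>\<^bsub>pairs_ring q\<^esub> = x"
      by (simp add: pairs_ring_def x [symmetric])
  qed
qed (auto simp: pairs_ring_def pairs_mult_add_left pairs_mult_add_right)

lemma homog_add:
  assumes "x \<in> homog q a b" "y \<in> homog q a b"
  shows   "x \<oplus>\<^bsub>FSL2 q\<^esub> y \<in> homog q a b"
proof -
  from assms obtain u v where
    u: "x = cls q u" "\<forall>w\<in>Poly_Mapping.keys u. word_deg w = (a, b)" and
    v: "y = cls q v" "\<forall>w\<in>Poly_Mapping.keys v. word_deg w = (a, b)"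
    by (auto simp: homog_def)
  have "\<forall>w\<in>Poly_Mapping.keys (u + v). word_deg w = (a, b)"
    using Poly_Mapping.keys_add[of u v] u(2) v(2) by blast
  thus ?thesis
    unfolding u(1) v(1) cls_simps by (auto simp: homog_def)
qed

lemma homog_degree_zero:
  "scal_cls q c \<in> homog q 0 0" "lam_cls q f \<in> homog q 0 0" "mu_cls q f \<in> homog q 0 0"
  by (auto simp: homog_def gen_cls_def gen_def scal_def zero_fr_word_def zero_prod_def
           intro!: imageI split: if_splits)

lemma rel_tensor_carrier:
  "rel_tensor q x y \<Longrightarrow> x \<in> carrier (pairs_ring q) \<and> y \<in> carrier (pairs_ring q)"
proof (induction rule: rel_tensor.induct)
  case (add_left x a c x' y b)
  thus ?case
    using homog_add[of x q a c x'] Poly_Mapping.keys_add[of "Poly_Mapping.single (x, y) (1::complex)" "Poly_Mapping.single (x', y) 1"]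
    by (auto simp: pairs_ring_def composable_def)
next
  case (add_right x a c y b y')
  thus ?case
    using homog_add[of y q c b y'] Poly_Mapping.keys_add[of "Poly_Mapping.single (x, y) (1::complex)" "Poly_Mapping.single (x, y') 1"]
    by (auto simp: pairs_ring_def composable_def)
next
  case (scal_left x a c y b z)
  thus ?case
    using homog_mult[OF homog_degree_zero(1) scal_left(1)]
    by (auto simp: pairs_ring_def composable_def split: if_splits)
next
  case (scal_right x a c y b z)
  thus ?case
    using homog_mult[OF homog_degree_zero(1) scal_right(2)]
    by (auto simp: pairs_ring_def composable_def split: if_splits)
next
  case (balanced x a c y b f)
  thus ?case
    using homog_mult[OF homog_degree_zero(3) balanced(1)] homog_mult[OF homog_degree_zero(2) balanced(2)]
    by (simp add: pairs_ring_def composable_def) blast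
qed

lemma ideal_ideal_tensor: "ideal (ideal_tensor q) (pairs_ring q)"
  unfolding ideal_tensor_def
proof (rule ring.genideal_ideal[OF ring_pairs_ring], safe)
  fix x y assume "rel_tensor q x y"
  hence "Poly_Mapping.keys x \<subseteq> composable q" "Poly_Mapping.keys y \<subseteq> composable q"
    using rel_tensor_carrier[of q x y] by (auto simp: pairs_ring_def)
  moreover have "Poly_Mapping.keys (x - y) \<subseteq> Poly_Mapping.keys x \<union> Poly_Mapping.keys y"
    by (auto simp: in_keys_iff lookup_minus)
  ultimately show "x - y \<in> carrier (pairs_ring q)"
    by (auto simp: pairs_ring_def)
qed

lemma ring_FSL2_tensor: "ring (FSL2_tensor q)"
  unfolding FSL2_tensor_def by (rule ideal.quotient_is_ring[OF ideal_ideal_tensor])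

definition is_coproduct :: "real \<Rightarrow> (fr_free set \<Rightarrow> fr_pairs set) \<Rightarrow> bool" where
  "is_coproduct q D \<longleftrightarrow>
     D \<in> ring_hom (FSL2 q) (FSL2_tensor q) \<and>
     D (gen_cls q Alpha) = tensor q (gen_cls q Alpha) (gen_cls q Alpha) \<oplus>\<^bsub>FSL2_tensor q\<^esub>
                           tensor q (gen_cls q Beta) (gen_cls q Gamma) \<and>
     D (gen_cls q Beta)  = tensor q (gen_cls q Alpha) (gen_cls q Beta) \<oplus>\<^bsub>FSL2_tensor q\<^esub>
                           tensor q (gen_cls q Beta) (gen_cls q Delta) \<and>
     D (gen_cls q Gamma) = tensor q (gen_cls q Gamma) (gen_cls q Alpha) \<oplus>\<^bsub>FSL2_tensor q\<^esub>
                           tensor q (gen_cls q Delta) (gen_cls q Gamma) \<and>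
     D (gen_cls q Delta) = tensor q (gen_cls q Gamma) (gen_cls q Beta) \<oplus>\<^bsub>FSL2_tensor q\<^esub>
                           tensor q (gen_cls q Delta) (gen_cls q Delta) \<and>
     (\<forall>f. D (lam_cls q f) = tensor q (lam_cls q f) \<one>\<^bsub>FSL2 q\<^esub>) \<and>
     (\<forall>f. D (mu_cls q f) = tensor q \<one>\<^bsub>FSL2 q\<^esub> (mu_cls q f))"

definition gamma_alpha :: "real \<Rightarrow> nat \<Rightarrow> nat \<Rightarrow> fr_free set" where
  "gamma_alpha q N k =
     (gen_cls q Gamma [^]\<^bsub>FSL2 q\<^esub> (N - k)) \<otimes>\<^bsub>FSL2 q\<^esub> (gen_cls q Alpha [^]\<^bsub>FSL2 q\<^esub> k)"

text \<open>
  The element \<open>\<gamma>\<^sup>N\<^sup>-\<^sup>j\<alpha>\<^sup>j\<close> has bidegree \<open>(2j - N, N)\<close>, so \<open>t\<^sub>k\<^sub>j \<otimes> \<gamma>\<^sup>N\<^sup>-\<^sup>j\<alpha>\<^sup>j\<close> is a symbol of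
  \<open>A \<otimes>~ A\<close> of the same left degree as \<open>\<Delta>(\<gamma>\<^sup>N\<^sup>-\<^sup>k\<alpha>\<^sup>k)\<close> exactly when \<open>t\<^sub>k\<^sub>j\<close> has bidegree \<open>(2k - N, 2j - N)\<close>.
\<close>

definition is_matrix_elements ::
    "real \<Rightarrow> (fr_free set \<Rightarrow> fr_pairs set) \<Rightarrow> (nat \<Rightarrow> nat \<Rightarrow> nat \<Rightarrow> fr_free set) \<Rightarrow> bool" where
  "is_matrix_elements q D t \<longleftrightarrow>
     (\<forall>N k. k \<le> N \<longrightarrow>
        (\<forall>j\<le>N. t N k j \<in> homog q (2 * int k - int N) (2 * int j - int N)) \<and>
        D (gamma_alpha q N k) =
          (\<Oplus>\<^bsub>FSL2_tensor q\<^esub>j\<in>{0..N}. tensor q (t N k j) (gamma_alpha q N j)))"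


section \<open>The involution and the Haar functional\<close>

definition is_star :: "real \<Rightarrow> (fr_free set \<Rightarrow> fr_free set) \<Rightarrow> bool" where
  "is_star q s \<longleftrightarrow>
     (\<forall>x\<in>carrier (FSL2 q). s x \<in> carrier (FSL2 q) \<and> s (s x) = x) \<and>
     (\<forall>x\<in>carrier (FSL2 q). \<forall>y\<in>carrier (FSL2 q).
        s (x \<oplus>\<^bsub>FSL2 q\<^esub> y) = s x \<oplus>\<^bsub>FSL2 q\<^esub> s y \<and>
        s (x \<otimes>\<^bsub>FSL2 q\<^esub> y) = s y \<otimes>\<^bsub>FSL2 q\<^esub> s x) \<and>
     (\<forall>c. \<forall>x\<in>carrier (FSL2 q).
        s (scal_cls q c \<otimes>\<^bsub>FSL2 q\<^esub> x) = scal_cls q (cnj c) \<otimes>\<^bsub>FSL2 q\<^esub> s x) \<and>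
     (\<forall>f. s (lam_cls q f) = lam_cls q (cnj_mero f)) \<and>
     (\<forall>f. s (mu_cls q f) = mu_cls q (cnj_mero f)) \<and>
     s (gen_cls q Alpha) = gen_cls q Delta \<and>
     s (gen_cls q Beta) = scal_cls q (- of_real q) \<otimes>\<^bsub>FSL2 q\<^esub> gen_cls q Gamma \<and>
     s (gen_cls q Gamma) = scal_cls q (- inverse (of_real q)) \<otimes>\<^bsub>FSL2 q\<^esub> gen_cls q Beta \<and>
     s (gen_cls q Delta) = gen_cls q Alpha"

definition lam_mu_span :: "real \<Rightarrow> fr_free set set" where
  "lam_mu_span q = {cls q (\<Sum>(f, g)\<leftarrow>fgs. lam f * mu g) |fgs. True}"

definition is_haar ::
    "real \<Rightarrow> (nat \<Rightarrow> nat \<Rightarrow> nat \<Rightarrow> fr_free set) \<Rightarrow> (fr_free set \<Rightarrow> fr_free set) \<Rightarrow> bool" where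
  "is_haar q t h \<longleftrightarrow>
     (\<forall>x\<in>carrier (FSL2 q). h x \<in> lam_mu_span q) \<and>
     (\<forall>x\<in>carrier (FSL2 q). \<forall>y\<in>carrier (FSL2 q). h (x \<oplus>\<^bsub>FSL2 q\<^esub> y) = h x \<oplus>\<^bsub>FSL2 q\<^esub> h y) \<and>
     (\<forall>c. \<forall>x\<in>carrier (FSL2 q). h (scal_cls q c \<otimes>\<^bsub>FSL2 q\<^esub> x) = scal_cls q c \<otimes>\<^bsub>FSL2 q\<^esub> h x) \<and>
     (\<forall>f g N k j. k \<le> N \<longrightarrow> j \<le> N \<longrightarrow>
        h (lam_cls q f \<otimes>\<^bsub>FSL2 q\<^esub> mu_cls q g \<otimes>\<^bsub>FSL2 q\<^esub> t N k j) =
          lam_cls q f \<otimes>\<^bsub>FSL2 q\<^esub> mu_cls q g \<otimes>\<^bsub>FSL2 q\<^esub> scal_cls q (of_bool (N = 0)))"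

end

theory Submission
  imports Defs
begin

text \<open>
  Applying \<open>\<Delta>\<close> to \<open>\<gamma>\<^sup>N\<^sup>-\<^sup>k\<alpha>\<^sup>k\<alpha>\<close> and \<open>\<gamma>\<^sup>N\<^sup>-\<^sup>k\<alpha>\<^sup>k\<gamma>\<close> expresses \<open>t\<^sup>N\<^sup>+\<^sup>1\<close> through products of \<open>t\<^sup>N\<close> with
  generators. To read off coefficients in \<open>A \<otimes>~ A\<close> one lets the second factor act on the lowest
  weight vector \<open>v\<^sub>0\<close> of a module in which \<open>\<gamma>\<^sup>N\<^sup>-\<^sup>j\<alpha>\<^sup>j v\<^sub>0 = v\<^sub>N\<^sub>-\<^sub>j\<close>. Induction on \<open>N\<close> yields complementary
  combinations that land in \<open>t\<^sup>N\<^sup>-\<^sup>1\<close>; solving the two systems shows that right multiplication by any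
  generator maps \<open>t\<^sup>N\<close> to an explicit combination of \<open>t\<^sup>N\<^sup>+\<^sup>1\<close> and \<open>t\<^sup>N\<^sup>-\<^sup>1\<close>. Consequently the matrix
  elements span \<open>A\<close> and \<open>h\<close> is linear over the functions of \<open>\<lambda>\<close> and \<open>\<mu>\<close>. As right multiplication by \<open>x\<close> is
  adjoint to right multiplication by \<open>x\<^sup>*\<close> for the form \<open>h(ab\<^sup>*)\<close>, a generator can be moved from the
  second argument to the first, and orthogonality follows by induction on the degree of the second
  argument; the norms come out of the same recursion.
\<close>

section \<open>Calculus in the field of meromorphic functions\<close>

text \<open>\<open>A\<close> is known only by generators and relations, so coefficients in A
  \<otimes>~ A are compared through functionals that provably kill a two-sided ideal. Reading off
  the v_n-coefficient of y v_0 qualifies: it is left linear over functions of \<lambda>, as the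
  balancing f(\<mu>)x \<otimes> y = x \<otimes> f(\<lambda>)y demands, and both tensor factors share
  their middle degree. Raising gives one equation for two unknown products. The lowering equation
  exists because of the determinant: only the inhomogeneous terms of \<alpha>\<delta>,
  \<delta>\<alpha> and \<beta>\<gamma> let level N - 1 appear. A coefficient in both variables lives
  in M \<otimes> M, so left and right factors are kept apart; this works because the coefficients of
  the four product rules and the norms are products of a function of \<lambda> and one of \<mu>. In
  the final induction the second degree drops to N while the first degree M becomes M + 1 or M - 1,
  so only two cases can be nonzero: for M + 1 = N two terms cancel, for M - 1 = N they add up to the
  norm recursion.\<close>

lemma eventually_at_shift:
  fixes z c :: complex
  assumes "eventually P (at (z + c))"
  shows   "eventually (\<lambda>w. P (w + c)) (at z)"
proof -
  have "filtermap (\<lambda>w. w + c) (at z) = at (z + c)"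
    using filtermap_at_shift[of "-c" z] by simp
  with assms show ?thesis by (metis eventually_filtermap)
qed

lemma eventually_at_cnj:
  assumes "eventually P (at (cnj z))"
  shows   "eventually (\<lambda>w. P (cnj w)) (at z)"
  using assms filtermap_cnj_at[of z] by (metis eventually_filtermap)

lemma to_mero_eqI:
  assumes "f meromorphic_on UNIV" "\<And>z. eventually (\<lambda>w. Rep_mero F w = f w) (at z)"
  shows   "to_mero f = F"
  by (rule mero_eqI, use ev_Rep_to_mero[OF assms(1)] assms(2) in eventually_elim) simp

lemma ev_const_mero: "eventually (\<lambda>w. Rep_mero (const_mero c) w = c) (at z)"
  unfolding const_mero_def by (rule ev_Rep_to_mero) (intro meromorphic_intros)

lemma to_mero_hom:
  assumes "f meromorphic_on UNIV" "g meromorphic_on UNIV"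
  shows "to_mero (\<lambda>x. f x + g x) = to_mero f + to_mero g"
        "to_mero (\<lambda>x. f x - g x) = to_mero f - to_mero g"
        "to_mero (\<lambda>x. f x * g x) = to_mero f * to_mero g"
        "to_mero (\<lambda>x. f x / g x) = to_mero f / to_mero g"
proof -
  note ev = ev_Rep_to_mero[OF assms(1)] ev_Rep_to_mero[OF assms(2)]
  note mer = meromorphic_on_add[OF assms] meromorphic_on_diff[OF assms] meromorphic_on_mult[OF assms]
    meromorphic_on_divide[OF assms]
  show "to_mero (\<lambda>x. f x + g x) = to_mero f + to_mero g"
    by (rule to_mero_eqI[OF mer(1)], use ev_mero(3)[of "to_mero f" "to_mero g"] ev in eventually_elim) simp
  show "to_mero (\<lambda>x. f x - g x) = to_mero f - to_mero g"
    by (rule to_mero_eqI[OF mer(2)], use ev_mero(4)[of "to_mero f" "to_mero g"] ev in eventually_elim) simp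
  show "to_mero (\<lambda>x. f x * g x) = to_mero f * to_mero g"
    by (rule to_mero_eqI[OF mer(3)], use ev_mero(6)[of "to_mero f" "to_mero g"] ev in eventually_elim) simp
  show "to_mero (\<lambda>x. f x / g x) = to_mero f / to_mero g"
    by (rule to_mero_eqI[OF mer(4)], use ev_mero(8)[of "to_mero f" "to_mero g"] ev in eventually_elim) simp
qed

lemma to_mero_const [simp]: "to_mero (\<lambda>_. c) = const_mero c"
  by (simp add: const_mero_def)

lemma const_mero_0 [simp]: "const_mero 0 = 0"
  and const_mero_1 [simp]: "const_mero 1 = 1"
  by (simp_all only: const_mero_def zero_mero_def one_mero_def)

lemma const_mero_hom:
  "const_mero (a + b) = const_mero a + const_mero b"
  "const_mero (a - b) = const_mero a - const_mero b"
  "const_mero (a * b) = const_mero a * const_mero b"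
  "const_mero (a / b) = const_mero a / const_mero b"
  by (rule to_mero_hom[of "\<lambda>_. a" "\<lambda>_. b", OF meromorphic_on_const meromorphic_on_const, unfolded to_mero_const])+

lemma const_mero_uminus: "const_mero (- a) = - const_mero a"
  using const_mero_hom(2)[of 0 a] by simp

lemma const_mero_inverse: "const_mero (inverse a) = inverse (const_mero a)"
  using const_mero_hom(4)[of 1 a] by (simp add: divide_inverse)

lemma const_mero_power: "const_mero (a ^ n) = const_mero a ^ n"
  by (induction n) (simp_all add: const_mero_hom)

lemma const_mero_power_int: "const_mero (a powi n) = const_mero a powi n"
  by (simp add: power_int_def const_mero_power const_mero_inverse)

lemma const_mero_eq_iff: "const_mero a = const_mero b \<longleftrightarrow> a = b"
proof
  assume *: "const_mero a = const_mero b"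
  have "eventually (\<lambda>w::complex. a = b) (at 0)"
    using ev_const_mero[of a 0] ev_const_mero[of b 0] unfolding * by eventually_elim simp
  thus "a = b" by simp
qed auto

text \<open>Only integer shifts occur, because the bigrading is integral; an integer argument lets
  them compose by index arithmetic.\<close>

definition sh :: "int \<Rightarrow> mero \<Rightarrow> mero" where
  "sh k = shift_mero (of_int k)"

lemma Rep_sh: "Rep_mero (sh k f) x = Rep_mero f (x + of_int k)"
  by (simp add: sh_def Rep_shift_mero)

lemma sh_hom:
  "sh k (f + g) = sh k f + sh k g" "sh k (f - g) = sh k f - sh k g"
  "sh k (f * g) = sh k f * sh k g" "sh k (f / g) = sh k f / sh k g" "sh k (- f) = - sh k f"
  "sh k (inverse f) = inverse (sh k f)"
proof -
  show "sh k (f + g) = sh k f + sh k g"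
    by (rule mero_eqI, use eventually_at_shift[where c = "of_int k", OF ev_mero(3)[of f g]] ev_mero(3)[of "sh k f" "sh k g"] in eventually_elim) (simp add: Rep_sh)
  show "sh k (f - g) = sh k f - sh k g"
    by (rule mero_eqI, use eventually_at_shift[where c = "of_int k", OF ev_mero(4)[of f g]] ev_mero(4)[of "sh k f" "sh k g"] in eventually_elim) (simp add: Rep_sh)
  show "sh k (f * g) = sh k f * sh k g"
    by (rule mero_eqI, use eventually_at_shift[where c = "of_int k", OF ev_mero(6)[of f g]] ev_mero(6)[of "sh k f" "sh k g"] in eventually_elim) (simp add: Rep_sh)
  show "sh k (f / g) = sh k f / sh k g"
    by (rule mero_eqI, use eventually_at_shift[where c = "of_int k", OF ev_mero(8)[of f g]] ev_mero(8)[of "sh k f" "sh k g"] in eventually_elim) (simp add: Rep_sh)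
  show "sh k (- f) = - sh k f"
    by (rule mero_eqI, use eventually_at_shift[where c = "of_int k", OF ev_mero(5)[of f]] ev_mero(5)[of "sh k f"] in eventually_elim) (simp add: Rep_sh)
  show "sh k (inverse f) = inverse (sh k f)"
    by (rule mero_eqI, use eventually_at_shift[where c = "of_int k", OF ev_mero(7)[of f]] ev_mero(7)[of "sh k f"] in eventually_elim) (simp add: Rep_sh)
qed

lemma sh_const [simp]: "sh k (const_mero c) = const_mero c"
  by (rule mero_eqI, use eventually_at_shift[where c = "of_int k", OF ev_const_mero[of c]] ev_const_mero[of c]
      in eventually_elim) (simp add: Rep_sh)

lemma sh_01 [simp]: "sh k 0 = 0" "sh k 1 = 1"
  using sh_const[of k 0] sh_const[of k 1] by simp_all

lemma sh_sh [simp]: "sh k (sh l f) = sh (k + l) f"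
  by (rule mero_eqI) (simp add: Rep_sh algebra_simps)

lemma sh_0 [simp]: "sh 0 f = f"
  by (rule mero_eqI) (simp add: Rep_sh)

lemma sh_power: "sh k (f ^ n) = sh k f ^ n"
  by (induction n) (simp_all add: sh_hom)

lemma sh_power_int: "sh k (f powi n) = sh k f powi n"
  by (simp add: power_int_def sh_power sh_hom)

lemma cnj_mero_hom:
  "cnj_mero (f + g) = cnj_mero f + cnj_mero g" "cnj_mero (f - g) = cnj_mero f - cnj_mero g"
  "cnj_mero (f * g) = cnj_mero f * cnj_mero g" "cnj_mero (f / g) = cnj_mero f / cnj_mero g"
  "cnj_mero (inverse f) = inverse (cnj_mero f)"
proof -
  note ev = ev_mero[THEN eventually_at_cnj]
  show "cnj_mero (f + g) = cnj_mero f + cnj_mero g"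
    by (rule mero_eqI, use ev(3)[of f g] ev_mero(3)[of "cnj_mero f" "cnj_mero g"] in eventually_elim) (simp add: Rep_cnj_mero)
  show "cnj_mero (f - g) = cnj_mero f - cnj_mero g"
    by (rule mero_eqI, use ev(4)[of f g] ev_mero(4)[of "cnj_mero f" "cnj_mero g"] in eventually_elim) (simp add: Rep_cnj_mero)
  show "cnj_mero (f * g) = cnj_mero f * cnj_mero g"
    by (rule mero_eqI, use ev(6)[of f g] ev_mero(6)[of "cnj_mero f" "cnj_mero g"] in eventually_elim) (simp add: Rep_cnj_mero)
  show "cnj_mero (f / g) = cnj_mero f / cnj_mero g"
    by (rule mero_eqI, use ev(8)[of f g] ev_mero(8)[of "cnj_mero f" "cnj_mero g"] in eventually_elim) (simp add: Rep_cnj_mero)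
  show "cnj_mero (inverse f) = inverse (cnj_mero f)"
    by (rule mero_eqI, use ev(7)[of f] ev_mero(7)[of "cnj_mero f"] in eventually_elim) (simp add: Rep_cnj_mero)
qed

lemma cnj_mero_const: "cnj_mero (const_mero c) = const_mero (cnj c)"
  by (rule mero_eqI, use eventually_at_cnj[OF ev_const_mero[of c]] ev_const_mero[of "cnj c"]
      in eventually_elim) (simp add: Rep_cnj_mero)

lemma cnj_mero_01 [simp]: "cnj_mero 0 = 0" "cnj_mero 1 = 1"
  using cnj_mero_const[of 0] cnj_mero_const[of 1] by simp_all

lemma cnj_mero_power: "cnj_mero (f ^ n) = cnj_mero f ^ n"
  by (induction n) (simp_all add: cnj_mero_hom)

lemma cnj_mero_power_int: "cnj_mero (f powi n) = cnj_mero f powi n"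
  by (simp add: power_int_def cnj_mero_power cnj_mero_hom)


section \<open>Rational functions of the exponential\<close>

locale quantum_parameter =
  fixes q :: real
  assumes q_pos: "0 < q" and q_less_1: "q < 1"
begin

definition p :: mero where "p = const_mero (of_real q)"

definition Y :: mero where "Y = to_mero (\<lambda>x. qexp q (2 * x))"

text \<open>As a function of x this is q^(2(x+n)) - 1. Up to constants and powers of
  \<open>Y\<close> the coefficient functions are quotients of such factors, and a shift by k merely
  replaces n by n + k.\<close>

definition br :: "int \<Rightarrow> mero" where "br n = p powi (2 * n) * Y - 1"

text \<open>A constant, but kept inside the function field so that all identities below live in a
  single field.\<close>

definition num :: "int \<Rightarrow> mero" where "num n = 1 - p powi (2 * n)"

lemma qexp_add: "qexp q (x + y) = qexp q x * qexp q y"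
  by (simp add: qexp_def exp_add distrib_right)

lemma qexp_of_int: "qexp q (of_int n) = of_real q powi n"
proof -
  have "qexp q (of_nat m) = of_real q ^ m" for m
    using q_pos by (simp add: qexp_def exp_of_nat_mult exp_of_real)
  moreover have "qexp q (- x) = inverse (qexp q x)" for x
    by (simp add: qexp_def exp_minus)
  ultimately show ?thesis
    by (cases n rule: int_cases2) (simp_all add: power_int_minus)
qed

lemma qexp_meromorphic: "(\<lambda>x. qexp q (a * x + b)) meromorphic_on A"
  unfolding qexp_def by (intro analytic_on_imp_meromorphic_on analytic_intros)

lemma qexp_meromorphic' [meromorphic_intros]: "(\<lambda>x. qexp q (2 * x)) meromorphic_on A"
  using qexp_meromorphic[of 2 0] by simp

lemma p_nz [simp]: "p \<noteq> 0"
  using const_mero_eq_iff[of "of_real q" 0] q_pos by (simp add: p_def)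

lemma p_power_int_const: "p powi n = const_mero (of_real (q powi n))"
  by (simp add: p_def const_mero_power_int)

lemma const_mero_qexp: "const_mero (qexp q (of_int n)) = p powi n"
  by (simp only: qexp_of_int p_power_int_const of_real_power_int)

text \<open>q is not a root of unity, since its powers are strictly monotone in the exponent. Hence
  \<open>num n\<close> is invertible for n \<noteq> 0, and the linear systems for the product rules
  can be solved.\<close>

lemma p_power_int_eq_1_iff [simp]: "p powi n = 1 \<longleftrightarrow> n = 0"
proof -
  have "p powi n = 1 \<longleftrightarrow> q powi n = 1"
    using const_mero_eq_iff[of "of_real (q powi n)" 1] of_real_eq_iff[of "q powi n" 1, where ?'a = complex]
    unfolding p_power_int_const by (simp del: of_real_eq_1_iff of_real_power_int)
  also have "\<dots> \<longleftrightarrow> n = 0"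
  proof (cases n "0 :: int" rule: linorder_cases)
    case less
    have "q powi n > q powi 0"
      using less q_pos q_less_1 by (intro power_int_strict_decreasing) auto
    thus ?thesis using less by auto
  next
    case greater
    have "q powi n < q powi 0"
      using greater q_pos q_less_1 by (intro power_int_strict_decreasing) auto
    thus ?thesis using greater by auto
  qed auto
  finally show ?thesis .
qed

lemma num_eq_0_iff [simp]: "num n = 0 \<longleftrightarrow> n = 0"
  by (auto simp: num_def)

lemma num_0 [simp]: "num 0 = 0" by (simp add: num_def)

lemma sh_p [simp]: "sh k p = p" and sh_p_power_int [simp]: "sh k (p powi n) = p powi n"
  by (simp_all add: p_def sh_power_int)

lemma sh_num [simp]: "sh k (num n) = num n"
  by (simp add: num_def sh_hom)

lemma to_mero_qexp: "to_mero (\<lambda>x. qexp q (2 * (x + of_int n))) = p powi (2 * n) * Y"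
proof -
  have "qexp q (2 * (x + of_int n)) = of_real (q powi (2 * n)) * qexp q (2 * x)" for x
    using qexp_add[of "2 * x" "of_int (2 * n)"] qexp_of_int[of "2 * n"]
    by (simp add: algebra_simps)
  thus ?thesis
    unfolding Y_def by (simp add: to_mero_hom meromorphic_intros p_power_int_const)
qed

lemma sh_Y: "sh k Y = p powi (2 * k) * Y"
proof -
  have "sh k Y = to_mero (\<lambda>x. qexp q (2 * (x + of_int k)))"
  proof (rule to_mero_eqI[symmetric])
    show "(\<lambda>x. qexp q (2 * (x + of_int k))) meromorphic_on UNIV"
      using qexp_meromorphic[of 2 "2 * of_int k"] by (simp add: algebra_simps)
    show "\<forall>\<^sub>F w in at z. Rep_mero (sh k Y) w = qexp q (2 * (w + complex_of_int k))" for z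
      using eventually_at_shift[where c = "of_int k" and z = z, OF ev_Rep_to_mero[OF qexp_meromorphic']]
      by (simp add: Rep_sh Y_def)
  qed
  thus ?thesis by (simp only: to_mero_qexp)
qed

lemma sh_br [simp]: "sh k (br n) = br (n + k)"
  by (simp add: br_def sh_hom sh_Y power_int_add[of p] algebra_simps)

lemma Y_nz [simp]: "Y \<noteq> 0"
proof
  assume *: "Y = 0"
  have "eventually (\<lambda>w. qexp q (2 * w) = 0) (at 0)"
    using ev_Rep_to_mero[OF qexp_meromorphic', of 0] ev_mero(1)[of 0]
    unfolding Y_def[symmetric] * by eventually_elim simp
  thus False by (simp add: qexp_def)
qed

text \<open>If \<open>br n\<close> vanished, so would its shift \<open>br (n + 1)\<close>; then
  q^(2n) \<open>Y\<close> and q^(2n+2) \<open>Y\<close> would both equal 1, forcing q^2 = 1.\<close>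

lemma br_nz [simp]: "br n \<noteq> 0"
proof
  assume *: "br n = 0"
  hence "sh 1 (br n) = 0" by (simp only: sh_01)
  hence "br (n + 1) = 0" by (simp only: sh_br)
  hence "p powi (2 * n + 2) * Y = 1" by (simp add: br_def distrib_left)
  moreover have "p powi (2 * n + 2) = p powi (2 * n) * p powi 2"
    by (rule power_int_add) simp
  ultimately have "(p powi (2 * n) * Y) * p powi 2 = 1" by (simp only: mult_ac)
  moreover have "p powi (2 * n) * Y = 1" using * by (simp add: br_def)
  ultimately have "p powi 2 = 1" by (simp only: mult_1_left)
  thus False by (simp only: p_power_int_eq_1_iff)
qed

lemma cnj_p [simp]: "cnj_mero p = p" 
  by (simp add: p_def cnj_mero_const)

lemma cnj_Y [simp]: "cnj_mero Y = Y"
proof (rule mero_eqI)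
  fix z
  have "eventually (\<lambda>w. Rep_mero Y w = qexp q (2 * w)) (at z)" for z
    unfolding Y_def by (intro ev_Rep_to_mero meromorphic_intros)
  from this[of z] eventually_at_cnj[OF this[of "cnj z"]]
  show "\<forall>\<^sub>F w in at z. Rep_mero (cnj_mero Y) w = Rep_mero Y w"
  proof eventually_elim
    case (elim w)
    have "cnj (qexp q (2 * cnj w)) = qexp q (2 * w)"
      by (simp add: qexp_def exp_cnj)
    thus ?case using elim by (simp add: Rep_cnj_mero)
  qed
qed

lemma cnj_br [simp]: "cnj_mero (br n) = br n"
  by (simp add: br_def cnj_mero_hom cnj_mero_power_int)

lemma cnj_num [simp]: "cnj_mero (num n) = num n"
  by (simp add: num_def cnj_mero_hom cnj_mero_power_int)

text \<open>
  \<open>ff\<close> is \<open>qF\<close>, and \<open>gg(x) = 1 / ff(x - 1)\<close>. In these terms \<open>G = ff \<cdot> gg\<close>, \<open>H(\<lambda>, \<mu>) = ff(\<lambda>) - gg(\<mu>)\<close> and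
  \<open>I(\<lambda>, \<mu>) = ff(\<lambda>) - ff(\<mu>)\<close>, because \<open>ff + gg = q + q\<^sup>-\<^sup>1\<close>. Together with \<open>c = 1\<close> the quadratic relations
  become \<open>\<alpha>\<delta> = 1 + ff(\<lambda>)\<gamma>\<beta>\<close>, \<open>\<delta>\<alpha> = 1 + gg(\<mu>)\<gamma>\<beta>\<close> and \<open>\<beta>\<gamma> = ff(\<lambda>)\<delta>\<alpha> - ff(\<mu>)\<close>.
\<close>

definition ff :: mero where "ff = br 2 / (p * br 1)"

definition gg :: mero where "gg = p * br 0 / br 1"

lemma to_mero_qexp_diff: "to_mero (\<lambda>x. qexp q (2 * (x + of_int n)) - c) = p powi (2 * n) * Y - const_mero c"
proof -
  have "(\<lambda>x. qexp q (2 * (x + of_int n))) meromorphic_on UNIV"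
    using qexp_meromorphic[of 2 "2 * of_int n"] by (simp add: algebra_simps)
  thus ?thesis by (subst to_mero_hom) (auto intro: meromorphic_intros simp: to_mero_qexp simp del: distrib_left_numeral)
qed

lemma p_powi_add: "p powi (m + n) = p powi m * p powi n"
  by (simp add: power_int_add)

text \<open>
  The addition formula to which both the Clebsch--Gordan coefficients and the recursions of the norms
  reduce.
\<close>

lemma key_identity:
  "p powi (2 * n) * num (m + 1) * br (- m) + num n * br (n + 1) = num (m + n + 1) * br (n - m)"
proof -
  define a b where "a = p powi (2 * m)" and "b = p powi (2 * n)"
  have [simp]: "a \<noteq> 0" by (simp add: a_def)
  have E: "num (m + 1) = 1 - p\<^sup>2 * a" "br (- m) = Y / a - 1" "num n = 1 - b" "br (n + 1) = p\<^sup>2 * b * Y - 1"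
    "num (m + n + 1) = 1 - p\<^sup>2 * a * b" "br (n - m) = b * Y / a - 1"
    by (simp_all add: num_def br_def a_def b_def power_int_add power_int_diff power_int_minus distrib_left right_diff_distrib field_simps)
  show ?thesis unfolding b_def[symmetric] E by (simp add: field_simps)
qed

text \<open>
  \<open>psi\<close> arises from moving \<open>\<gamma>\<close> past \<open>\<gamma>\<^sup>N\<^sup>-\<^sup>j\<alpha>\<^sup>j\<close>; \<open>ws\<close> and \<open>xi\<close> are the coefficients of the combinations of
  products with a generator that lower \<open>N\<close>, and \<open>cc\<close> is an auxiliary factor of their induction step.
\<close>

definition psi :: "int \<Rightarrow> int \<Rightarrow> mero" where
  "psi N j = p powi (- j) * br (N - j + 2) / br (N - 2 * j + 2)"

definition ws :: "int \<Rightarrow> int \<Rightarrow> mero" where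
  "ws N i = p powi (2 * N - 3 * i - 1) * num (i + 1) * br (- i) / br (N - 2 * i)"

definition cc :: "int \<Rightarrow> int \<Rightarrow> mero" where
  "cc N i = p powi (1 - i) * br (N + 1 - i) / br (N + 1 - 2 * i)"

definition xi :: "int \<Rightarrow> int \<Rightarrow> mero" where
  "xi N k = - (p powi (2 * N + 1 - 2 * k)) * num k * br (1 - k) / br (N + 2 - 2 * k)"

text \<open>Up to sign, the determinant of the two equations for the products of a row with a pair
  of generators. By \<open>key_identity\<close> at m = i, n = N - i the bracket in the denominator
  cancels, so the determinant is a constant.\<close>

lemma ws_psi: "ws N i + num (N - i) * psi N (i + 1) = p powi (- i - 1) * num (N + 1)"
proof -
  have "p powi (2 * N - 3 * i - 1) = p powi (- i - 1) * p powi (2 * (N - i))"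
    by (subst p_powi_add[symmetric], rule arg_cong[where f = "(powi) p"]) simp
  hence "ws N i + num (N - i) * psi N (i + 1) =
      p powi (- i - 1) * (p powi (2 * (N - i)) * num (i + 1) * br (- i) + num (N - i) * br (N - i + 1)) / br (N - 2 * i)"
    unfolding ws_def psi_def by (simp add: add_divide_distrib algebra_simps minus_diff_commute)
  also have "\<dots> = p powi (- i - 1) * num (N + 1)"
    using key_identity[of "N - i" i] by (simp add: algebra_simps)
  finally show ?thesis .
qed

text \<open>Moving \<open>gg\<close> in front of an element of column i shifts it by N - 2i. The
  right side splits the result into a term that already belongs to level N + 1 and one to which the
  level N rule still applies.\<close>

lemma gg_ws_cc: "p powi (- i) * num (N + 1) * sh (N - 2 * i) gg = ws (N + 1) i + num (N - i) * cc N i"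
proof -
  have "p powi (2 * (N + 1) - 3 * i - 1) = p powi (1 - i) * p powi (2 * (N - i))"
    by (subst p_powi_add[symmetric], rule arg_cong[where f = "(powi) p"]) simp
  hence "ws (N + 1) i + num (N - i) * cc N i =
      p powi (1 - i) * (p powi (2 * (N - i)) * num (i + 1) * br (- i) + num (N - i) * br (N - i + 1)) / br (N + 1 - 2 * i)"
    by (simp add: ws_def cc_def add_divide_distrib algebra_simps)
  also have "\<dots> = p powi (1 - i) * (num (N + 1) * br (N - 2 * i)) / br (N + 1 - 2 * i)"
    using key_identity[of "N - i" i] by (simp add: algebra_simps)
  also have "\<dots> = p powi (- i) * num (N + 1) * sh (N - 2 * i) gg"
    by (simp add: gg_def sh_hom power_int_diff power_int_minus algebra_simps divide_inverse)
  finally show ?thesis ..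
qed

text \<open>After the level N rule is applied to the \<open>cc\<close> part of
  \<open>gg_ws_cc\<close>, this turns the outcome into exactly the \<open>psi\<close> term of the
  raised element in column i + 1.\<close>

lemma ws_psi_cc: "ws (N + 1) i * psi N (i + 1) = cc N i * ws N i"
proof -
  have 1: "p powi (2 * (N + 1) - 3 * i - 1) * p powi (- (i + 1)) = p powi (1 - i) * p powi (2 * N - 3 * i - 1)"
    unfolding p_powi_add[symmetric] by (rule arg_cong[where f = "(powi) p"]) simp
  have 2: "N - (i + 1) + 2 = N + 1 - i" "N - 2 * (i + 1) + 2 = N - 2 * i" by simp_all
  have "ws (N + 1) i * psi N (i + 1) = (p powi (2 * (N + 1) - 3 * i - 1) * p powi (- (i + 1))) *
      num (i + 1) * br (- i) * br (N + 1 - i) / (br (N + 1 - 2 * i) * br (N - 2 * i))"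
    unfolding ws_def psi_def 2 by (simp add: divide_inverse mult_ac)
  also have "\<dots> = cc N i * ws N i"
    unfolding 1 ws_def cc_def by (simp add: divide_inverse mult_ac)
  finally show ?thesis .
qed

text \<open>The reason why the remainders of the induction step recombine into a raising formula one
  level lower.\<close>

lemma cc_psi: "cc N i = p * psi (N - 1) i"
  by (simp add: cc_def psi_def power_int_diff power_int_minus field_simps)

lemma psi_ff: "psi N i * sh (N - 2 * i) ff = psi (N + 1) (i + 1)"
  by (simp add: psi_def ff_def sh_hom power_int_diff power_int_minus algebra_simps divide_inverse)

lemma ws_psi_ff: "ws (N + 1) i + num (N + 1 - i) * psi N i * sh (N - 2 * i) ff = p powi (- i - 1) * num (N + 2)"
  using ws_psi[of "N + 1" i] by (simp add: mult.assoc psi_ff add.commute[of 2])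

text \<open>The recursion imposed on the lowering coefficient when a row is raised by \<alpha> and
  \<beta>; \<open>xi\<close> is its closed solution starting from \<open>xi N 0 = 0\<close>. With a
  = q^(2k) and b = q^(2N) it becomes a rational identity.\<close>

lemma xi_rec: "xi (N + 1) (k + 1) = sh (N - 2 * k) ff * (p * xi N k + num (N + 1)) - inverse p * num (N + 2)"
proof -
  define a b where "a = p powi (2 * k)" and "b = p powi (2 * N)"
  have [simp]: "a \<noteq> 0" "b \<noteq> 0" by (simp_all add: a_def b_def)
  have E: "num (k + 1) = 1 - p\<^sup>2 * a" "br (- k) = Y / a - 1" "num k = 1 - a" "br (1 - k) = p\<^sup>2 * Y / a - 1"
    "p powi (2 * N + 1 - 2 * k) = p * b / a"
    by (simp_all add: num_def br_def a_def b_def power_int_add power_int_diff power_int_minus distrib_left right_diff_distrib field_simps)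
  have "p powi (2 * N + 2) = b * p\<^sup>2" "p powi (2 * N + 4) = b * p ^ 4"
    unfolding p_powi_add b_def by simp_all
  hence E': "num (N + 1) = 1 - p\<^sup>2 * b" "num (N + 2) = 1 - p ^ 4 * b"
    by (simp_all add: num_def distrib_left mult.commute[of b])
  have B: "br (N + 1 - 2 * k) = p\<^sup>2 * b * Y / (a * a) - 1" "br (N + 2 - 2 * k) = p ^ 4 * b * Y / (a * a) - 1"
  proof -
    have a2: "p powi (4 * k) = a * a" by (simp add: a_def flip: p_powi_add)
    show "br (N + 1 - 2 * k) = p\<^sup>2 * b * Y / (a * a) - 1" "br (N + 2 - 2 * k) = p ^ 4 * b * Y / (a * a) - 1"
      by (simp_all add: br_def power_int_add power_int_diff distrib_left right_diff_distrib a2 b_def[symmetric])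
  qed
  let ?B = "br (N + 1 - 2 * k)"
  have "(- (p * b / a) * num (k + 1) * br (- k)) =
     - (p * b / a) * num k * br (1 - k) + (inverse p * br (N + 2 - 2 * k) * num (N + 1) - inverse p * num (N + 2) * ?B)"
    unfolding E E' B by (simp add: field_simps power2_eq_square power4_eq_xxxx)
  hence "(- (p * b / a) * num (k + 1) * br (- k)) / ?B =
     (- (p * b / a) * num k * br (1 - k) + (inverse p * br (N + 2 - 2 * k) * num (N + 1) - inverse p * num (N + 2) * ?B)) / ?B"
    by (rule arg_cong)
  also have "\<dots> = sh (N - 2 * k) ff * (p * xi N k + num (N + 1)) - inverse p * num (N + 2)"
    unfolding xi_def E(5) by (simp add: ff_def sh_hom add_ac diff_add_eq diff_divide_distrib add_divide_distrib algebra_simps)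
      (simp add: field_simps)
  finally have "(- (p * b / a) * num (k + 1) * br (- k)) / ?B =
     sh (N - 2 * k) ff * (p * xi N k + num (N + 1)) - inverse p * num (N + 2)" .
  moreover have "2 * (N + 1) + 1 - 2 * (k + 1) = 2 * N + 1 - 2 * k" "1 - (k + 1) = - k" "N + 1 + 2 - 2 * (k + 1) = N + 1 - 2 * k"
    by simp_all
  hence "xi (N + 1) (k + 1) = (- (p * b / a) * num (k + 1) * br (- k)) / ?B"
    by (simp only: xi_def E(5))
  ultimately show ?thesis by simp
qed

end

section \<open>The algebra as a bimodule over the meromorphic functions\<close>

lemma ideal_SL2_facts:
  "0 \<in> ideal_SL2 q"
  "x \<in> ideal_SL2 q \<Longrightarrow> y \<in> ideal_SL2 q \<Longrightarrow> x + y \<in> ideal_SL2 q"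
  "x \<in> ideal_SL2 q \<Longrightarrow> y \<in> ideal_SL2 q \<Longrightarrow> x - y \<in> ideal_SL2 q"
  "x \<in> ideal_SL2 q \<Longrightarrow> - x \<in> ideal_SL2 q"
  "x \<in> ideal_SL2 q \<Longrightarrow> y * x \<in> ideal_SL2 q"
  "x \<in> ideal_SL2 q \<Longrightarrow> x * y \<in> ideal_SL2 q"
proof -
  interpret ideal "ideal_SL2 q" free_ring by (rule ideal_ideal_SL2)
  show "0 \<in> ideal_SL2 q"
    using additive_subgroup.zero_closed[OF is_additive_subgroup] by (simp add: free_ring_def)
  show add: "x \<in> ideal_SL2 q \<Longrightarrow> y \<in> ideal_SL2 q \<Longrightarrow> x + y \<in> ideal_SL2 q" for x y
    using additive_subgroup.a_closed[OF is_additive_subgroup] by (simp add: free_ring_def)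
  show l: "x \<in> ideal_SL2 q \<Longrightarrow> y * x \<in> ideal_SL2 q" for x y
    using I_l_closed by (simp add: free_ring_def)
  show "x \<in> ideal_SL2 q \<Longrightarrow> x * y \<in> ideal_SL2 q" for x y
    using I_r_closed by (simp add: free_ring_def)
  show neg: "x \<in> ideal_SL2 q \<Longrightarrow> - x \<in> ideal_SL2 q" for x
    using l[of x "-1"] by simp
  show "x \<in> ideal_SL2 q \<Longrightarrow> y \<in> ideal_SL2 q \<Longrightarrow> x - y \<in> ideal_SL2 q"
    using add[of x "-y"] neg[of y] by simp
qed

lemma cls_altdef: "cls q x = {i + x |i. i \<in> ideal_SL2 q}"
  by (auto simp: cls_def a_r_coset_def r_coset_def free_ring_def)

lemma cls_eq_iff: "cls q x = cls q y \<longleftrightarrow> x - y \<in> ideal_SL2 q"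
proof
  assume "cls q x = cls q y"
  moreover have "x \<in> cls q x" using ideal_SL2_facts(1) by (force simp: cls_altdef)
  ultimately show "x - y \<in> ideal_SL2 q" by (auto simp: cls_altdef)
next
  assume *: "x - y \<in> ideal_SL2 q"
  show "cls q x = cls q y"
  proof (intro equalityI subsetI)
    fix z assume "z \<in> cls q x"
    then obtain i where "z = i + x" "i \<in> ideal_SL2 q" by (auto simp: cls_altdef)
    thus "z \<in> cls q y"
      using * ideal_SL2_facts(2)[of i q "x - y"] by (force simp: cls_altdef intro: exI[of _ "i + (x - y)"])
  next
    fix z assume "z \<in> cls q y"
    then obtain i where "z = i + y" "i \<in> ideal_SL2 q" by (auto simp: cls_altdef)
    thus "z \<in> cls q x"
      using * ideal_SL2_facts(3)[of i q "x - y"] by (force simp: cls_altdef intro: exI[of _ "i - (x - y)"])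
  qed
qed

lemma cls_relator: "rel_M2 q x y \<Longrightarrow> cls q x = cls q y"
  unfolding cls_eq_iff ideal_SL2_def
  using ring.genideal_self[OF ring_free_ring, of "relators_SL2 q"]
  by (auto simp: relators_SL2_def free_ring_def)

lemma cls_det: "cls q (det_c q) = \<one>\<^bsub>FSL2 q\<^esub>"
  unfolding cls_simps(3)[symmetric] cls_eq_iff ideal_SL2_def
  using ring.genideal_self[OF ring_free_ring, of "relators_SL2 q"]
  by (auto simp: relators_SL2_def free_ring_def)

lemma FSL2_carrier: "carrier (FSL2 q) = range (cls q)"
  by (auto simp: FSL2_def cls_def FactRing_def A_RCOSETS_defs a_r_coset_def r_coset_def free_ring_def)

lemma scal_hom:
  "scal (c + d) = scal c + scal d" "scal (c * d) = scal c * scal d" "scal 1 = 1" "scal 0 = 0"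
  by (simp_all add: scal_def single_add mult_single)

lemma free_sum_words:
  "(x :: fr_free) = (\<Sum>w\<in>Poly_Mapping.keys x. Poly_Mapping.single w (Poly_Mapping.lookup x w))"
  by (rule poly_mapping_eqI) (auto simp: lookup_sum lookup_single when_def in_keys_iff sum.delta)

lemma scal_commute: "scal c * x = x * scal c"
  by (subst (1 2) free_sum_words[of x])
     (simp add: sum_distrib_left sum_distrib_right scal_def mult_single mult.commute)

lemma single_Word: "Poly_Mapping.single (Word gs) c = scal c * prod_list (map gen gs)"
proof (induction gs)
  case (Cons g gs)
  have "Poly_Mapping.single (Word (g # gs)) c = gen g * Poly_Mapping.single (Word gs) c"
    by (simp add: gen_def mult_single)
  also have "\<dots> = gen g * scal c * prod_list (map gen gs)"
    by (simp only: Cons mult.assoc)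
  also have "gen g * scal c = scal c * gen g" by (simp only: scal_commute)
  finally show ?case by (simp add: mult.assoc)
qed (simp add: scal_def zero_fr_word_def)

locale dynamical_SL2 = quantum_parameter
begin

abbreviation A where "A \<equiv> FSL2 q"

sublocale A: ring "FSL2 q" by (rule ring_FSL2)

abbreviation mul (infixl "\<cdot>" 70) where "x \<cdot> y \<equiv> x \<otimes>\<^bsub>FSL2 q\<^esub> y"
abbreviation add (infixl "\<uplus>" 65) where "x \<uplus> y \<equiv> x \<oplus>\<^bsub>FSL2 q\<^esub> y"
abbreviation "oneA \<equiv> \<one>\<^bsub>FSL2 q\<^esub>"
abbreviation "zeroA \<equiv> \<zero>\<^bsub>FSL2 q\<^esub>"
abbreviation "\<alpha> \<equiv> gen_cls q Alpha"
abbreviation "\<beta> \<equiv> gen_cls q Beta"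
abbreviation "\<gamma> \<equiv> gen_cls q Gamma"
abbreviation "\<delta> \<equiv> gen_cls q Delta"
abbreviation "L \<equiv> lam_cls q"
abbreviation "R \<equiv> mu_cls q"

lemma cls_closed [simp, intro]: "cls q x \<in> carrier A" "gen_cls q g \<in> carrier A"
  by (simp_all add: FSL2_carrier gen_cls_def)

lemma cls_sub: "cls q (x - y) = cls q x \<ominus>\<^bsub>A\<^esub> cls q y"
proof -
  have "cls q (x - y) \<uplus> cls q y = cls q x" by (simp add: cls_simps)
  thus ?thesis
    by (metis A.add.inv_solve_right A.minus_eq cls_closed(1))
qed

lemma L_hom:
  "L (f + g) = L f \<uplus> L g" "L (f * g) = L f \<cdot> L g" "L 1 = oneA" "L (const_mero c) = scal_cls q c"
  using cls_relator[OF lam_add[of q f g]] cls_relator[OF lam_mult[of q f g]]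
    cls_relator[OF lam_const[of q 1]] cls_relator[OF lam_const[of q c]]
  by (simp_all add: gen_cls_def cls_simps scal_hom)

lemma R_hom:
  "R (f + g) = R f \<uplus> R g" "R (f * g) = R f \<cdot> R g" "R 1 = oneA" "R (const_mero c) = scal_cls q c"
  using cls_relator[OF mu_add[of q f g]] cls_relator[OF mu_mult[of q f g]]
    cls_relator[OF mu_const[of q 1]] cls_relator[OF mu_const[of q c]]
  by (simp_all add: gen_cls_def cls_simps scal_hom)

lemma L_0 [simp]: "L 0 = zeroA" and R_0 [simp]: "R 0 = zeroA"
  using L_hom(4)[of 0] R_hom(4)[of 0] by (simp_all add: scal_hom cls_simps)

lemma L_R_commute: "L f \<cdot> R g = R g \<cdot> L f"
  using cls_relator[OF lam_mu[of q f g]] by (simp add: gen_cls_def cls_simps)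

lemma scal_cls_commute: "x \<in> carrier A \<Longrightarrow> scal_cls q c \<cdot> x = x \<cdot> scal_cls q c"
  by (auto simp: FSL2_carrier cls_simps scal_commute)

text \<open>Constants have the same image under both embeddings, which later allows them to be
  carried from the \<lambda>-side to the \<mu>-side.\<close>

lemma L_p: "L (p powi n) = R (p powi n)" and L_num: "L (num n) = R (num n)"
proof -
  show "L (p powi n) = R (p powi n)"
    by (simp only: p_power_int_const L_hom R_hom)
  have "num n = const_mero (1 - of_real (q powi (2 * n)))"
    by (simp add: num_def p_power_int_const const_mero_hom del: of_real_power_int)
  thus "L (num n) = R (num n)"
    by (simp only: L_hom R_hom)
qed

lemma homogD: "x \<in> homog q a b \<Longrightarrow> x \<in> carrier A"
  using homog_carrier[of q a b] by auto

text \<open>The defining relations move a function to the right of a generator. Read backwards, at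
  the inversely shifted function, they move it to the left, hence minus the degree.\<close>

lemma gen_shift:
  "gen_cls q g \<cdot> L f = L (sh (- fst (gen_deg g)) f) \<cdot> gen_cls q g"
  "gen_cls q g \<cdot> R f = R (sh (- snd (gen_deg g)) f) \<cdot> gen_cls q g"
proof -
  note rl = cls_relator[OF lam_alpha] cls_relator[OF lam_beta] cls_relator[OF lam_gamma] cls_relator[OF lam_delta]
  note rm = cls_relator[OF mu_alpha] cls_relator[OF mu_beta] cls_relator[OF mu_gamma] cls_relator[OF mu_delta]
  have sh1: "shift_mero 1 f = sh 1 f" "shift_mero (-1) f = sh (-1) f" for f by (simp_all add: sh_def)
  show "gen_cls q g \<cdot> L f = L (sh (- fst (gen_deg g)) f) \<cdot> gen_cls q g"
    using rl(1)[of q "sh (-1) f"] rl(2)[of q "sh (-1) f"] rl(3)[of q "sh 1 f"] rl(4)[of q "sh 1 f"]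
      L_R_commute
    by (cases g) (simp_all add: gen_cls_def[symmetric] cls_simps(1)[symmetric] sh1 flip: L_hom(2), 
        simp_all add: mult.commute)
  show "gen_cls q g \<cdot> R f = R (sh (- snd (gen_deg g)) f) \<cdot> gen_cls q g"
    using rm(1)[of q "sh (-1) f"] rm(2)[of q "sh 1 f"] rm(3)[of q "sh (-1) f"] rm(4)[of q "sh 1 f"]
      L_R_commute
    by (cases g) (simp_all add: gen_cls_def[symmetric] cls_simps(1)[symmetric] sh1 flip: R_hom(2),
        simp_all add: mult.commute)
qed

lemma word_shift:
  "cls q (prod_list (map gen gs)) \<cdot> L f = L (sh (- fst (word_deg (Word gs))) f) \<cdot> cls q (prod_list (map gen gs))"
  "cls q (prod_list (map gen gs)) \<cdot> R f = R (sh (- snd (word_deg (Word gs))) f) \<cdot> cls q (prod_list (map gen gs))"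
proof (induction gs arbitrary: f)
  case (Cons g gs)
  have eq: "cls q (prod_list (map gen (g # gs))) = gen_cls q g \<cdot> cls q (prod_list (map gen gs))"
    by (simp add: gen_cls_def cls_simps)
  {
    case 1
    have "cls q (prod_list (map gen (g # gs))) \<cdot> L f = gen_cls q g \<cdot> (cls q (prod_list (map gen gs)) \<cdot> L f)"
      by (simp only: eq) (simp add: A.m_assoc)
    also have "\<dots> = (gen_cls q g \<cdot> L (sh (- fst (word_deg (Word gs))) f)) \<cdot> cls q (prod_list (map gen gs))"
      by (simp add: Cons.IH(1) A.m_assoc)
    finally show ?case by (simp only: eq gen_shift(1)) (simp add: A.m_assoc)
  next
    case 2
    have "cls q (prod_list (map gen (g # gs))) \<cdot> R f = gen_cls q g \<cdot> (cls q (prod_list (map gen gs)) \<cdot> R f)"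
      by (simp only: eq) (simp add: A.m_assoc)
    also have "\<dots> = (gen_cls q g \<cdot> R (sh (- snd (word_deg (Word gs))) f)) \<cdot> cls q (prod_list (map gen gs))"
      by (simp add: Cons.IH(2) A.m_assoc)
    finally show ?case by (simp only: eq gen_shift(2)) (simp add: A.m_assoc)
  }
qed (simp_all add: cls_simps)

lemma cls_sum_eqI:
  assumes "\<And>i. i \<in> I \<Longrightarrow> cls q (f i) = cls q (g i)"
  shows   "cls q (sum f I) = cls q (sum g I)"
  using assms
proof (induction I rule: infinite_finite_induct)
  case (insert x I)
  thus ?case by (simp add: cls_simps(2)[symmetric])
qed auto

lemma homog_shift:
  assumes "x \<in> homog q a b"
  shows   "x \<cdot> L f = L (sh (- a) f) \<cdot> x" "x \<cdot> R f = R (sh (- b) f) \<cdot> x"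
proof -
  obtain u where u: "x = cls q u" "\<And>w. w \<in> Poly_Mapping.keys u \<Longrightarrow> word_deg w = (a, b)"
    using assms by (auto simp: homog_def)
  let ?s = "\<lambda>w. Poly_Mapping.single w (Poly_Mapping.lookup u w)"
  have *: "cls q (?s w * lam f) = cls q (lam (sh (- a) f) * ?s w)"
          "cls q (?s w * mu f) = cls q (mu (sh (- b) f) * ?s w)" if w: "w \<in> Poly_Mapping.keys u" for w
  proof -
    obtain gs where gs: "w = Word gs" by (cases w)
    have deg: "fst (word_deg (Word gs)) = a" "snd (word_deg (Word gs)) = b" using u(2)[OF w] gs by auto
    let ?P = "cls q (prod_list (map gen gs))" and ?c = "scal_cls q (Poly_Mapping.lookup u w)"
    have s: "cls q (?s w) = ?c \<cdot> ?P"
      by (simp add: gs single_Word cls_simps)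
    have "(?c \<cdot> ?P) \<cdot> L f = L (sh (- a) f) \<cdot> (?c \<cdot> ?P)"
      using word_shift(1)[of gs f] scal_cls_commute[of "L (sh (- a) f)"]
      by (metis A.m_assoc cls_closed deg)
    thus "cls q (?s w * lam f) = cls q (lam (sh (- a) f) * ?s w)"
      by (simp add: cls_simps(1)[symmetric] s gen_cls_def)
    have "(?c \<cdot> ?P) \<cdot> R f = R (sh (- b) f) \<cdot> (?c \<cdot> ?P)"
      using word_shift(2)[of gs f] scal_cls_commute[of "R (sh (- b) f)"]
      by (metis A.m_assoc cls_closed deg)
    thus "cls q (?s w * mu f) = cls q (mu (sh (- b) f) * ?s w)"
      by (simp add: cls_simps(1)[symmetric] s gen_cls_def)
  qed
  have "x \<cdot> L f = cls q (\<Sum>w\<in>Poly_Mapping.keys u. ?s w * lam f)"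
    by (subst u(1), subst free_sum_words[of u]) (simp add: gen_cls_def cls_simps sum_distrib_right)
  also have "\<dots> = cls q (\<Sum>w\<in>Poly_Mapping.keys u. lam (sh (- a) f) * ?s w)"
    by (rule cls_sum_eqI) (rule *)
  also have "\<dots> = L (sh (- a) f) \<cdot> x"
    by (subst u(1), subst (2) free_sum_words[of u]) (simp add: gen_cls_def cls_simps sum_distrib_left)
  finally show "x \<cdot> L f = L (sh (- a) f) \<cdot> x" .
  have "x \<cdot> R f = cls q (\<Sum>w\<in>Poly_Mapping.keys u. ?s w * mu f)"
    by (subst u(1), subst free_sum_words[of u]) (simp add: gen_cls_def cls_simps sum_distrib_right)
  also have "\<dots> = cls q (\<Sum>w\<in>Poly_Mapping.keys u. mu (sh (- b) f) * ?s w)"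
    by (rule cls_sum_eqI) (rule *)
  also have "\<dots> = R (sh (- b) f) \<cdot> x"
    by (subst u(1), subst (2) free_sum_words[of u]) (simp add: gen_cls_def cls_simps sum_distrib_left)
  finally show "x \<cdot> R f = R (sh (- b) f) \<cdot> x" .
qed

lemma gen_homog: "gen_cls q g \<in> homog q (fst (gen_deg g)) (snd (gen_deg g))"
  by (auto simp: homog_def gen_cls_def gen_def intro!: imageI split: if_splits)

text \<open>Treating the two multiplications as commuting actions lets simplification collect
  coefficients inside the field instead of reassociating products in \<open>A\<close>.\<close>

definition ls :: "mero \<Rightarrow> fr_free set \<Rightarrow> fr_free set" where "ls f x = L f \<cdot> x"
definition rs :: "mero \<Rightarrow> fr_free set \<Rightarrow> fr_free set" where "rs f x = R f \<cdot> x"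

lemma ls_closed [simp, intro]: "x \<in> carrier A \<Longrightarrow> ls f x \<in> carrier A"
  and rs_closed [simp, intro]: "x \<in> carrier A \<Longrightarrow> rs f x \<in> carrier A"
  by (simp_all add: ls_def rs_def)

lemma ls_rs_simps [simp]:
  assumes [simp]: "x \<in> carrier A"
  shows "ls f (ls g x) = ls (f * g) x" "rs f (rs g x) = rs (f * g) x" "rs f (ls g x) = ls g (rs f x)"
        "ls 1 x = x" "rs 1 x = x" "ls 0 x = zeroA" "rs 0 x = zeroA"
  using L_R_commute[of g f]
  by (simp_all add: ls_def rs_def L_hom R_hom A.m_assoc[symmetric])

lemma ls_rs_zero [simp]: "ls f zeroA = zeroA" "rs f zeroA = zeroA"
  by (simp_all add: ls_def rs_def)

lemma ls_rs_distrib [simp]: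
  assumes [simp]: "x \<in> carrier A" "y \<in> carrier A"
  shows "ls f (x \<uplus> y) = ls f x \<uplus> ls f y" "rs f (x \<uplus> y) = rs f x \<uplus> rs f y"
        "ls f x \<cdot> y = ls f (x \<cdot> y)" "rs f x \<cdot> y = rs f (x \<cdot> y)"
  by (simp_all add: ls_def rs_def A.m_assoc A.r_distr)

lemma rs_add: "x \<in> carrier A \<Longrightarrow> rs (f + g) x = rs f x \<uplus> rs g x"
  and ls_add: "x \<in> carrier A \<Longrightarrow> ls (f + g) x = ls f x \<uplus> ls g x"
  by (simp_all add: rs_def ls_def L_hom R_hom A.l_distr)

lemma rs_diff: "x \<in> carrier A \<Longrightarrow> rs (f - g) x = rs f x \<uplus> rs (- g) x"
  using rs_add[of x f "- g"] by simp

lemma homog_ls_rs: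
  assumes "x \<in> homog q a b" "y \<in> carrier A"
  shows "x \<cdot> ls f y = ls (sh (- a) f) (x \<cdot> y)" "x \<cdot> rs f y = rs (sh (- b) f) (x \<cdot> y)"
  using homogD[OF assms(1)] homog_shift[OF assms(1), of f] assms(2)
  by (simp_all add: ls_def rs_def A.m_assoc[symmetric])

section \<open>The defining relations rewritten in terms of \<open>ff\<close> and
  \<open>gg\<close>\<close>

lemma br_mult_p: "p powi k * br n = p powi (2 * n + k) * Y - p powi k"
  by (simp add: br_def power_int_add algebra_simps)

lemma to_mero_fun_R: "to_mero (fun_R q) = inverse (br 1)"
proof -
  have m: "(\<lambda>x. qexp q (2 * (x + of_int 1)) - 1) meromorphic_on UNIV"
    using qexp_meromorphic[of 2 2] by (auto intro!: meromorphic_intros simp: algebra_simps)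
  have "fun_R q = (\<lambda>x. 1 / (qexp q (2 * (x + of_int 1)) - 1))" by (auto simp: fun_R_def)
  hence "to_mero (fun_R q) = to_mero (\<lambda>_. 1) / to_mero (\<lambda>x. qexp q (2 * (x + of_int 1)) - 1)"
    using to_mero_hom(4)[OF meromorphic_on_const m, of 1] by simp
  thus ?thesis by (simp only: to_mero_qexp_diff) (simp add: br_def field_simps)
qed

lemma to_mero_fun_P: "to_mero (fun_P q) = 1 + inverse (br 1)"
proof -
  have m: "(\<lambda>x. qexp q (2 * (x + of_int 1)) - 1) meromorphic_on UNIV" "(\<lambda>x. qexp q (2 * (x + of_int 1))) meromorphic_on UNIV"
    using qexp_meromorphic[of 2 2] by (auto intro!: meromorphic_intros simp: algebra_simps)
  have "fun_P q = (\<lambda>x. qexp q (2 * (x + of_int 1)) / (qexp q (2 * (x + of_int 1)) - 1))" by (auto simp: fun_P_def)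
  hence "to_mero (fun_P q) = to_mero (\<lambda>x. qexp q (2 * (x + of_int 1))) / to_mero (\<lambda>x. qexp q (2 * (x + of_int 1)) - 1)"
    using to_mero_hom(4)[OF m(2,1)] by simp
  also have "\<dots> = (br 1 + 1) / br 1" 
    by (simp only: to_mero_qexp_diff to_mero_qexp) (simp add: br_def)
  finally show ?thesis by (simp add: field_simps)
qed

lemma to_mero_fun_F: "to_mero (fun_F q) = inverse p * ff"
proof -
  have m: "(\<lambda>x. qexp q (2 * (x + of_int 1)) - c) meromorphic_on UNIV" for c
    using qexp_meromorphic[of 2 2] by (auto intro!: meromorphic_intros simp: algebra_simps)
  have c: "qexp q (-2) = of_real (q powi -2)" using qexp_of_int[of "-2"] by simp
  have "fun_F q = (\<lambda>x. (qexp q (2 * (x + of_int 1)) - qexp q (-2)) / (qexp q (2 * (x + of_int 1)) - 1))"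
    by (auto simp: fun_F_def)
  hence "to_mero (fun_F q) = to_mero (\<lambda>x. qexp q (2 * (x + of_int 1)) - qexp q (-2)) /
           to_mero (\<lambda>x. qexp q (2 * (x + of_int 1)) - 1)"
    using to_mero_hom(4)[OF m m] by simp
  also have "\<dots> = (p powi 2 * Y - p powi -2) / br 1"
    by (simp only: to_mero_qexp_diff c p_power_int_const[symmetric]) (simp add: br_def)
  also have "p powi 2 * Y - p powi -2 = p powi -2 * br 2"
    by (simp add: br_mult_p)
  finally show ?thesis by (simp add: ff_def field_simps power_int_minus power2_eq_square)
qed

lemma to_mero_fun_G: "to_mero (fun_G q) = ff * gg"
proof -
  let ?f = "\<lambda>c x. qexp q (2 * (x + of_int 1)) - c"
  have m: "?f c meromorphic_on UNIV" for c
    using qexp_meromorphic[of 2 2] by (auto intro!: meromorphic_intros simp: algebra_simps)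
  have c: "qexp q (-2) = of_real (q powi -2)" "qexp q 2 = of_real (q powi 2)"
    using qexp_of_int[of "-2"] qexp_of_int[of "2"] by simp_all
  have "fun_G q = (\<lambda>x. ?f (qexp q 2) x * ?f (qexp q (-2)) x / (?f 1 x * ?f 1 x))"
    by (auto simp: fun_G_def power2_eq_square)
  hence "to_mero (fun_G q) = to_mero (?f (qexp q 2)) * to_mero (?f (qexp q (-2))) / (to_mero (?f 1) * to_mero (?f 1))"
    using m by (simp only: to_mero_hom meromorphic_on_mult)
  also have "\<dots> = (p powi 2 * Y - p powi 2) * (p powi 2 * Y - p powi -2) / (br 1 * br 1)"
    by (simp only: to_mero_qexp_diff c p_power_int_const[symmetric]) (simp add: br_def)
  also have "p powi 2 * Y - p powi -2 = p powi -2 * br 2"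
    by (simp add: br_mult_p)
  also have "p powi 2 * Y - p powi 2 = p powi 2 * br 0"
    by (simp only: br_mult_p) simp
  finally show ?thesis by (simp add: ff_def gg_def field_simps power_int_minus power2_eq_square)
qed

lemma p_inverse_cancel [simp]: "p * (inverse p * x) = x" "inverse p * (p * x) = x"
  by simp_all

text \<open>Partial fractions in \<open>br 1\<close>. The opposite polar parts of \<open>ff\<close>
  and \<open>gg\<close> explain why their sum is constant.\<close>

lemma ff_altdef: "ff = p + (p - inverse p) * inverse (br 1)"
  and gg_altdef: "gg = inverse p - (p - inverse p) * inverse (br 1)"
proof -
  have "p * p * (br 1 + 1) = p * p * (p powi 2 * Y)"
    by (simp add: br_def)
  hence "br 2 = p * p * (br 1 + 1) - 1"
    by (simp add: br_def power_int_def power2_eq_square power4_eq_xxxx)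
  moreover have "br 0 = inverse (p * p) * (br 1 + 1) - 1"
    by (simp add: br_def power_int_def power2_eq_square)
  ultimately show "ff = p + (p - inverse p) * inverse (br 1)" "gg = inverse p - (p - inverse p) * inverse (br 1)"
    using br_nz[of 1] unfolding ff_def gg_def by (simp_all add: field_simps)
qed

lemma ff_gg_shift: "gg * sh (-1) ff = 1"
  by (simp add: ff_def gg_def sh_hom)

lemma scal_cls_rs: "scal_cls q c \<cdot> x = rs (const_mero c) x"
  by (simp add: rs_def R_hom)

lemma cls_mult: "cls q (x * y) = cls q x \<cdot> cls q y"
  by (simp add: cls_simps)

lemma cls_gen: "cls q (gen g) = gen_cls q g"
  by (simp add: gen_cls_def)

text \<open>With r = 1 / \<open>br 1\<close> one has P = 1 + r and R = r, so the mixed product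
  r(\<lambda>)r(\<mu>) cancels. What remains is a function of \<lambda> plus a function of
  \<mu>.\<close>

lemma elem_H_I:
  assumes [simp]: "x \<in> carrier A"
  shows "cls q (elem_H q) \<cdot> x = ls ff x \<uplus> rs (- gg) x"
        "cls q (elem_I q) \<cdot> x = ls ff x \<uplus> rs (- ff) x"
proof -
  define c where "c = p - inverse p"
  define r where "r = inverse (br 1)"
  have sc: "scal_cls q (qexp q 1 - qexp q (-1)) = R c"
    using qexp_of_int[of 1] qexp_of_int[of "-1"]
    by (simp add: R_hom[symmetric] c_def p_def const_mero_hom const_mero_inverse R_hom(4)[symmetric])
  have L_c: "L c = R c" unfolding sc[symmetric] by (simp only: L_hom(4)[symmetric] sc) 
      (metis L_hom(4) R_hom(4) sc const_mero_hom(2) const_mero_inverse c_def p_def)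
  have lsc: "ls (c * g) y = rs c (ls g y)" "ls c y = rs c y" if "y \<in> carrier A" for g y
    using that L_c by (simp_all add: ls_def rs_def L_hom A.m_assoc)
  have ff: "ff = p + c * r" and gg: "gg = inverse p - c * r"
    by (simp_all add: ff_altdef gg_altdef c_def r_def)
  have Lp: "L p = R p" using L_p[of 1] by simp
  have lsp: "ls p y = rs p y" for y by (simp add: ls_def rs_def Lp)
  have "cls q (elem_H q) \<cdot> x = rs c (ls (1 + r) (rs (1 + r) x) \<ominus>\<^bsub>A\<^esub> ls r (rs r x))"
    by (simp add: elem_H_def cls_mult cls_sub cls_gen sc to_mero_fun_P to_mero_fun_R r_def[symmetric]
          A.m_assoc A.l_distr A.minus_eq A.l_minus ls_def rs_def)
  also have "\<dots> = rs c (x \<uplus> ls r x \<uplus> rs r x)"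
    by (simp add: ls_add rs_add) (simp add: A.minus_eq A.a_ac A.r_neg2 A.r_neg1 A.r_neg)
  also have "\<dots> = ls ff x \<uplus> rs (- gg) x"
  proof -
    have "- gg = (c - p) + c * r" by (simp add: gg c_def)
    hence "ls ff x \<uplus> rs (- gg) x = (rs p x \<uplus> rs c (ls r x)) \<uplus> (rs (c - p) x \<uplus> rs (c * r) x)"
      by (simp add: ff ls_add lsp lsc rs_add)
    also have "\<dots> = (rs p x \<uplus> rs (c - p) x) \<uplus> (rs c (ls r x) \<uplus> rs (c * r) x)"
      by (simp add: A.a_ac)
    also have "rs p x \<uplus> rs (c - p) x = rs c x" by (simp flip: rs_add)
    finally show ?thesis by (simp add: A.a_ac)
  qed
  finally show "cls q (elem_H q) \<cdot> x = ls ff x \<uplus> rs (- gg) x" .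
  have "cls q (elem_I q) \<cdot> x = rs c (ls r (rs (1 + r) x) \<ominus>\<^bsub>A\<^esub> ls (1 + r) (rs r x))"
    by (simp add: elem_I_def cls_mult cls_sub cls_gen sc to_mero_fun_P to_mero_fun_R r_def[symmetric]
          A.m_assoc A.l_distr A.minus_eq A.l_minus ls_def rs_def)
  also have "\<dots> = rs c (ls r x \<uplus> rs (- r) x)"
  proof -
    have "rs r x \<uplus> rs (- r) x = zeroA" by (simp flip: rs_add)
    hence "rs (- r) x = \<ominus>\<^bsub>A\<^esub> rs r x" by (metis A.minus_equality A.a_comm assms rs_closed)
    thus ?thesis
      by (simp add: ls_add rs_add) (simp add: A.minus_eq A.minus_add A.a_ac A.r_neg2 A.r_neg1 A.r_neg)
  qed
  also have "\<dots> = ls ff x \<uplus> rs (- ff) x"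
  proof -
    have "- ff = - p + c * (- r)" by (simp add: ff)
    hence "ls ff x \<uplus> rs (- ff) x = (rs p x \<uplus> rs c (ls r x)) \<uplus> (rs (- p) x \<uplus> rs (c * - r) x)"
      by (simp only: ff ls_add lsp lsc rs_add assms)
    also have "\<dots> = (rs p x \<uplus> rs (- p) x) \<uplus> (rs c (ls r x) \<uplus> rs (c * - r) x)"
      by (simp add: A.a_ac)
    also have "rs p x \<uplus> rs (- p) x = zeroA" by (simp flip: rs_add)
    finally show ?thesis by simp
  qed
  finally show "cls q (elem_I q) \<cdot> x = ls ff x \<uplus> rs (- ff) x" .
qed

lemma alpha_gamma_comm: "\<alpha> \<cdot> \<gamma> = ls ff (\<gamma> \<cdot> \<alpha>)"
  and beta_delta_comm: "\<beta> \<cdot> \<delta> = ls ff (\<delta> \<cdot> \<beta>)"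
proof -
  have "scal_cls q (of_real q) \<cdot> (L (inverse p * ff) \<cdot> x) = ls ff x" if "x \<in> carrier A" for x
  proof -
    have "scal_cls q (of_real q) = L p" by (simp add: p_def L_hom)
    thus ?thesis using that ls_rs_simps(1)[of x p "inverse p * ff"] by (simp add: ls_def)
  qed
  thus "\<alpha> \<cdot> \<gamma> = ls ff (\<gamma> \<cdot> \<alpha>)" "\<beta> \<cdot> \<delta> = ls ff (\<delta> \<cdot> \<beta>)"
    using cls_relator[OF rel_M2.alpha_gamma[of q]] cls_relator[OF rel_M2.beta_delta[of q]]
    by (simp_all add: cls_mult cls_gen to_mero_fun_F A.m_assoc)
qed

text \<open>The relations carry F(\<mu> - 1); since \<open>gg\<close> inverts the shifted
  \<open>ff\<close>, they can be solved for the opposite order, the one that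
  \<open>raising_step\<close> needs.\<close>

lemma beta_alpha_comm: "\<beta> \<cdot> \<alpha> = rs gg (\<alpha> \<cdot> \<beta>)"
  and delta_gamma_comm: "\<delta> \<cdot> \<gamma> = rs gg (\<gamma> \<cdot> \<delta>)"
proof -
  have "scal_cls q (of_real q) \<cdot> (R (shift_mero (-1) (inverse p * ff)) \<cdot> x) = rs (sh (-1) ff) x" if "x \<in> carrier A" for x
  proof -
    have "shift_mero (-1) (inverse p * ff) = inverse p * sh (-1) ff"
      using sh_hom(3,6)[of "-1"] by (simp add: sh_def[of "-1", simplified, symmetric])
    moreover have "scal_cls q (of_real q) = R p" by (simp add: p_def R_hom)
    ultimately show ?thesis using that ls_rs_simps(2)[of x p "inverse p * sh (-1) ff"] by (simp add: rs_def)
  qed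
  hence "\<alpha> \<cdot> \<beta> = rs (sh (-1) ff) (\<beta> \<cdot> \<alpha>)" "\<gamma> \<cdot> \<delta> = rs (sh (-1) ff) (\<delta> \<cdot> \<gamma>)"
    using cls_relator[OF rel_M2.alpha_beta[of q]] cls_relator[OF rel_M2.gamma_delta[of q]]
    by (simp_all add: cls_mult cls_gen to_mero_fun_F A.m_assoc)
  thus "\<beta> \<cdot> \<alpha> = rs gg (\<alpha> \<cdot> \<beta>)" "\<delta> \<cdot> \<gamma> = rs gg (\<gamma> \<cdot> \<delta>)"
    by (simp_all add: ff_gg_shift)
qed

lemma alpha_delta_det: "\<alpha> \<cdot> \<delta> = oneA \<uplus> ls ff (\<gamma> \<cdot> \<beta>)"
proof -
  have "scal_cls q (of_real q) \<cdot> (L (inverse p * ff) \<cdot> x) = ls ff x" if "x \<in> carrier A" for x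
  proof -
    have "scal_cls q (of_real q) = L p" by (simp add: p_def L_hom)
    thus ?thesis using that ls_rs_simps(1)[of x p "inverse p * ff"] by (simp add: ls_def)
  qed
  hence "\<alpha> \<cdot> \<delta> \<ominus>\<^bsub>A\<^esub> ls ff (\<gamma> \<cdot> \<beta>) = oneA"
    using cls_det[of q] by (simp add: det_c_def cls_sub cls_mult cls_gen to_mero_fun_F A.m_assoc)
  thus ?thesis
    by (metis A.add.inv_solve_right A.m_closed A.minus_eq A.one_closed cls_closed(2) ls_closed)
qed

lemma delta_alpha_det: "\<delta> \<cdot> \<alpha> = oneA \<uplus> rs gg (\<gamma> \<cdot> \<beta>)"
proof -
  have "\<alpha> \<cdot> \<delta> \<ominus>\<^bsub>A\<^esub> \<delta> \<cdot> \<alpha> = ls ff (\<gamma> \<cdot> \<beta>) \<uplus> rs (- gg) (\<gamma> \<cdot> \<beta>)"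
    using cls_relator[OF rel_M2.alpha_delta[of q]]
    by (simp add: cls_sub cls_mult cls_gen A.m_assoc elem_H_I A.l_distr)
  hence "\<alpha> \<cdot> \<delta> = (ls ff (\<gamma> \<cdot> \<beta>) \<uplus> rs (- gg) (\<gamma> \<cdot> \<beta>)) \<uplus> \<delta> \<cdot> \<alpha>"
    by (metis A.add.inv_solve_right A.m_closed A.minus_eq A.a_closed cls_closed(2) ls_closed rs_closed)
  hence "oneA \<uplus> ls ff (\<gamma> \<cdot> \<beta>) = (rs (- gg) (\<gamma> \<cdot> \<beta>) \<uplus> \<delta> \<cdot> \<alpha>) \<uplus> ls ff (\<gamma> \<cdot> \<beta>)"
    by (simp add: alpha_delta_det A.a_ac)
  hence "oneA = rs (- gg) (\<gamma> \<cdot> \<beta>) \<uplus> \<delta> \<cdot> \<alpha>" by simp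
  hence "oneA \<uplus> rs gg (\<gamma> \<cdot> \<beta>) = (rs gg (\<gamma> \<cdot> \<beta>) \<uplus> rs (- gg) (\<gamma> \<cdot> \<beta>)) \<uplus> \<delta> \<cdot> \<alpha>"
    by (simp add: A.a_ac)
  also have "rs gg (\<gamma> \<cdot> \<beta>) \<uplus> rs (- gg) (\<gamma> \<cdot> \<beta>) = zeroA" by (simp flip: rs_add)
  finally show ?thesis by simp
qed

lemma beta_gamma_det: "\<beta> \<cdot> \<gamma> = ls ff (\<delta> \<cdot> \<alpha>) \<uplus> rs (- ff) oneA"
proof -
  have "\<beta> \<cdot> \<gamma> \<ominus>\<^bsub>A\<^esub> rs (ff * gg) (\<gamma> \<cdot> \<beta>) = ls ff (\<delta> \<cdot> \<alpha>) \<uplus> rs (- ff) (\<delta> \<cdot> \<alpha>)"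
    using cls_relator[OF rel_M2.beta_gamma_mu[of q]]
    by (simp add: cls_sub cls_mult cls_gen A.m_assoc elem_H_I to_mero_fun_G A.l_distr rs_def[of "ff * gg"])
  hence "\<beta> \<cdot> \<gamma> = (ls ff (\<delta> \<cdot> \<alpha>) \<uplus> rs (- ff) (\<delta> \<cdot> \<alpha>)) \<uplus> rs (ff * gg) (\<gamma> \<cdot> \<beta>)"
    by (metis A.add.inv_solve_right A.m_closed A.minus_eq A.a_closed cls_closed(2) ls_closed rs_closed)
  \<comment> \<open>Only this copy of \<delta>\<alpha> is expanded: its \<gamma>\<beta> term cancels
    the one with coefficient G(\<mu>).\<close>
  also have "rs (- ff) (\<delta> \<cdot> \<alpha>) = rs (- ff) oneA \<uplus> rs (- (ff * gg)) (\<gamma> \<cdot> \<beta>)"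
    by (simp add: delta_alpha_det)
  also have "(ls ff (\<delta> \<cdot> \<alpha>) \<uplus> (rs (- ff) oneA \<uplus> rs (- (ff * gg)) (\<gamma> \<cdot> \<beta>))) \<uplus> rs (ff * gg) (\<gamma> \<cdot> \<beta>) =
     (ls ff (\<delta> \<cdot> \<alpha>) \<uplus> rs (- ff) oneA) \<uplus> (rs (- (ff * gg)) (\<gamma> \<cdot> \<beta>) \<uplus> rs (ff * gg) (\<gamma> \<cdot> \<beta>))"
    by (simp add: A.a_ac)
  also have "rs (- (ff * gg)) (\<gamma> \<cdot> \<beta>) \<uplus> rs (ff * gg) (\<gamma> \<cdot> \<beta>) = zeroA" by (simp flip: rs_add)
  finally show ?thesis by simp
qed

end

context dynamical_SL2
begin

section \<open>A lowest weight module\<close>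

text \<open>
  A vector is a sequence of meromorphic functions, the \<open>n\<close>-th entry being the coefficient of a basis
  vector \<open>v\<^sub>n\<close> on which \<open>f(\<mu>)\<close> acts as \<open>f(\<lambda> + 2n)\<close>. Normalising \<open>\<gamma> v\<^sub>n = v\<^sub>n\<^sub>+\<^sub>1\<close>, \<open>\<alpha> v\<^sub>0 = v\<^sub>0\<close>, \<open>\<beta> v\<^sub>0 = 0\<close>, the
  relations leave no choice for the other coefficients; \<open>zv n\<close> is the eigenvalue of \<open>\<gamma>\<beta>\<close>.
\<close>

definition av :: "nat \<Rightarrow> mero" where "av n = p powi (- int n) * br (int n + 1) / br 1"
definition dv :: "nat \<Rightarrow> mero" where "dv n = p powi (int n) * br (int n + 1) / br (2 * int n + 1)"
definition bv :: "nat \<Rightarrow> mero" where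
  "bv n = num (int n + 1) * num (int n) * p * Y / (br 1 * br (2 * int n + 1))"
definition zv :: "nat \<Rightarrow> mero" where
  "zv n = num (int n) * num (int n - 1) * p ^ 3 * Y / (br 2 * br (2 * int n))"

fun gact :: "fr_gen \<Rightarrow> (nat \<Rightarrow> mero) \<Rightarrow> nat \<Rightarrow> mero" where
  "gact Alpha w n = av n * sh (-1) (w n)"
| "gact Beta w n = bv n * sh (-1) (w (Suc n))"
| "gact Gamma w n = (case n of 0 \<Rightarrow> 0 | Suc m \<Rightarrow> sh 1 (w m))"
| "gact Delta w n = dv n * sh 1 (w n)"
| "gact (MuL f) w n = f * w n"
| "gact (MuR f) w n = sh (2 * int n) f * w n"

fun wact :: "fr_word \<Rightarrow> (nat \<Rightarrow> mero) \<Rightarrow> nat \<Rightarrow> mero" where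
  "wact (Word gs) = foldr gact gs"

definition act :: "fr_free \<Rightarrow> (nat \<Rightarrow> mero) \<Rightarrow> nat \<Rightarrow> mero" where
  "act x w n = (\<Sum>u\<in>Poly_Mapping.keys x. const_mero (Poly_Mapping.lookup x u) * wact u w n)"

lemma gact_add: "gact g (\<lambda>n. w n + w' n) = (\<lambda>n. gact g w n + gact g w' n)"
  by (rule ext, cases g) (auto simp: sh_hom algebra_simps split: nat.splits)

lemma gact_const: "gact g (\<lambda>n. const_mero c * w n) = (\<lambda>n. const_mero c * gact g w n)"
  by (rule ext, cases g) (auto simp: sh_hom algebra_simps split: nat.splits)

lemma wact_add: "wact u (\<lambda>n. w n + w' n) = (\<lambda>n. wact u w n + wact u w' n)"
proof (cases u)
  case (Word gs)
  have "foldr gact gs (\<lambda>n. w n + w' n) = (\<lambda>n. foldr gact gs w n + foldr gact gs w' n)"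
    by (induction gs) (simp_all add: gact_add)
  thus ?thesis by (simp add: Word)
qed

lemma wact_const: "wact u (\<lambda>n. const_mero c * w n) = (\<lambda>n. const_mero c * wact u w n)"
proof (cases u)
  case (Word gs)
  have "foldr gact gs (\<lambda>n. const_mero c * w n) = (\<lambda>n. const_mero c * foldr gact gs w n)"
    by (induction gs) (simp_all add: gact_const)
  thus ?thesis by (simp add: Word)
qed

lemma wact_sum: "wact u (\<lambda>n. \<Sum>i\<in>I. f i n) = (\<lambda>n. \<Sum>i\<in>I. wact u (f i) n)"
proof -
  have "wact u (\<lambda>n. 0) = (\<lambda>n. 0)" using wact_const[of u 0 "\<lambda>_. 0"] by simp
  thus ?thesis by (induction I rule: infinite_finite_induct) (simp_all add: wact_add)
qed

lemma wact_plus: "wact (u + v) w = wact u (wact v w)"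
  by (cases u; cases v) simp

lemma act_superset:
  assumes "finite K" "Poly_Mapping.keys x \<subseteq> K"
  shows   "act x w n = (\<Sum>u\<in>K. const_mero (Poly_Mapping.lookup x u) * wact u w n)"
  unfolding act_def by (rule sum.mono_neutral_left) (use assms in \<open>auto simp: in_keys_iff\<close>)

lemma act_add: "act (x + y) w = (\<lambda>n. act x w n + act y w n)"
proof
  fix n
  define K where "K = Poly_Mapping.keys x \<union> Poly_Mapping.keys y"
  have K: "finite K" "Poly_Mapping.keys x \<subseteq> K" "Poly_Mapping.keys y \<subseteq> K" "Poly_Mapping.keys (x + y) \<subseteq> K"
    using Poly_Mapping.keys_add[of x y] by (auto simp: K_def)
  show "act (x + y) w n = act x w n + act y w n"
    using act_superset[OF K(1,2)] act_superset[OF K(1,3)] act_superset[OF K(1,4)]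
    by (simp add: lookup_add const_mero_hom distrib_right sum.distrib)
qed

lemma act_0: "act 0 w = (\<lambda>_. 0)"
  by (auto simp: act_def)

lemma act_diff: "act (x - y) w = (\<lambda>n. act x w n - act y w n)"
  using act_add[of "x - y" y w] by (auto simp: fun_eq_iff)

lemma act_sum: "act (\<Sum>i\<in>I. f i) w = (\<lambda>n. \<Sum>i\<in>I. act (f i) w n)"
  by (induction I rule: infinite_finite_induct) (simp_all add: act_add act_0)

lemma act_single: "act (Poly_Mapping.single u c) w = (\<lambda>n. const_mero c * wact u w n)"
  by (auto simp: act_def fun_eq_iff)

lemma act_mult: "act (x * y) w = act x (act y w)"
proof -
  let ?s = "\<lambda>x u. Poly_Mapping.single u (Poly_Mapping.lookup x u)"
  have *: "act (?s x u * y) w = act (?s x u) (act y w)" for u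
  proof -
    have "act (?s x u * y) w = act (\<Sum>v\<in>Poly_Mapping.keys y. ?s x u * ?s y v) w"
      by (subst free_sum_words[of y]) (simp add: sum_distrib_left)
    also have "\<dots> = act (?s x u) (\<lambda>n. \<Sum>v\<in>Poly_Mapping.keys y. act (?s y v) w n)"
      by (simp add: act_sum act_single mult_single wact_plus wact_const wact_sum const_mero_hom
          sum_distrib_left mult.assoc)
    also have "(\<lambda>n. \<Sum>v\<in>Poly_Mapping.keys y. act (?s y v) w n) = act y w"
      by (subst (3) free_sum_words[of y]) (simp add: act_sum)
    finally show ?thesis .
  qed
  have "act (x * y) w = act (\<Sum>u\<in>Poly_Mapping.keys x. ?s x u * y) w"
    by (subst free_sum_words[of x]) (simp add: sum_distrib_right)
  also have "\<dots> = (\<lambda>n. \<Sum>u\<in>Poly_Mapping.keys x. act (?s x u) (act y w) n)"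
    by (simp add: act_sum *)
  also have "\<dots> = act x (act y w)"
    by (subst (3) free_sum_words[of x]) (simp add: act_sum)
  finally show ?thesis .
qed

lemma act_gen: "act (gen g) w = gact g w"
  by (simp add: gen_def act_single)

lemma act_scal: "act (scal c) w = (\<lambda>n. const_mero c * w n)"
  by (simp add: scal_def act_single zero_fr_word_def)

lemma act_1: "act 1 w = w"
  using act_scal[of 1 w] by (simp add: scal_hom)

lemma ff_plus_gg: "gg = p + inverse p - ff"
  by (simp add: ff_altdef gg_altdef)

lemma sh_ff: "sh k ff = br (2 + k) / (p * br (1 + k))" and sh_gg: "sh k gg = p * br k / br (1 + k)"
  by (simp_all add: ff_def gg_def sh_hom)

text \<open>The relations for \<alpha>\<delta>, \<delta>\<alpha> and \<beta>\<gamma> on v_n, with N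
  standing for q^(2n). Each numerator is first rewritten polynomially; the denominators are then
  made opaque, so that clearing them stays cheap.\<close>

lemma module_relations_field:
  fixes p N Y :: "'a :: field"
  assumes "p \<noteq> 0" "p^2 * Y - 1 \<noteq> 0" "p^4 * Y - 1 \<noteq> 0" "N^2 * Y - 1 \<noteq> 0" "N^2 * p^2 * Y - 1 \<noteq> 0"
  shows "(N * p^2 * Y - 1) * (N * Y - 1) / ((p^2 * Y - 1) * (N^2 * Y - 1)) =
           1 + (p^4 * Y - 1) / (p * (p^2 * Y - 1)) * ((1 - N) * (1 - N / p^2) * p^3 * Y / ((p^4 * Y - 1) * (N^2 * Y - 1)))"
    and "(N * p^2 * Y - 1) * (N * p^4 * Y - 1) / ((N^2 * p^2 * Y - 1) * (p^4 * Y - 1)) =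
           1 + p * (N^2 * Y - 1) / (N^2 * p^2 * Y - 1) * ((1 - N) * (1 - N / p^2) * p^3 * Y / ((p^4 * Y - 1) * (N^2 * Y - 1)))"
    and "(1 - N * p^2) * (1 - N) * p * Y / ((p^2 * Y - 1) * (N^2 * p^2 * Y - 1)) =
           (p^4 * Y - 1) / (p * (p^2 * Y - 1)) * ((N * p^2 * Y - 1) * (N * p^4 * Y - 1) / ((N^2 * p^2 * Y - 1) * (p^4 * Y - 1))) -
           (N^2 * p^4 * Y - 1) / (p * (N^2 * p^2 * Y - 1))"
proof -
  define a b c d where "a = p^2 * Y - 1" and "b = p^4 * Y - 1" and "c = N^2 * Y - 1" and "d = N^2 * p^2 * Y - 1"
  note abcd = a_def[symmetric] b_def[symmetric] c_def[symmetric] d_def[symmetric]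
  have nz: "a \<noteq> 0" "b \<noteq> 0" "c \<noteq> 0" "d \<noteq> 0" "p \<noteq> 0" using assms by (simp_all add: a_def b_def c_def d_def)
  have 1: "(N * p^2 * Y - 1) * (N * Y - 1) = a * c + (1 - N) * (p^2 - N) * Y"
    unfolding a_def c_def by (simp add: algebra_simps power2_eq_square)
  show "(N * p^2 * Y - 1) * (N * Y - 1) / ((p^2 * Y - 1) * (N^2 * Y - 1)) =
           1 + (p^4 * Y - 1) / (p * (p^2 * Y - 1)) * ((1 - N) * (1 - N / p^2) * p^3 * Y / ((p^4 * Y - 1) * (N^2 * Y - 1)))"
    unfolding 1 abcd using nz by (simp add: divide_simps) (simp add: algebra_simps power2_eq_square power3_eq_cube)
  have 2: "(N * p^2 * Y - 1) * (N * p^4 * Y - 1) = b * d + p^2 * (1 - N) * (p^2 - N) * Y"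
    unfolding b_def d_def by (simp add: algebra_simps power2_eq_square power4_eq_xxxx)
  show "(N * p^2 * Y - 1) * (N * p^4 * Y - 1) / ((N^2 * p^2 * Y - 1) * (p^4 * Y - 1)) =
           1 + p * (N^2 * Y - 1) / (N^2 * p^2 * Y - 1) * ((1 - N) * (1 - N / p^2) * p^3 * Y / ((p^4 * Y - 1) * (N^2 * Y - 1)))"
    unfolding 2 abcd using nz by (simp add: divide_simps) (simp add: algebra_simps power2_eq_square power3_eq_cube)
  have 3: "(N * p^2 * Y - 1) * (N * p^4 * Y - 1) = (N^2 * p^4 * Y - 1) * a + (1 - N * p^2) * (1 - N) * p^2 * Y"
    unfolding a_def by (simp add: algebra_simps power2_eq_square power4_eq_xxxx)
  show "(1 - N * p^2) * (1 - N) * p * Y / ((p^2 * Y - 1) * (N^2 * p^2 * Y - 1)) =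
           (p^4 * Y - 1) / (p * (p^2 * Y - 1)) * ((N * p^2 * Y - 1) * (N * p^4 * Y - 1) / ((N^2 * p^2 * Y - 1) * (p^4 * Y - 1))) -
           (N^2 * p^4 * Y - 1) / (p * (N^2 * p^2 * Y - 1))"
    unfolding 3 abcd using nz by (simp add: divide_simps) (simp add: algebra_simps power2_eq_square power3_eq_cube)
qed

lemma sh_p_power [simp]: "sh k (p ^ n) = p ^ n"
  by (simp add: sh_power)

lemma module_relations:
  fixes n :: nat
  shows "av n * sh (-1) (dv n) = 1 + ff * zv n"
    and "dv n * sh 1 (av n) = 1 + sh (2 * int n) gg * zv n"
    and "bv n = ff * (dv n * sh 1 (av n)) - sh (2 * int n) ff"
proof -
  define N where "N = p powi (2 * int n)"
  have N2: "p powi (4 * int n) = N^2"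
    by (simp add: N_def power2_eq_square flip: power_int_add)
  have E: "br 1 = p^2 * Y - 1" "br 2 = p^4 * Y - 1" "br (int n) = N * Y - 1" "br (int n + 1) = N * p^2 * Y - 1"
    "br (int n + 2) = N * p^4 * Y - 1" "br (2 * int n) = N^2 * Y - 1" "br (2 * int n + 1) = N^2 * p^2 * Y - 1"
    "br (2 * int n + 2) = N^2 * p^4 * Y - 1" "num (int n) = 1 - N" "num (int n - 1) = 1 - N / p^2" "num (int n + 1) = 1 - N * p^2"
    by (simp_all add: br_def num_def power_int_add power_int_diff distrib_left right_diff_distrib N2 N_def[symmetric])
  have nz: "p \<noteq> 0" "p^2 * Y - 1 \<noteq> 0" "p^4 * Y - 1 \<noteq> 0" "N^2 * Y - 1 \<noteq> 0" "N^2 * p^2 * Y - 1 \<noteq> 0"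
    using br_nz unfolding E[symmetric] by simp_all
  have 1: "av n * sh (-1) (dv n) = br (int n + 1) * br (int n) / (br 1 * br (2 * int n))"
    by (simp add: av_def dv_def sh_hom power_int_minus field_simps)
  have 2: "dv n * sh 1 (av n) = br (int n + 1) * br (int n + 2) / (br (2 * int n + 1) * br 2)"
    by (simp add: av_def dv_def sh_hom power_int_minus field_simps)
  have 3: "ff = br 2 / (p * br 1)" "sh (2 * int n) ff = br (2 * int n + 2) / (p * br (2 * int n + 1))" 
    "sh (2 * int n) gg = p * br (2 * int n) / br (2 * int n + 1)"
    by (simp_all add: ff_def gg_def sh_hom add.commute)
  show "av n * sh (-1) (dv n) = 1 + ff * zv n"
   and "dv n * sh 1 (av n) = 1 + sh (2 * int n) gg * zv n"
   and "bv n = ff * (dv n * sh 1 (av n)) - sh (2 * int n) ff"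
    unfolding 1 2 3(2,3) zv_def bv_def
    unfolding 3(1) E by (rule module_relations_field[OF nz])+
qed

text \<open>At n = 0 the left side is zero because \<gamma> never reaches v_0, and
  \<open>zv 0\<close> vanishes through \<open>num 0\<close>.\<close>

lemma act_gamma_beta: "gact Gamma (gact Beta w) n = zv n * w n"
  by (cases n) (simp_all add: zv_def bv_def sh_hom sh_Y power_int_def algebra_simps power3_eq_cube power2_eq_square)

lemma act_beta_gamma: "gact Beta (gact Gamma w) n = bv n * w n"
  by simp

lemma act_alpha_delta: "gact Alpha (gact Delta w) n = (1 + ff * zv n) * w n"
  by (simp add: sh_hom module_relations(1)[symmetric])

lemma act_delta_alpha: "gact Delta (gact Alpha w) n = (1 + sh (2 * int n) gg * zv n) * w n"
  by (simp add: sh_hom module_relations(2)[symmetric])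

lemma act_elem:
  "act (elem_H q) w n = (ff - sh (2 * int n) gg) * w n"
  "act (elem_I q) w n = (ff - sh (2 * int n) ff) * w n"
proof -
  have sc: "const_mero (qexp q 1 - qexp q (- 1)) = p - inverse p"
    using qexp_of_int[of 1] qexp_of_int[of "-1"]
    by (simp add: p_def const_mero_hom const_mero_inverse)
  show "act (elem_H q) w n = (ff - sh (2 * int n) gg) * w n" 
       "act (elem_I q) w n = (ff - sh (2 * int n) ff) * w n"
    by (simp_all add: elem_H_def elem_I_def act_mult act_diff act_scal act_gen sc to_mero_fun_P to_mero_fun_R
        ff_altdef gg_altdef sh_hom algebra_simps)
qed

lemma act_rel:
  assumes "rel_M2 q x y"
  shows   "act x w n = act y w n"
proof -
  note a = act_mult act_add act_diff act_scal act_gen to_mero_fun_F to_mero_fun_G sh_hom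
  have sh1: "shift_mero 1 f = sh 1 f" "shift_mero (-1) f = sh (-1) f" for f by (simp_all add: sh_def)
  have c: "const_mero (of_real q) = p" by (simp add: p_def)
  \<comment> \<open>Primes mark the action of a function of \<mu> on v_n. Expressing
    \<open>bv n\<close> by \<open>zv n\<close>, and \<open>gg\<close> by \<open>ff\<close> where
    needed, leaves polynomial identities in f, f' and \<open>zv n\<close>.\<close>
  define f f' g g' where "f = ff" and "f' = sh (2 * int n) ff" and "g = gg" and "g' = sh (2 * int n) gg"
  have g: "g = p + inverse p - f" and g': "g' = p + inverse p - f'"
    using ff_plus_gg by (simp_all add: f_def g_def f'_def g'_def sh_hom)
  have b: "bv n = f * (1 + g' * zv n) - f'"
    using module_relations(3)[of n] module_relations(2)[of n] by (simp add: f_def f'_def g'_def)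
  show ?thesis
    using assms
  proof cases
    case (alpha_beta)
    have "av n * sh (-1) (bv n) = sh (2 * int n - 1) ff * bv n * sh (-1) (av (Suc n))"
      by (simp add: av_def bv_def sh_ff sh_hom sh_Y power_int_diff power_int_minus power2_eq_square field_simps)
    thus ?thesis unfolding alpha_beta by (simp add: a sh1 c)
  next
    case alpha_gamma
    have "av (Suc m) = ff * sh 1 (av m)" for m
      by (simp add: av_def ff_def sh_hom power_int_diff power_int_minus field_simps)
    thus ?thesis unfolding alpha_gamma by (simp add: a sh1 c split: nat.splits)
  next
    case beta_delta
    have "bv n * sh (-1) (dv (Suc n)) = ff * dv n * sh 1 (bv n)"
      by (simp add: dv_def bv_def ff_def sh_hom sh_Y power_int_add field_simps)
        (simp add: power2_eq_square)
    thus ?thesis unfolding beta_delta by (simp add: a sh1 c)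
  next
    case gamma_delta
    have "sh 1 (dv m) = sh (2 * int (Suc m) - 1) ff * dv (Suc m)" for m
      by (simp add: dv_def sh_ff sh_hom power_int_add field_simps)
    thus ?thesis unfolding gamma_delta by (simp add: a sh1 c split: nat.splits)
  next
    case alpha_delta
    show ?thesis unfolding alpha_delta
      by (simp only: act_diff act_mult act_gen act_elem act_alpha_delta act_delta_alpha act_gamma_beta)
         (simp add: algebra_simps)
  next
    case alpha_delta_G
    show ?thesis unfolding alpha_delta_G
      by (simp only: act_diff act_mult act_gen act_elem act_alpha_delta act_delta_alpha act_beta_gamma to_mero_fun_G gact.simps(5,6) sh_hom b)
         (simp only: f'_def[symmetric] g'_def[symmetric], simp only: f_def[symmetric] g_def[symmetric],
          simp only: g g', simp add: algebra_simps)
  next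
    case beta_gamma_mu
    show ?thesis unfolding beta_gamma_mu
      by (simp only: act_diff act_mult act_gen act_elem act_gamma_beta act_delta_alpha act_beta_gamma to_mero_fun_G gact.simps(5,6) sh_hom b)
         (simp only: f'_def[symmetric] g'_def[symmetric], simp only: f_def[symmetric] g_def[symmetric],
          simp add: algebra_simps)
  next
    case beta_gamma_lam
    show ?thesis unfolding beta_gamma_lam
      by (simp only: act_diff act_mult act_gen act_elem act_gamma_beta act_alpha_delta act_beta_gamma to_mero_fun_G gact.simps(5,6) sh_hom b)
         (simp only: f'_def[symmetric] g'_def[symmetric], simp only: f_def[symmetric] g_def[symmetric],
          simp only: g g', simp add: algebra_simps)
  qed (simp_all add: a sh1 algebra_simps split: nat.splits)
qed

lemma act_zero: "(\<And>n. w n = 0) \<Longrightarrow> act x w n = 0"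
proof -
  assume "\<And>n. w n = 0"
  hence w: "w = (\<lambda>n. const_mero 0 * w n)" by auto
  have "wact u w = (\<lambda>n. const_mero 0 * wact u w n)" for u by (subst w, subst wact_const) simp
  hence "wact u w n = 0" for u by (metis const_mero_0 mult_zero_left)
  thus "act x w n = 0" by (simp add: act_def)
qed

text \<open>Quantifying over all vectors makes the annihilator two-sided: a right factor only
  replaces the vector.\<close>

lemma ideal_act_kernel: "ideal {x. \<forall>w n. act x w n = 0} free_ring"
proof (rule idealI[OF ring_free_ring])
  have neg: "\<ominus>\<^bsub>free_ring\<^esub> x = - x" for x
    using ring_free_ring abelian_group.minus_equality[of free_ring "-x" x]
    by (auto simp: free_ring_def ring_def)
  interpret ring free_ring by (rule ring_free_ring)
  show "subgroup {x. \<forall>w n. act x w n = 0} (add_monoid free_ring)"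
  proof
    fix x assume x: "x \<in> {x. \<forall>w n. act x w n = 0}"
    have "act (- x) w n = 0" for w n
      using act_diff[of 0 x w] x by (simp add: act_0)
    thus "inv\<^bsub>add_monoid free_ring\<^esub> x \<in> {x. \<forall>w n. act x w n = 0}"
      using neg[of x] by (simp add: a_inv_def)
  qed (auto simp: free_ring_def act_add act_0)
qed (auto simp: free_ring_def act_mult act_zero)

text \<open>The determinant acts as 1, so the annihilator contains every relator of SL(2) and the
  action descends to the quotient.\<close>

lemma cls_eq_imp_act_eq:
  assumes "cls q x = cls q y"
  shows   "act x w n = act y w n"
proof -
  have det: "act (det_c q - 1) w n = 0" for w n
  proof -
    have "act (gen Alpha * gen Delta) w n = act (1 + scal (of_real q) * lam (to_mero (fun_F q)) * gen Gamma * gen Beta) w n"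
      by (simp only: act_add act_mult act_gen act_scal act_alpha_delta act_1)
         (simp add: act_gamma_beta[simplified] to_mero_fun_F p_def[symmetric] algebra_simps)
    thus ?thesis by (simp add: det_c_def act_diff act_add act_1)
  qed
  have "ideal_SL2 q \<subseteq> {x. \<forall>w n. act x w n = 0}"
    unfolding ideal_SL2_def
    by (rule ring.genideal_minimal[OF ring_free_ring ideal_act_kernel])
       (auto simp: relators_SL2_def act_diff act_rel det[unfolded act_diff])
  moreover have "x - y \<in> ideal_SL2 q" using assms by (simp add: cls_eq_iff)
  ultimately have "act (x - y) w n = 0" by blast
  thus ?thesis by (simp add: act_diff)
qed

section \<open>Separating functionals\<close>

text \<open>An arbitrary representative; the action depends only on the class.\<close>

definition rep :: "fr_free set \<Rightarrow> fr_free" where "rep x = (SOME u. cls q u = x)"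

definition vac :: "nat \<Rightarrow> mero \<Rightarrow> nat \<Rightarrow> mero" where
  "vac m f n = (if n = m then f else 0)"

definition evf :: "nat \<Rightarrow> fr_free set \<Rightarrow> mero" where
  "evf n x = act (rep x) (vac 0 1) n"

lemma cls_rep: "x \<in> carrier A \<Longrightarrow> cls q (rep x) = x"
  unfolding rep_def by (rule someI_ex) (auto simp: FSL2_carrier)

lemma evf_cls: "evf n (cls q u) = act u (vac 0 1) n"
  unfolding evf_def by (rule cls_eq_imp_act_eq) (simp add: cls_rep)

lemma evf_simps:
  assumes "x \<in> carrier A"
  shows "y \<in> carrier A \<Longrightarrow> evf n (x \<uplus> y) = evf n x + evf n y"
        "evf n (ls f x) = f * evf n x"
        "evf n (scal_cls q c \<cdot> x) = const_mero c * evf n x"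
proof -
  obtain u where [simp]: "x = cls q u" using assms by (auto simp: FSL2_carrier)
  show "evf n (x \<uplus> y) = evf n x + evf n y" if "y \<in> carrier A"
    using that by (auto simp: FSL2_carrier cls_simps evf_cls act_add)
  show "evf n (ls f x) = f * evf n x"
    by (simp add: ls_def gen_cls_def cls_simps evf_cls act_mult act_gen)
  show "evf n (scal_cls q c \<cdot> x) = const_mero c * evf n x"
    by (simp add: cls_simps evf_cls act_mult act_scal)
qed

text \<open>
  \<open>slice n\<close> lifts the map \<open>x \<otimes> y \<mapsto> f(\<mu>)x\<close>, where \<open>f\<close> is the \<open>v\<^sub>n\<close>-coefficient of \<open>y v\<^sub>0\<close>, to representatives.
\<close>

definition slice :: "nat \<Rightarrow> fr_pairs \<Rightarrow> fr_free" where
  "slice n u = (\<Sum>s\<in>Poly_Mapping.keys u. scal (Poly_Mapping.lookup u s) * (mu (evf n (snd s)) * rep (fst s)))"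

lemma slice_superset:
  assumes "finite K" "Poly_Mapping.keys u \<subseteq> K"
  shows   "slice n u = (\<Sum>s\<in>K. scal (Poly_Mapping.lookup u s) * (mu (evf n (snd s)) * rep (fst s)))"
  unfolding slice_def by (rule sum.mono_neutral_left) (use assms in \<open>auto simp: in_keys_iff scal_hom\<close>)

lemma slice_add: "slice n (u + v) = slice n u + slice n v"
proof -
  define K where "K = Poly_Mapping.keys u \<union> Poly_Mapping.keys v"
  have K: "finite K" "Poly_Mapping.keys u \<subseteq> K" "Poly_Mapping.keys v \<subseteq> K" "Poly_Mapping.keys (u + v) \<subseteq> K"
    using Poly_Mapping.keys_add[of u v] by (auto simp: K_def)
  show ?thesis
    using slice_superset[OF K(1,2)] slice_superset[OF K(1,3)] slice_superset[OF K(1,4)]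
    by (simp add: lookup_add scal_hom distrib_right sum.distrib)
qed

lemma slice_0 [simp]: "slice n 0 = 0"
  by (simp add: slice_def)

lemma slice_sum: "slice n (sum f I) = (\<Sum>i\<in>I. slice n (f i))"
  by (induction I rule: infinite_finite_induct) (simp_all add: slice_add)

lemma slice_diff: "slice n (u - v) = slice n u - slice n v"
  using slice_add[of n "u - v" v] by (simp add: algebra_simps)

lemma cls_slice_single:
  assumes "x \<in> carrier A"
  shows   "cls q (slice n (Poly_Mapping.single (x, y) c)) = rs (const_mero c * evf n y) x"
proof (cases "c = 0")
  case False
  thus ?thesis using assms
    by (simp add: slice_def cls_mult cls_gen cls_rep scal_cls_rs rs_def[of "evf n y", symmetric])
next
  case True
  thus ?thesis using assms by (simp add: cls_simps)
qed

lemma composableE: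
  assumes "s \<in> composable q"
  obtains x y a b c where "s = (x, y)" "x \<in> homog q a c" "y \<in> homog q c b" "x \<in> carrier A" "y \<in> carrier A"
  using assms homogD by (auto simp: composable_def)

lemma pairs_mult_diff_left: "pairs_mult q (x - y) z = pairs_mult q x z - pairs_mult q y z"
  and pairs_mult_diff_right: "pairs_mult q z (x - y) = pairs_mult q z x - pairs_mult q z y"
  using pairs_mult_add_left[of q "x - y" y z] pairs_mult_add_right[of q z "x - y" y] by (simp_all add: algebra_simps)

text \<open>Each tensor relation is tested between two symbols, because a two-sided ideal must be
  killed. The decisive case is balancing: f is moved out past the left symbol in both tensor factors
  and suffers the same shift, as the right degree of \<open>s1\<close> is the left degree of
  \<open>s2\<close>.\<close>

lemma slice_rel_tensor_single:
  assumes "rel_tensor q x y" "s \<in> composable q" "r \<in> composable q"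
  shows   "cls q (slice n (pairs_mult q (Poly_Mapping.single s c) (pairs_mult q x (Poly_Mapping.single r d)))) =
           cls q (slice n (pairs_mult q (Poly_Mapping.single s c) (pairs_mult q y (Poly_Mapping.single r d))))"
proof -
  obtain s1 s2 sa sb sc where s: "s = (s1, s2)" "s1 \<in> homog q sa sc" "s2 \<in> homog q sc sb"
    and [simp]: "s1 \<in> carrier A" "s2 \<in> carrier A" using composableE[OF assms(2)] by metis
  obtain r1 r2 ra rb rc where r: "r = (r1, r2)" "r1 \<in> homog q ra rc" "r2 \<in> homog q rc rb"
    and [simp]: "r1 \<in> carrier A" "r2 \<in> carrier A" using composableE[OF assms(3)] by metis
  note pm = pairs_mult_single pair_mult_def s(1) r(1) pairs_mult_add_left pairs_mult_add_right slice_add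
    cls_simps(2)[symmetric] cls_slice_single
  from assms(1) show ?thesis
  proof cases
    case (add_left u a c' u' v b)
    hence [simp]: "u \<in> carrier A" "u' \<in> carrier A" "v \<in> carrier A" using homogD by auto
    show ?thesis unfolding add_left(1,2) by (simp add: pm A.l_distr A.r_distr)
  next
    case (add_right u a c' v b v')
    hence [simp]: "u \<in> carrier A" "v' \<in> carrier A" "v \<in> carrier A" using homogD by auto
    show ?thesis unfolding add_right(1,2)
      by (simp add: pm A.l_distr A.r_distr evf_simps distrib_left rs_add)
  next
    case (scal_left u a c' v b z)
    hence [simp]: "u \<in> carrier A" "v \<in> carrier A" using homogD by auto
    have "s1 \<cdot> (scal_cls q z \<cdot> u \<cdot> r1) = rs (const_mero z) (s1 \<cdot> (u \<cdot> r1))"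
      using homog_ls_rs(2)[OF s(2), of "u \<cdot> r1" "const_mero z"] by (simp add: rs_def R_hom A.m_assoc)
    thus ?thesis unfolding scal_left(1,2)
      by (simp add: pm const_mero_hom mult_ac)
  next
    case (scal_right u a c' v b z)
    hence [simp]: "u \<in> carrier A" "v \<in> carrier A" using homogD by auto
    have "s2 \<cdot> (scal_cls q z \<cdot> v \<cdot> r2) = scal_cls q z \<cdot> (s2 \<cdot> (v \<cdot> r2))"
      using homog_ls_rs(2)[OF s(3), of "v \<cdot> r2" "const_mero z"] by (simp add: rs_def R_hom A.m_assoc)
    thus ?thesis unfolding scal_right(1,2)
      by (simp add: pm evf_simps const_mero_hom mult_ac)
  next
    case (balanced u a c' v b f)
    hence [simp]: "u \<in> carrier A" "v \<in> carrier A" using homogD by auto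
    have "s2 \<cdot> (L f \<cdot> v \<cdot> r2) = ls (sh (- sc) f) (s2 \<cdot> (v \<cdot> r2))"
      using homog_ls_rs(1)[OF s(3), of "v \<cdot> r2" f] by (simp add: ls_def A.m_assoc)
    moreover have "s1 \<cdot> (R f \<cdot> u \<cdot> r1) = rs (sh (- sc) f) (s1 \<cdot> (u \<cdot> r1))"
      using homog_ls_rs(2)[OF s(2), of "u \<cdot> r1" f] by (simp add: rs_def A.m_assoc)
    ultimately show ?thesis unfolding balanced(1,2)
      by (simp add: pm evf_simps mult_ac)
  qed
qed

lemma slice_rel_tensor:
  assumes "rel_tensor q x y" "v \<in> carrier (pairs_ring q)" "w \<in> carrier (pairs_ring q)"
  shows   "slice n (pairs_mult q v (pairs_mult q (x - y) w)) \<in> ideal_SL2 q"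
proof -
  let ?s = "\<lambda>u s. Poly_Mapping.single s (Poly_Mapping.lookup u s)"
  have keys: "Poly_Mapping.keys v \<subseteq> composable q" "Poly_Mapping.keys w \<subseteq> composable q"
    using assms by (auto simp: pairs_ring_def)
  have "pairs_mult q v (pairs_mult q u w) =
      (\<Sum>s\<in>Poly_Mapping.keys v. \<Sum>r\<in>Poly_Mapping.keys w. pairs_mult q (?s v s) (pairs_mult q u (?s w r)))" for u
    by (subst fr_pairs_sum_single[of v], subst fr_pairs_sum_single[of w])
       (simp only: pairs_mult_sum_left pairs_mult_sum_right, rule sum.swap)
  moreover have "cls q (slice n (\<Sum>s\<in>Poly_Mapping.keys v. \<Sum>r\<in>Poly_Mapping.keys w. pairs_mult q (?s v s) (pairs_mult q x (?s w r)))) =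
     cls q (slice n (\<Sum>s\<in>Poly_Mapping.keys v. \<Sum>r\<in>Poly_Mapping.keys w. pairs_mult q (?s v s) (pairs_mult q y (?s w r))))"
    unfolding slice_sum
    by (intro cls_sum_eqI slice_rel_tensor_single assms(1)) (use keys in auto)
  ultimately have "cls q (slice n (pairs_mult q v (pairs_mult q x w))) = cls q (slice n (pairs_mult q v (pairs_mult q y w)))"
    by simp
  thus ?thesis
    by (simp add: cls_eq_iff pairs_mult_diff_left pairs_mult_diff_right slice_diff)
qed

section \<open>Slices on the tensor quotient\<close>

lemma pairs_ring_simps [simp]:
  "x \<otimes>\<^bsub>pairs_ring q\<^esub> y = pairs_mult q x y" "x \<oplus>\<^bsub>pairs_ring q\<^esub> y = x + y" "\<zero>\<^bsub>pairs_ring q\<^esub> = 0"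
  by (simp_all add: pairs_ring_def)

sublocale P: ring "pairs_ring q" by (rule ring_pairs_ring)

sublocale P2: ring "FSL2_tensor q" by (rule ring_FSL2_tensor)

sublocale PI: ideal "ideal_tensor q" "pairs_ring q" by (rule ideal_ideal_tensor)

text \<open>The kernel of a slice need not be an ideal; requiring vanishing after multiplication
  from both sides yields one.\<close>

definition slice_kernel :: "nat \<Rightarrow> fr_pairs set" where
  "slice_kernel n = {u \<in> carrier (pairs_ring q). \<forall>v\<in>carrier (pairs_ring q). \<forall>w\<in>carrier (pairs_ring q).
     slice n (pairs_mult q v (pairs_mult q u w)) \<in> ideal_SL2 q}"

lemma ideal_slice_kernel: "ideal (slice_kernel n) (pairs_ring q)"
proof (rule idealI[OF ring_pairs_ring])
  have neg: "\<ominus>\<^bsub>pairs_ring q\<^esub> x = - x" if "x \<in> carrier (pairs_ring q)" for x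
    using that P.minus_equality[of "- x" x] by (auto simp: pairs_ring_def)
  show "subgroup (slice_kernel n) (add_monoid (pairs_ring q))"
  proof
    fix x assume x: "x \<in> slice_kernel n"
    hence xc: "x \<in> carrier (pairs_ring q)" by (simp add: slice_kernel_def)
    have "slice n (pairs_mult q v (pairs_mult q (- x) w)) \<in> ideal_SL2 q"
      if "v \<in> carrier (pairs_ring q)" "w \<in> carrier (pairs_ring q)" for v w
      using x that pairs_mult_diff_left[of 0 x w] pairs_mult_diff_right[of v 0 "pairs_mult q x w"]
        slice_diff[of n 0 "pairs_mult q v (pairs_mult q x w)"] ideal_SL2_facts(4)
      by (auto simp: slice_kernel_def)
    thus "inv\<^bsub>add_monoid (pairs_ring q)\<^esub> x \<in> slice_kernel n"
      using neg[OF xc] xc P.a_inv_closed[OF xc] by (simp add: a_inv_def slice_kernel_def)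
  next
    fix x y assume "x \<in> slice_kernel n" "y \<in> slice_kernel n"
    thus "x \<otimes>\<^bsub>add_monoid (pairs_ring q)\<^esub> y \<in> slice_kernel n"
      using P.a_closed[of x y]
      by (simp add: slice_kernel_def pairs_mult_add_left pairs_mult_add_right slice_add ideal_SL2_facts)
  next
    show "\<one>\<^bsub>add_monoid (pairs_ring q)\<^esub> \<in> slice_kernel n"
      using P.zero_closed by (simp add: slice_kernel_def ideal_SL2_facts(1))
  qed (auto simp: slice_kernel_def)
next
  fix a x assume ax: "a \<in> slice_kernel n" "x \<in> carrier (pairs_ring q)"
  hence ac: "a \<in> carrier (pairs_ring q)" by (simp add: slice_kernel_def)
  note assoc = P.m_assoc[simplified] and closed = P.m_closed[simplified]
  have "pairs_mult q v (pairs_mult q (pairs_mult q x a) w) = pairs_mult q (pairs_mult q v x) (pairs_mult q a w)"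
    "pairs_mult q v (pairs_mult q (pairs_mult q a x) w) = pairs_mult q v (pairs_mult q a (pairs_mult q x w))"
    if "v \<in> carrier (pairs_ring q)" "w \<in> carrier (pairs_ring q)" for v w
    using that ax(2) ac closed assoc by simp_all
  thus "x \<otimes>\<^bsub>pairs_ring q\<^esub> a \<in> slice_kernel n" "a \<otimes>\<^bsub>pairs_ring q\<^esub> x \<in> slice_kernel n"
    using ax ac closed by (auto simp: slice_kernel_def)
qed

definition tcls :: "fr_pairs \<Rightarrow> fr_pairs set" where
  "tcls u = ideal_tensor q +>\<^bsub>pairs_ring q\<^esub> u"

lemma tcls_eq_imp_slice_eq:
  assumes "tcls u = tcls u'" "u \<in> carrier (pairs_ring q)" "u' \<in> carrier (pairs_ring q)"
  shows   "cls q (slice n u) = cls q (slice n u')"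
proof -
  have sub: "ideal_tensor q \<subseteq> slice_kernel n"
    unfolding ideal_tensor_def
  proof (rule P.genideal_minimal[OF ideal_slice_kernel], safe)
    fix x y assume xy: "rel_tensor q x y"
    have "x - y \<in> carrier (pairs_ring q)"
      using rel_tensor_carrier[OF xy]
      by (auto simp: pairs_ring_def in_keys_iff lookup_minus) (metis in_keys_iff subsetD diff_zero)
    thus "x - y \<in> slice_kernel n" using slice_rel_tensor[OF xy] by (simp add: slice_kernel_def)
  qed
  have "u \<in> tcls u" unfolding tcls_def by (rule PI.a_rcos_self) fact
  with assms(1) obtain i where i: "i \<in> ideal_tensor q" "u = i + u'"
    by (auto simp: tcls_def a_r_coset_def r_coset_def)
  have ic: "i \<in> carrier (pairs_ring q)" using i(1) PI.Icarr by blast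
  \<comment> \<open>Multiplying by the unit on both sides turns membership in
    \<open>slice_kernel\<close> into vanishing of the plain slice.\<close>
  have "pairs_mult q \<one>\<^bsub>pairs_ring q\<^esub> (pairs_mult q i \<one>\<^bsub>pairs_ring q\<^esub>) = i"
    using ic P.l_one P.r_one by simp
  moreover have "slice n (pairs_mult q \<one>\<^bsub>pairs_ring q\<^esub> (pairs_mult q i \<one>\<^bsub>pairs_ring q\<^esub>)) \<in> ideal_SL2 q"
    using i(1) sub P.one_closed by (auto simp: slice_kernel_def)
  ultimately show ?thesis by (simp add: cls_eq_iff i(2) slice_add)
qed

lemma tcls_hom:
  assumes "u \<in> carrier (pairs_ring q)" "v \<in> carrier (pairs_ring q)"
  shows "tcls u \<otimes>\<^bsub>FSL2_tensor q\<^esub> tcls v = tcls (pairs_mult q u v)"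
        "tcls u \<oplus>\<^bsub>FSL2_tensor q\<^esub> tcls v = tcls (u + v)"
  using PI.rcoset_mult_add[OF assms] PI.a_rcos_sum[OF assms]
  by (simp_all add: tcls_def FSL2_tensor_def FactRing_def)

lemma tcls_closed: "u \<in> carrier (pairs_ring q) \<Longrightarrow> tcls u \<in> carrier (FSL2_tensor q)"
  by (auto simp: tcls_def FSL2_tensor_def FactRing_def A_RCOSETS_defs a_r_coset_def r_coset_def)

lemma tensor_tcls: "tensor q x y = tcls (Poly_Mapping.single (x, y) 1)"
  by (simp add: tensor_def tcls_def)

lemma single_composable: "s \<in> composable q \<Longrightarrow> Poly_Mapping.single s c \<in> carrier (pairs_ring q)"
  by (auto simp: pairs_ring_def)

lemma composableI: "x \<in> homog q a c \<Longrightarrow> y \<in> homog q c b \<Longrightarrow> (x, y) \<in> composable q"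
  by (auto simp: composable_def)

lemma sum_pairs_closed:
  "(\<And>i. i \<in> I \<Longrightarrow> f i \<in> carrier (pairs_ring q)) \<Longrightarrow> sum f I \<in> carrier (pairs_ring q)"
proof (induction I rule: infinite_finite_induct)
  case (insert i I)
  thus ?case using P.a_closed[of "f i" "sum f I"] by simp
qed (use P.zero_closed in auto)

lemma finsum_tcls:
  assumes "finite I" "\<And>i. i \<in> I \<Longrightarrow> f i \<in> carrier (pairs_ring q)"
  shows   "(\<Oplus>\<^bsub>FSL2_tensor q\<^esub>i\<in>I. tcls (f i)) = tcls (sum f I)"
  using assms
proof (induction I rule: finite_induct)
  case empty
  have "tcls 0 = \<zero>\<^bsub>FSL2_tensor q\<^esub>"
    using P.a_rcos_zero[OF PI.ideal_axioms PI.zero_closed] 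
    by (simp add: tcls_def FSL2_tensor_def FactRing_def)
  thus ?case by simp
next
  case (insert i I)
  thus ?case by (simp add: tcls_closed tcls_hom sum_pairs_closed)
qed

section \<open>The elements \<open>gamma_alpha\<close> and their action on v_0\<close>

lemma gen_pow: "gen_cls q g [^]\<^bsub>FSL2 q\<^esub> (n :: nat) = cls q (gen g ^ n)"
  by (induction n) (simp_all add: cls_simps cls_mult[symmetric] gen_cls_def power_commutes)

lemma gen_pow_homog:
  "gen_cls q g [^]\<^bsub>FSL2 q\<^esub> (n :: nat) \<in> homog q (int n * fst (gen_deg g)) (int n * snd (gen_deg g))"
proof (induction n)
  case 0
  thus ?case using homog_one by simp
next
  case (Suc n)
  thus ?case using homog_mult[OF Suc gen_homog[of g]] by (simp add: algebra_simps)
qed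

lemma gamma_alpha_homog:
  "k \<le> N \<Longrightarrow> gamma_alpha q N k \<in> homog q (2 * int k - int N) (int N)"
  using homog_mult[OF gen_pow_homog[of Gamma "N - k"] gen_pow_homog[of Alpha k]]
  by (simp add: gamma_alpha_def of_nat_diff algebra_simps)

lemma gamma_alpha_closed [simp]: "gamma_alpha q N k \<in> carrier A"
  by (simp add: gamma_alpha_def)

lemma gact_vac:
  "gact Gamma (vac m f) = vac (Suc m) (sh 1 f)" "gact Alpha (vac m f) = vac m (av m * sh (-1) f)"
  by (auto simp: vac_def fun_eq_iff split: nat.splits)

lemma act_gamma_pow: "act (gen Gamma ^ k) (vac m f) = vac (m + k) (sh (int k) f)"
proof (induction k)
  case (Suc k)
  thus ?case by (simp add: act_mult act_gen gact_vac add.commute del: gact.simps)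
qed (simp add: act_1)

text \<open>The eigenvalue of \<alpha> on v_1 is not constant, and each further \<alpha> shifts the
  earlier ones; the product of shifts telescopes.\<close>

lemma act_alpha_pow:
  "act (gen Alpha ^ j) (vac 0 1) = vac 0 1"
  "act (gen Alpha ^ j) (vac 1 1) = vac 1 (p powi (- int j) * br 2 / br (2 - int j))"
proof (induction j)
  case 0
  case 1 show ?case by (simp add: act_1)
  case 2 show ?case by (simp add: act_1)
next
  case (Suc j)
  case 1 show ?case using Suc(1) by (simp add: act_mult act_gen gact_vac av_def del: gact.simps)
  case 2 show ?case using Suc(2)
    by (simp add: act_mult act_gen gact_vac av_def sh_hom power_int_diff power_int_minus field_simps del: gact.simps One_nat_def)
qed

text \<open>Distinct columns reach distinct basis vectors, so one slice isolates one column. An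
  extra \<gamma> on the right makes \<alpha>^j act on v_1 instead of v_0, which produces
  \<open>psi\<close>.\<close>

lemma evf_gamma_alpha:
  assumes "j \<le> N"
  shows "evf n (gamma_alpha q N j) = (if n = N - j then 1 else 0)"
        "evf n (gamma_alpha q N j \<cdot> \<alpha>) = (if n = N - j then 1 else 0)"
        "evf n (gamma_alpha q N j \<cdot> \<gamma>) = (if n = Suc N - j then psi (int N) (int j) else 0)"
proof -
  have ga: "gamma_alpha q N j = cls q (gen Gamma ^ (N - j) * gen Alpha ^ j)"
    by (simp add: gamma_alpha_def gen_pow cls_simps)
  have "evf n (gamma_alpha q N j) = act (gen Gamma ^ (N - j)) (act (gen Alpha ^ j) (vac 0 1)) n"
    by (simp add: ga evf_cls act_mult)
  thus "evf n (gamma_alpha q N j) = (if n = N - j then 1 else 0)"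
    by (simp add: act_alpha_pow act_gamma_pow) (simp add: vac_def)
  have "evf n (gamma_alpha q N j \<cdot> \<alpha>) = act (gen Gamma ^ (N - j)) (act (gen Alpha ^ j) (act (gen Alpha) (vac 0 1))) n"
    by (simp add: ga gen_cls_def cls_simps evf_cls act_mult)
  also have "act (gen Alpha) (vac 0 1) = vac 0 1" using act_alpha_pow(1)[of 1] by simp
  finally show "evf n (gamma_alpha q N j \<cdot> \<alpha>) = (if n = N - j then 1 else 0)"
    by (simp add: act_alpha_pow act_gamma_pow) (simp add: vac_def)
  have "evf n (gamma_alpha q N j \<cdot> \<gamma>) = act (gen Gamma ^ (N - j)) (act (gen Alpha ^ j) (act (gen Gamma) (vac 0 1))) n"
    by (simp add: ga gen_cls_def cls_simps evf_cls act_mult)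
  also have "act (gen Gamma) (vac 0 1) = vac 1 1" using act_gamma_pow[of 1 0 1] by simp
  finally show "evf n (gamma_alpha q N j \<cdot> \<gamma>) = (if n = Suc N - j then psi (int N) (int j) else 0)"
    using assms by (simp add: act_alpha_pow act_gamma_pow del: One_nat_def)
      (auto simp: vac_def psi_def sh_hom of_nat_diff algebra_simps Suc_diff_le)
qed

text \<open>Each passage of \<gamma> across an \<alpha> contributes a shifted \<open>ff\<close>; the
  product telescopes to the same \<open>psi\<close>, now as a function of \<lambda>.\<close>

lemma gamma_alpha_gamma:
  assumes "k \<le> N"
  shows   "gamma_alpha q N k \<cdot> \<gamma> = ls (psi (int N) (int k)) (gamma_alpha q (Suc N) k)"
proof -
  have 1: "(\<alpha> [^]\<^bsub>A\<^esub> j) \<cdot> \<gamma> = ls (p powi (- int j) * br 2 / br (2 - int j)) (\<gamma> \<cdot> (\<alpha> [^]\<^bsub>A\<^esub> j))" for j :: nat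
  proof (induction j)
    case (Suc j)
    have hom: "\<alpha> [^]\<^bsub>A\<^esub> j \<in> homog q (int j) (int j)" using gen_pow_homog[of Alpha j] by simp
    have "(\<alpha> [^]\<^bsub>A\<^esub> Suc j) \<cdot> \<gamma> = (\<alpha> [^]\<^bsub>A\<^esub> j) \<cdot> ls ff (\<gamma> \<cdot> \<alpha>)"
      by (simp add: A.m_assoc alpha_gamma_comm)
    also have "\<dots> = ls (sh (- int j) ff) ((\<alpha> [^]\<^bsub>A\<^esub> j) \<cdot> \<gamma> \<cdot> \<alpha>)"
      using homog_ls_rs(1)[OF hom, of "\<gamma> \<cdot> \<alpha>" ff] by (simp add: A.m_assoc)
    also have "\<dots> = ls (sh (- int j) ff * (p powi (- int j) * br 2 / br (2 - int j))) (\<gamma> \<cdot> (\<alpha> [^]\<^bsub>A\<^esub> Suc j))"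
      by (simp add: Suc A.m_assoc)
    also have "sh (- int j) ff * (p powi (- int j) * br 2 / br (2 - int j)) = p powi (- int (Suc j)) * br 2 / br (2 - int (Suc j))"
      by (simp add: sh_ff power_int_diff power_int_minus field_simps)
    finally show ?case .
  qed simp
  have hom: "\<gamma> [^]\<^bsub>A\<^esub> (N - k) \<in> homog q (- int (N - k)) (int (N - k))" using gen_pow_homog[of Gamma "N - k"] by simp
  have "gamma_alpha q N k \<cdot> \<gamma> = (\<gamma> [^]\<^bsub>A\<^esub> (N - k)) \<cdot> ls (p powi (- int k) * br 2 / br (2 - int k)) (\<gamma> \<cdot> (\<alpha> [^]\<^bsub>A\<^esub> k))"
    by (simp add: gamma_alpha_def A.m_assoc 1)
  also have "\<dots> = ls (sh (int (N - k)) (p powi (- int k) * br 2 / br (2 - int k))) ((\<gamma> [^]\<^bsub>A\<^esub> (Suc N - k)) \<cdot> (\<alpha> [^]\<^bsub>A\<^esub> k))"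
    using homog_ls_rs(1)[OF hom] assms by (simp add: A.m_assoc Suc_diff_le)
  also have "sh (int (N - k)) (p powi (- int k) * br 2 / br (2 - int k)) = psi (int N) (int k)"
    using assms by (simp add: psi_def sh_hom of_nat_diff algebra_simps)
  finally show ?thesis by (simp add: gamma_alpha_def)
qed

end

section \<open>Matrix elements and the raising formulas\<close>

locale dynamical_matrix_elements = dynamical_SL2 +
  fixes D :: "fr_free set \<Rightarrow> fr_pairs set" and t :: "nat \<Rightarrow> nat \<Rightarrow> nat \<Rightarrow> fr_free set"
  assumes coproduct: "is_coproduct q D" and matrix_elements: "is_matrix_elements q D t"
begin

text \<open>
  The column index is an integer and \<open>T\<close> vanishes outside the range of \<open>t\<close>, so that the recursions need
  no boundary cases.
\<close>

definition T :: "nat \<Rightarrow> nat \<Rightarrow> int \<Rightarrow> fr_free set" where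
  "T N k i = (if k \<le> N \<and> 0 \<le> i \<and> i \<le> int N then t N k (nat i) else zeroA)"

lemma T_homog: "T N k i \<in> homog q (2 * int k - int N) (2 * i - int N)"
proof (cases "k \<le> N \<and> 0 \<le> i \<and> i \<le> int N")
  case True
  hence "nat i \<le> N" by auto
  hence "t N k (nat i) \<in> homog q (2 * int k - int N) (2 * int (nat i) - int N)"
    using True matrix_elements unfolding is_matrix_elements_def by blast
  thus ?thesis using True by (simp add: T_def)
next
  case False
  have "zeroA \<in> homog q a b" for a b
    unfolding homog_def by (rule image_eqI[of _ _ 0]) (simp_all add: cls_simps)
  thus ?thesis using False by (auto simp: T_def)
qed

lemma T_closed [simp]: "T N k i \<in> carrier A"
  using T_homog homogD by blast

lemma T_outside: "\<not> (0 \<le> i \<and> i \<le> int N) \<Longrightarrow> T N k i = zeroA" "k > N \<Longrightarrow> T N k i = zeroA"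
  by (auto simp: T_def)

text \<open>A concrete representative of the coproduct of \<open>gamma_alpha q N k\<close>, needed
  because slices act on representatives.\<close>

definition S :: "nat \<Rightarrow> nat \<Rightarrow> fr_pairs" where
  "S N k = (\<Sum>j\<in>{0..N}. Poly_Mapping.single (T N k (int j), gamma_alpha q N j) 1)"

lemma S_closed: "S N k \<in> carrier (pairs_ring q)"
  unfolding S_def
  by (intro sum_pairs_closed single_composable composableI[OF T_homog]) (auto intro: gamma_alpha_homog)

lemma D_hom:
  assumes "x \<in> carrier A" "y \<in> carrier A"
  shows "D (x \<cdot> y) = D x \<otimes>\<^bsub>FSL2_tensor q\<^esub> D y"
  using coproduct assms by (simp add: is_coproduct_def ring_hom_def)

lemma D_gamma_alpha:
  assumes "k \<le> N"
  shows   "D (gamma_alpha q N k) = tcls (S N k)"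
proof -
  have "D (gamma_alpha q N k) = (\<Oplus>\<^bsub>FSL2_tensor q\<^esub>j\<in>{0..N}. tensor q (t N k j) (gamma_alpha q N j))"
    using matrix_elements assms by (simp add: is_matrix_elements_def)
  also have "\<dots> = (\<Oplus>\<^bsub>FSL2_tensor q\<^esub>j\<in>{0..N}. tcls (Poly_Mapping.single (T N k (int j), gamma_alpha q N j) 1))"
  proof (rule P2.finsum_cong')
    show "tensor q (t N k j) (gamma_alpha q N j) = tcls (Poly_Mapping.single (T N k (int j), gamma_alpha q N j) 1)"
      if "j \<in> {0..N}" for j
      using that assms by (simp add: tensor_tcls T_def)
  qed (auto intro!: tcls_closed single_composable composableI[OF T_homog] gamma_alpha_homog)
  also have "\<dots> = tcls (S N k)"
    unfolding S_def
    by (rule finsum_tcls) (auto intro!: single_composable composableI[OF T_homog] gamma_alpha_homog)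
  finally show ?thesis .
qed

lemma slice_sum_single:
  assumes "\<And>j. j \<le> N \<Longrightarrow> evf n (e j) = (if int j = i then c else 0)" "\<And>i. f i \<in> carrier A"
    "\<not> (0 \<le> i \<and> i \<le> int N) \<Longrightarrow> f i = zeroA"
  shows "cls q (slice n (\<Sum>j\<in>{0..N}. Poly_Mapping.single (f (int j), e j) 1)) = rs c (f i)"
proof -
  have "cls q (slice n (\<Sum>j\<in>{0..N}. Poly_Mapping.single (f (int j), e j) 1)) =
        cls q (\<Sum>j\<in>{0..N}. if int j = i then rep (rs c (f i)) else 0)"
    unfolding slice_sum using assms(1,2)
    by (intro cls_sum_eqI) (auto simp: cls_slice_single cls_rep cls_simps)
  also have "(\<Sum>j\<in>{0..N}. if int j = i then rep (rs c (f i)) else 0) =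
      (if 0 \<le> i \<and> i \<le> int N then rep (rs c (f i)) else 0)"
  proof (cases "0 \<le> i \<and> i \<le> int N")
    case True
    hence "(\<Sum>j\<in>{0..N}. if int j = i then rep (rs c (f i)) else 0) = (\<Sum>j\<in>{0..N}. if nat i = j then rep (rs c (f i)) else 0)"
      by (intro sum.cong) auto
    thus ?thesis using True by (simp add: nat_le_iff)
  next
    case False
    thus ?thesis by (auto intro!: sum.neutral)
  qed
  also have "cls q \<dots> = rs c (f i)"
    using assms(2,3) by (auto simp: cls_rep cls_simps)
  finally show ?thesis .
qed

lemma slice_S_single:
  assumes "\<And>j. j \<le> N \<Longrightarrow> evf n (gamma_alpha q N j \<cdot> y) = (if int j = i then c else 0)"
    "x \<in> carrier A"
  shows "cls q (slice n (pairs_mult q (S N k) (Poly_Mapping.single (x, y) 1))) = rs c (T N k i \<cdot> x)"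
proof -
  have "pairs_mult q (S N k) (Poly_Mapping.single (x, y) 1) =
     (\<Sum>j\<in>{0..N}. Poly_Mapping.single (T N k (int j) \<cdot> x, gamma_alpha q N j \<cdot> y) 1)"
    by (simp add: S_def pairs_mult_sum_left pairs_mult_single pair_mult_def)
  also have "cls q (slice n \<dots>) = rs c (T N k i \<cdot> x)"
    by (rule slice_sum_single[where f = "\<lambda>i. T N k i \<cdot> x"]) (use assms in \<open>auto simp: T_outside\<close>)
  finally show ?thesis .
qed

lemma slice_S:
  assumes "\<And>j. j \<le> N \<Longrightarrow> evf n (gamma_alpha q N j) = (if int j = i then c else 0)"
  shows "cls q (slice n (S N k)) = rs c (T N k i)"
  unfolding S_def by (rule slice_sum_single) (use assms in \<open>auto simp: T_outside\<close>)

lemma slice_single_S: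
  assumes "\<And>j. j \<le> N \<Longrightarrow> evf n (gamma_alpha q N j) = (if int j = i then c else 0)"
    "x \<in> carrier A"
  shows "cls q (slice n (pairs_mult q (Poly_Mapping.single (x, oneA) 1) (S N k))) = rs c (x \<cdot> T N k i)"
proof -
  have "pairs_mult q (Poly_Mapping.single (x, oneA) 1) (S N k) =
     (\<Sum>j\<in>{0..N}. Poly_Mapping.single (x \<cdot> T N k (int j), gamma_alpha q N j) 1)"
    by (simp add: S_def pairs_mult_sum_right pairs_mult_single pair_mult_def)
  also have "cls q (slice n \<dots>) = rs c (x \<cdot> T N k i)"
    by (rule slice_sum_single[where f = "\<lambda>i. x \<cdot> T N k i"]) (use assms in \<open>auto simp: T_outside\<close>)
  finally show ?thesis .
qed

lemma D_gens:
  "D \<alpha> = tcls (Poly_Mapping.single (\<alpha>, \<alpha>) 1 + Poly_Mapping.single (\<beta>, \<gamma>) 1)"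
  "D \<gamma> = tcls (Poly_Mapping.single (\<gamma>, \<alpha>) 1 + Poly_Mapping.single (\<delta>, \<gamma>) 1)"
  "D (L f) = tcls (Poly_Mapping.single (L f, oneA) 1)"
  "D oneA = tcls (Poly_Mapping.single (oneA, oneA) 1)"
  and composable_gens: "(\<alpha>, \<alpha>) \<in> composable q" "(\<beta>, \<gamma>) \<in> composable q" "(\<gamma>, \<alpha>) \<in> composable q" "(\<delta>, \<gamma>) \<in> composable q"
    "(L f, oneA) \<in> composable q" "(oneA, oneA) \<in> composable q"
proof -
  show c: "(\<alpha>, \<alpha>) \<in> composable q" "(\<beta>, \<gamma>) \<in> composable q" "(\<gamma>, \<alpha>) \<in> composable q" "(\<delta>, \<gamma>) \<in> composable q"
    "(L f, oneA) \<in> composable q" "(oneA, oneA) \<in> composable q" for f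
    using composableI[OF gen_homog[of Alpha], of \<alpha>] composableI[OF gen_homog[of Beta], of \<gamma>]
      composableI[OF gen_homog[of Gamma], of \<alpha>] composableI[OF gen_homog[of Delta], of \<gamma>]
      gen_homog[of Alpha] gen_homog[of Gamma] composableI[OF gen_homog[of "MuL f"], of oneA]
      composableI[OF homog_one homog_one] homog_one[of q]
    by simp_all
  show "D \<alpha> = tcls (Poly_Mapping.single (\<alpha>, \<alpha>) 1 + Poly_Mapping.single (\<beta>, \<gamma>) 1)"
  "D \<gamma> = tcls (Poly_Mapping.single (\<gamma>, \<alpha>) 1 + Poly_Mapping.single (\<delta>, \<gamma>) 1)"
  "D (L f) = tcls (Poly_Mapping.single (L f, oneA) 1)"
    using coproduct c by (simp_all add: is_coproduct_def tensor_tcls tcls_hom single_composable)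
  have "D oneA = \<one>\<^bsub>FSL2_tensor q\<^esub>" using coproduct by (simp add: is_coproduct_def ring_hom_def)
  thus "D oneA = tcls (Poly_Mapping.single (oneA, oneA) 1)"
    by (simp add: FSL2_tensor_def FactRing_def tcls_def) (simp add: pairs_ring_def)
qed

lemma T_0_0_0: "T 0 0 0 = oneA"
proof -
  have "gamma_alpha q 0 0 = oneA" by (simp add: gamma_alpha_def)
  hence "tcls (S 0 0) = tcls (Poly_Mapping.single (oneA, oneA) 1)"
    using D_gamma_alpha[of 0 0] D_gens(4) by simp
  hence "cls q (slice 0 (S 0 0)) = cls q (slice 0 (Poly_Mapping.single (oneA, oneA) 1))"
    by (rule tcls_eq_imp_slice_eq) (simp_all add: S_closed single_composable composable_gens)
  moreover have "evf 0 (gamma_alpha q 0 0) = 1" using evf_gamma_alpha(1)[of 0 0 0] by simp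
  ultimately show ?thesis
    using slice_S[of 0 0 0 1 0] \<open>gamma_alpha q 0 0 = oneA\<close> by (simp add: cls_slice_single)
qed

text \<open>Compare both sides of the coproduct of \<open>gamma_alpha q N k\<close> times \<alpha>.
  The symbol \<alpha> \<otimes> \<alpha> contributes column i - 1 with coefficient 1, and \<beta>
  \<otimes> \<gamma> contributes column i with coefficient \<open>psi\<close>.\<close>

lemma T_Suc_alpha_beta:
  assumes "k \<le> N"
  shows   "T (Suc N) (Suc k) i = T N k (i - 1) \<cdot> \<alpha> \<uplus> rs (psi (int N) i) (T N k i \<cdot> \<beta>)"
proof (cases "0 \<le> i \<and> i \<le> int (Suc N)")
  case True
  define n where "n = nat (int (Suc N) - i)"
  \<comment> \<open>At level N + 1, column i sends v_0 to v_n for this n.\<close>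
  have n: "int n = int N + 1 - i" using True by (simp add: n_def)
  have "gamma_alpha q (Suc N) (Suc k) = gamma_alpha q N k \<cdot> \<alpha>"
    by (simp add: gamma_alpha_def A.m_assoc)
  hence "tcls (S (Suc N) (Suc k)) = tcls (pairs_mult q (S N k) (Poly_Mapping.single (\<alpha>, \<alpha>) 1 + Poly_Mapping.single (\<beta>, \<gamma>) 1))"
    using D_gamma_alpha[of "Suc k" "Suc N"] D_hom[of "gamma_alpha q N k" \<alpha>] D_gamma_alpha[of k N] D_gens assms
      tcls_hom(1)[OF S_closed P.a_closed[OF single_composable single_composable]] composable_gens
    by simp
  hence "cls q (slice n (S (Suc N) (Suc k))) =
      cls q (slice n (pairs_mult q (S N k) (Poly_Mapping.single (\<alpha>, \<alpha>) 1 + Poly_Mapping.single (\<beta>, \<gamma>) 1)))"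
    using P.m_closed[OF S_closed P.a_closed[OF single_composable single_composable]] composable_gens
    by (intro tcls_eq_imp_slice_eq S_closed) simp_all
  also have "\<dots> = cls q (slice n (pairs_mult q (S N k) (Poly_Mapping.single (\<alpha>, \<alpha>) 1))) \<uplus>
      cls q (slice n (pairs_mult q (S N k) (Poly_Mapping.single (\<beta>, \<gamma>) 1)))"
    by (simp add: pairs_mult_add_right slice_add cls_simps)
  also have "cls q (slice n (pairs_mult q (S N k) (Poly_Mapping.single (\<alpha>, \<alpha>) 1))) = rs 1 (T N k (i - 1) \<cdot> \<alpha>)"
    by (rule slice_S_single) (use n in \<open>auto simp: evf_gamma_alpha\<close>)
  also have "cls q (slice n (pairs_mult q (S N k) (Poly_Mapping.single (\<beta>, \<gamma>) 1))) = rs (psi (int N) i) (T N k i \<cdot> \<beta>)"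
    by (rule slice_S_single) (use n in \<open>auto simp: evf_gamma_alpha\<close>)
  also have "cls q (slice n (S (Suc N) (Suc k))) = rs 1 (T (Suc N) (Suc k) i)"
    by (rule slice_S) (use n in \<open>auto simp: evf_gamma_alpha\<close>)
  finally show ?thesis by simp
qed (auto simp: T_outside)

text \<open>Here the right factor is \<gamma>, which must be moved across \<alpha>^k before the
  product is again some \<open>gamma_alpha\<close>; this is the source of the left
  coefficient.\<close>

lemma T_Suc_gamma_delta:
  assumes "k \<le> N"
  shows   "ls (psi (int N) (int k)) (T (Suc N) k i) = T N k (i - 1) \<cdot> \<gamma> \<uplus> rs (psi (int N) i) (T N k i \<cdot> \<delta>)"
proof (cases "0 \<le> i \<and> i \<le> int (Suc N)")
  case True
  define n where "n = nat (int (Suc N) - i)"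
  have n: "int n = int N + 1 - i" using True by (simp add: n_def)
  let ?f = "psi (int N) (int k)"
  have "tcls (pairs_mult q (Poly_Mapping.single (L ?f, oneA) 1) (S (Suc N) k)) =
      tcls (pairs_mult q (S N k) (Poly_Mapping.single (\<gamma>, \<alpha>) 1 + Poly_Mapping.single (\<delta>, \<gamma>) 1))"
    using gamma_alpha_gamma[OF assms] D_hom[of "L ?f" "gamma_alpha q (Suc N) k"] D_gamma_alpha[of k "Suc N"]
      D_hom[of "gamma_alpha q N k" \<gamma>] D_gamma_alpha[of k N] D_gens assms
      tcls_hom(1)[OF S_closed P.a_closed[OF single_composable single_composable]] composable_gens
      tcls_hom(1)[OF single_composable S_closed]
    by (simp add: ls_def)
  hence "cls q (slice n (pairs_mult q (Poly_Mapping.single (L ?f, oneA) 1) (S (Suc N) k))) =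
      cls q (slice n (pairs_mult q (S N k) (Poly_Mapping.single (\<gamma>, \<alpha>) 1 + Poly_Mapping.single (\<delta>, \<gamma>) 1)))"
    using P.m_closed[OF S_closed P.a_closed[OF single_composable single_composable]] composable_gens
      P.m_closed[OF single_composable S_closed]
    by (intro tcls_eq_imp_slice_eq) simp_all
  also have "\<dots> = cls q (slice n (pairs_mult q (S N k) (Poly_Mapping.single (\<gamma>, \<alpha>) 1))) \<uplus>
      cls q (slice n (pairs_mult q (S N k) (Poly_Mapping.single (\<delta>, \<gamma>) 1)))"
    by (simp add: pairs_mult_add_right slice_add cls_simps)
  also have "cls q (slice n (pairs_mult q (S N k) (Poly_Mapping.single (\<gamma>, \<alpha>) 1))) = rs 1 (T N k (i - 1) \<cdot> \<gamma>)"
    by (rule slice_S_single) (use n in \<open>auto simp: evf_gamma_alpha\<close>)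
  also have "cls q (slice n (pairs_mult q (S N k) (Poly_Mapping.single (\<delta>, \<gamma>) 1))) = rs (psi (int N) i) (T N k i \<cdot> \<delta>)"
    by (rule slice_S_single) (use n in \<open>auto simp: evf_gamma_alpha\<close>)
  also have "cls q (slice n (pairs_mult q (Poly_Mapping.single (L ?f, oneA) 1) (S (Suc N) k))) = rs 1 (L ?f \<cdot> T (Suc N) k i)"
    by (rule slice_single_S) (use n in \<open>auto simp: evf_gamma_alpha\<close>)
  finally show ?thesis by (simp add: ls_def)
qed (auto simp: T_outside)

end

section \<open>Clebsch--Gordan rules\<close>

context dynamical_SL2
begin

text \<open>
  The common induction step of the two contraction rules: the family \<open>\<tau>\<close> is a row of \<open>t\<^sup>N\<close>, which the
  generators \<open>a', b'\<close> raise to a row of \<open>t\<^sup>N\<^sup>+\<^sup>1\<close>, and \<open>\<theta>\<close> is the inhomogeneous term (0 or 1) in the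
  relation between \<open>b'a\<close> and \<open>a'b\<close>.
\<close>

lemma raising_step:
  assumes \<tau>: "\<And>i. \<tau> i \<in> homog q d (2 * i - int N)" and \<rho>: "\<And>i. \<rho> i \<in> carrier A"
    and gens: "a = gen_cls q a0" "b = gen_cls q b0" "a' = gen_cls q a1" "b' = gen_cls q b1"
    and \<theta>: "\<theta> \<in> carrier A" "b' \<cdot> a = \<theta> \<uplus> rs gg (a' \<cdot> b)"
    and IH: "\<And>i. rs (num (int N - i)) (\<tau> i \<cdot> a') = rs (ws (int N) i) (\<tau> (i + 1) \<cdot> b') \<uplus> \<rho> i"
  shows "rs (num (int N + 1 - i)) ((\<tau> (i - 1) \<cdot> a' \<uplus> rs (psi (int N) i) (\<tau> i \<cdot> b')) \<cdot> a) =
         rs (ws (int N + 1) i) ((\<tau> i \<cdot> a' \<uplus> rs (psi (int N) (i + 1)) (\<tau> (i + 1) \<cdot> b')) \<cdot> b) \<uplus>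
         rs (p powi (- i) * num (int N + 1)) (\<tau> i \<cdot> \<theta>) \<uplus> (\<rho> (i - 1) \<cdot> a \<uplus> rs (cc (int N) i) (\<rho> i \<cdot> b))"
proof -
  have [simp]: "\<tau> i \<in> carrier A" for i using \<tau> homogD by blast
  note [simp] = \<rho> \<theta>(1)
  have [simp]: "a \<in> carrier A" "b \<in> carrier A" "a' \<in> carrier A" "b' \<in> carrier A" by (simp_all add: gens)
  let ?n = "num (int N + 1 - i)" and ?w = "ws (int N + 1) i" and ?c = "cc (int N) i"
  have 1: "rs ?n (\<tau> (i - 1) \<cdot> a') = rs (ws (int N) (i - 1)) (\<tau> i \<cdot> b') \<uplus> \<rho> (i - 1)"
    using IH[of "i - 1"] by (simp add: algebra_simps)
  have 2: "\<tau> i \<cdot> (b' \<cdot> a) = \<tau> i \<cdot> \<theta> \<uplus> rs (sh (int N - 2 * i) gg) (\<tau> i \<cdot> (a' \<cdot> b))"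
    by (simp add: \<theta>(2) A.r_distr homog_ls_rs(2)[OF \<tau>])
  have "rs ?n ((\<tau> (i - 1) \<cdot> a' \<uplus> rs (psi (int N) i) (\<tau> i \<cdot> b')) \<cdot> a) =
        (rs ?n (\<tau> (i - 1) \<cdot> a')) \<cdot> a \<uplus> rs (?n * psi (int N) i) (\<tau> i \<cdot> (b' \<cdot> a))"
    by (simp add: A.l_distr A.m_assoc)
  also have "\<dots> = rs (ws (int N) (i - 1) + ?n * psi (int N) i) (\<tau> i \<cdot> (b' \<cdot> a)) \<uplus> \<rho> (i - 1) \<cdot> a"
    unfolding 1 by (simp add: A.l_distr A.m_assoc rs_add A.a_ac)
  also have "ws (int N) (i - 1) + ?n * psi (int N) i = p powi (- i) * num (int N + 1)"
    using ws_psi[of "int N" "i - 1"] by (simp add: algebra_simps)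
  also have "rs (p powi (- i) * num (int N + 1)) (\<tau> i \<cdot> (b' \<cdot> a)) =
     rs (p powi (- i) * num (int N + 1)) (\<tau> i \<cdot> \<theta>) \<uplus> rs (?w + num (int N - i) * ?c) (\<tau> i \<cdot> (a' \<cdot> b))"
    unfolding 2 gg_ws_cc[symmetric] by (simp add: mult_ac)
  also have "rs (?w + num (int N - i) * ?c) (\<tau> i \<cdot> (a' \<cdot> b)) =
     rs ?w (\<tau> i \<cdot> (a' \<cdot> b)) \<uplus> rs ?c ((rs (num (int N - i)) (\<tau> i \<cdot> a')) \<cdot> b)"
    by (simp add: rs_add A.m_assoc mult_ac)
  also have "rs ?c ((rs (num (int N - i)) (\<tau> i \<cdot> a')) \<cdot> b) =
     rs (?w * psi (int N) (i + 1)) (\<tau> (i + 1) \<cdot> (b' \<cdot> b)) \<uplus> rs ?c (\<rho> i \<cdot> b)"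
    unfolding IH ws_psi_cc by (simp add: A.l_distr A.m_assoc)
  finally show ?thesis
    by (simp add: A.l_distr A.m_assoc A.a_ac)
qed

text \<open>Cramer's rule with determinant \<open>ws_psi\<close>; u is the inverse of that
  determinant.\<close>

lemma decompose_product:
  assumes c[simp]: "x \<in> carrier A" "y \<in> carrier A" "r \<in> carrier A" "m \<in> carrier A"
    and m: "m = x \<uplus> rs (psi N (i + 1)) y"
    and n: "rs (num (N - i)) x = rs (ws N i) y \<uplus> r" and "N + 1 \<noteq> 0"
  defines "u \<equiv> p powi (i + 1) / num (N + 1)"
  shows "y = rs (u * num (N - i)) m \<uplus> rs (- u) r"
    and "x = rs (u * ws N i) m \<uplus> rs (u * psi N (i + 1)) r"
proof -
  have u: "u * (p powi (- i - 1) * num (N + 1)) = 1"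
    using \<open>N + 1 \<noteq> 0\<close> by (simp add: u_def power_int_diff power_int_minus power_int_add)
  have "rs (num (N - i)) m = rs (ws N i + num (N - i) * psi N (i + 1)) y \<uplus> r"
    by (simp add: m n rs_add A.a_ac)
  hence 1: "rs (num (N - i)) m = rs (p powi (- i - 1) * num (N + 1)) y \<uplus> r" by (simp only: ws_psi)
  have "rs (u * num (N - i)) m \<uplus> rs (- u) r = rs u (rs (num (N - i)) m) \<uplus> rs (- u) r" by simp
  also have "\<dots> = y \<uplus> (rs u r \<uplus> rs (- u) r)"
    unfolding 1 by (simp add: u A.a_assoc)
  also have "rs u r \<uplus> rs (- u) r = zeroA" by (simp flip: rs_add)
  finally show "y = rs (u * num (N - i)) m \<uplus> rs (- u) r" by simp
  have "rs (ws N i) m \<uplus> rs (psi N (i + 1)) r = rs (ws N i) x \<uplus> rs (psi N (i + 1)) (rs (ws N i) y \<uplus> r)"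
    by (simp add: m A.a_ac mult_ac)
  also have "\<dots> = rs (ws N i + num (N - i) * psi N (i + 1)) x"
    unfolding n[symmetric] by (simp add: rs_add mult_ac)
  also have "\<dots> = rs (p powi (- i - 1) * num (N + 1)) x" by (simp only: ws_psi)
  finally have 2: "rs (ws N i) m \<uplus> rs (psi N (i + 1)) r = rs (p powi (- i - 1) * num (N + 1)) x" .
  have "rs (u * ws N i) m \<uplus> rs (u * psi N (i + 1)) r = rs u (rs (ws N i) m \<uplus> rs (psi N (i + 1)) r)"
    by simp
  also have "\<dots> = x" unfolding 2 by (simp add: u)
  finally show "x = rs (u * ws N i) m \<uplus> rs (u * psi N (i + 1)) r" ..
qed

lemma ls_p_powi: "x \<in> carrier A \<Longrightarrow> ls (p powi n) x = rs (p powi n) x"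
  and ls_num: "x \<in> carrier A \<Longrightarrow> ls (num n) x = rs (num n) x"
  by (simp_all add: ls_def rs_def L_p L_num)

lemma ls_uminus_p: "y \<in> carrier A \<Longrightarrow> ls (- p * x) y = rs (- p) (ls x y)"
  and ls_num_mult: "y \<in> carrier A \<Longrightarrow> ls (num n * x) y = rs (num n) (ls x y)"
proof -
  have "L (- p) = R (- p)"
    using L_hom(4)[of "- of_real q"] R_hom(4)[of "- of_real q"] by (simp add: const_mero_uminus p_def)
  thus "y \<in> carrier A \<Longrightarrow> ls (- p * x) y = rs (- p) (ls x y)"
    using ls_rs_simps(1)[of y "- p" x, symmetric] by (simp add: ls_def rs_def)
  show "y \<in> carrier A \<Longrightarrow> ls (num n * x) y = rs (num n) (ls x y)"
    using ls_num[of "ls x y" n] by simp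
qed

lemma collect_terms:
  assumes [simp]: "z \<in> carrier A" "y \<in> carrier A"
  shows "ls a z \<uplus> (ls a (rs (e * num n) y \<uplus> rs e (ls x y)) \<uplus> rs (w + e * c) y) =
         (ls a z \<uplus> rs w y) \<uplus> rs e (ls (a * (x + num n)) y \<uplus> rs c y)"
proof -
  have "ls (a * (x + num n)) y = ls (a * x) y \<uplus> ls a (rs (num n) y)"
    using ls_num[of y n] ls_rs_simps(1)[of y a "num n"] by (simp add: distrib_left ls_add)
  thus ?thesis by (simp add: rs_add A.a_ac)
qed

end

context dynamical_matrix_elements
begin

text \<open>Row 0 is raised by \<gamma>, \<delta> and has no remainder. A higher row is raised by
  \<alpha>, \<beta>; its products are reordered so that the inductive hypothesis applies, and the
  terms left by the determinant accumulate in \<open>xi\<close>. The truncated indices N - 1 and k -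
  1 are harmless: for k = 0 the coefficient \<open>xi\<close> vanishes.\<close>

lemma contraction_gamma_delta:
  assumes "k \<le> N"
  shows "rs (num (int N - i)) (T N k i \<cdot> \<gamma>) =
         rs (ws (int N) i) (T N k (i + 1) \<cdot> \<delta>) \<uplus> rs (p powi (- i)) (ls (xi (int N) (int k)) (T (N - 1) (k - 1) i))"
  using assms
proof (induction N arbitrary: k i)
  case 0
  have "ws 0 i = 0 \<or> i \<noteq> -1" by (cases "i = -1") (simp_all add: ws_def)
  moreover have "xi 0 0 = 0" by (simp add: xi_def)
  moreover have "num (- i) = 0 \<or> i \<noteq> 0" by simp
  ultimately show ?case using 0 by (cases "i = 0"; cases "i = -1") (auto simp: T_outside)
next
  case (Suc N)
  have N1: "int (Suc N) = int N + 1" by simp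
  show ?case
  proof (cases k)
    case 0
    have T0: "T (Suc N) 0 j = T N 0 (j - 1) \<cdot> \<gamma> \<uplus> rs (psi (int N) j) (T N 0 j \<cdot> \<delta>)" for j
      using T_Suc_gamma_delta[of 0 N j] by (simp add: psi_def)
    have "xi n 0 = 0" for n by (simp add: xi_def)
    moreover have "rs (num (int N + 1 - i)) ((T N 0 (i - 1) \<cdot> \<gamma> \<uplus> rs (psi (int N) i) (T N 0 i \<cdot> \<delta>)) \<cdot> \<gamma>) =
      rs (ws (int N + 1) i) ((T N 0 i \<cdot> \<gamma> \<uplus> rs (psi (int N) (i + 1)) (T N 0 (i + 1) \<cdot> \<delta>)) \<cdot> \<delta>) \<uplus>
      rs (p powi (- i) * num (int N + 1)) (T N 0 i \<cdot> zeroA) \<uplus> (zeroA \<cdot> \<gamma> \<uplus> rs (cc (int N) i) (zeroA \<cdot> \<delta>))"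
      by (rule raising_step[where \<rho> = "\<lambda>_. zeroA" and a = \<gamma> and a' = \<gamma> and b = \<delta> and b' = \<delta>, OF T_homog A.zero_closed refl refl refl refl])
         (use Suc.IH[of 0] in \<open>simp_all add: delta_gamma_comm xi_def\<close>)
    ultimately show ?thesis unfolding 0 T0 N1 by simp
  next
    case (Suc k')
    hence k': "k' \<le> N" using Suc.prems by simp
    let ?\<tau> = "T N k'" and ?f = "sh (int N - 2 * int k') ff"
    define \<rho> where "\<rho> j = rs (p powi (- j)) (ls (xi (int N) (int k')) (T (N - 1) (k' - 1) j))" for j
    have [simp]: "\<rho> j \<in> carrier A" for j by (simp add: \<rho>_def)
    \<comment> \<open>By \<open>cc_psi\<close> the two remainders form the raising formula from
      level N - 1, so they give back row k' of level N.\<close>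
    have tail: "\<rho> (i - 1) \<cdot> \<alpha> \<uplus> rs (cc (int N) i) (\<rho> i \<cdot> \<beta>) = rs (p powi (- i)) (ls (p * xi (int N) (int k')) (?\<tau> i))"
    proof (cases "k' = 0")
      case True
      thus ?thesis by (simp add: \<rho>_def xi_def)
    next
      case False
      with k' have "N > 0" by simp
      have e: "p powi (1 - i) = p powi (- i) * p" by (simp add: power_int_diff power_int_minus divide_inverse)
      have "T N k' i = T (N - 1) (k' - 1) (i - 1) \<cdot> \<alpha> \<uplus> rs (psi (int N - 1) i) (T (N - 1) (k' - 1) i \<cdot> \<beta>)"
        using T_Suc_alpha_beta[of "k' - 1" "N - 1" i] False k' \<open>N > 0\<close> by (simp add: of_nat_diff)
      moreover have "ls (p * xi (int N) (int k')) y = rs p (ls (xi (int N) (int k')) y)" if "y \<in> carrier A" for y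
        using that ls_p_powi[of "ls (xi (int N) (int k')) y" 1] by simp
      ultimately show ?thesis by (simp add: \<rho>_def cc_psi e mult_ac)
    qed
    have T1: "T (Suc N) (Suc k') j = ?\<tau> (j - 1) \<cdot> \<alpha> \<uplus> rs (psi (int N) j) (?\<tau> j \<cdot> \<beta>)" for j
      using T_Suc_alpha_beta[OF k'] .
    \<comment> \<open>Reordering turns right multiplication by \<gamma> or \<delta> into one by
      \<alpha> or \<beta>, at the price of a common left factor \<open>ff\<close> and inhomogeneous
      terms.\<close>
    have ag: "?\<tau> j \<cdot> \<alpha> \<cdot> \<gamma> = ls ?f (?\<tau> j \<cdot> \<gamma> \<cdot> \<alpha>)" for j
      using homog_ls_rs(1)[OF T_homog, of "\<gamma> \<cdot> \<alpha>" N k' j ff] by (simp add: A.m_assoc alpha_gamma_comm)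
    have bd: "?\<tau> j \<cdot> \<beta> \<cdot> \<delta> = ls ?f (?\<tau> j \<cdot> \<delta> \<cdot> \<beta>)" for j
      using homog_ls_rs(1)[OF T_homog, of "\<delta> \<cdot> \<beta>" N k' j ff] by (simp add: A.m_assoc beta_delta_comm)
    have ad: "?\<tau> j \<cdot> \<alpha> \<cdot> \<delta> = ?\<tau> j \<uplus> ls ?f (?\<tau> j \<cdot> \<gamma> \<cdot> \<beta>)" for j
      using homog_ls_rs(1)[OF T_homog, of "\<gamma> \<cdot> \<beta>" N k' j ff] by (simp add: A.m_assoc alpha_delta_det A.r_distr)
    have bg: "?\<tau> j \<cdot> \<beta> \<cdot> \<gamma> = ls ?f (?\<tau> j \<cdot> \<delta> \<cdot> \<alpha>) \<uplus> rs (- sh (int N - 2 * j) ff) (?\<tau> j)" for j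
      using homog_ls_rs(1)[OF T_homog, of "\<delta> \<cdot> \<alpha>" N k' j ff] homog_ls_rs(2)[OF T_homog, of oneA N k' j "- ff"]
      by (simp add: A.m_assoc beta_gamma_det A.r_distr sh_hom)
    let ?n = "num (int N + 1 - i)" and ?w = "ws (int N + 1) i" and ?psi = "psi (int N)"
    define X where "X = rs ?n ((?\<tau> (i - 1) \<cdot> \<gamma> \<uplus> rs (?psi i) (?\<tau> i \<cdot> \<delta>)) \<cdot> \<alpha>)"
    define Z where "Z = rs ?w ((?\<tau> i \<cdot> \<gamma> \<uplus> rs (?psi (i + 1)) (?\<tau> (i + 1) \<cdot> \<delta>)) \<cdot> \<beta>)"
    have [simp]: "X \<in> carrier A" "Z \<in> carrier A" by (simp_all add: X_def Z_def)
    have XZ: "X = Z \<uplus> rs (p powi (- i) * num (int N + 1)) (?\<tau> i) \<uplus> rs (p powi (- i)) (ls (p * xi (int N) (int k')) (?\<tau> i))"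
      unfolding X_def Z_def tail[symmetric]
      by (subst raising_step[where \<rho> = \<rho> and a = \<alpha> and a' = \<gamma> and b = \<beta> and b' = \<delta> and \<theta> = oneA, OF T_homog _ refl refl refl refl])
         (use Suc.IH[OF k'] in \<open>simp_all add: delta_alpha_det \<rho>_def\<close>)
    have "rs (num (int (Suc N) - i)) (T (Suc N) (Suc k') i \<cdot> \<gamma>) = ls ?f X \<uplus> rs (- (?n * ?psi i * sh (int N - 2 * i) ff)) (?\<tau> i)"
      unfolding T1 N1 by (simp add: A.l_distr ag bg X_def A.a_ac mult_ac)
    also have "\<dots> = ls ?f Z \<uplus> (ls ?f (rs (p powi (- i) * num (int N + 1)) (?\<tau> i) \<uplus> rs (p powi (- i)) (ls (p * xi (int N) (int k')) (?\<tau> i)))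
        \<uplus> rs (- (?n * ?psi i * sh (int N - 2 * i) ff)) (?\<tau> i))"
      unfolding XZ by (simp add: A.a_ac)
    \<comment> \<open>The \<open>ws\<close> part is exactly what restores the 1 of \<alpha>\<delta>
      on the right side; the rest goes into \<open>xi\<close>.\<close>
    also have "- (?n * ?psi i * sh (int N - 2 * i) ff) = ?w + - (p powi (- i) * (inverse p * num (int N + 2)))"
      using ws_psi_ff[of "int N" i] by (simp add: power_int_diff algebra_simps divide_inverse)
    also have "ls ?f Z \<uplus> (ls ?f (rs (p powi (- i) * num (int N + 1)) (?\<tau> i) \<uplus> rs (p powi (- i)) (ls (p * xi (int N) (int k')) (?\<tau> i)))
        \<uplus> rs (?w + - (p powi (- i) * (inverse p * num (int N + 2)))) (?\<tau> i)) =
        (ls ?f Z \<uplus> rs ?w (?\<tau> i)) \<uplus>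
        rs (p powi (- i)) (ls (?f * (p * xi (int N) (int k') + num (int N + 1))) (?\<tau> i) \<uplus> rs (- (inverse p * num (int N + 2))) (?\<tau> i))"
      using collect_terms[of Z "?\<tau> i" ?f "p powi (- i)" "int N + 1" "p * xi (int N) (int k')" ?w "- (inverse p * num (int N + 2))"]
      by (simp only: mult_minus_right) simp
    also have "rs (- (inverse p * num (int N + 2))) (?\<tau> i) = ls (- (inverse p * num (int N + 2))) (?\<tau> i)"
    proof -
      have "L (- (inverse p * num (int N + 2))) = R (- (inverse p * num (int N + 2)))"
        using L_hom(2)[of "const_mero (-1)" "inverse p * num (int N + 2)"] R_hom(2)[of "const_mero (-1)" "inverse p * num (int N + 2)"]
          L_p[of "-1"] L_num[of "int N + 2"] L_hom(4)[of "-1"] R_hom(4)[of "-1"]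
        by (simp add: L_hom(2,4) R_hom(2,4) const_mero_uminus power_int_minus)
      thus ?thesis by (simp add: ls_def rs_def)
    qed
    also have "ls (?f * (p * xi (int N) (int k') + num (int N + 1))) (?\<tau> i) \<uplus> ls (- (inverse p * num (int N + 2))) (?\<tau> i) =
        ls (xi (int N + 1) (int k' + 1)) (?\<tau> i)"
      unfolding xi_rec by (simp flip: ls_add)
    also have "ls ?f Z \<uplus> rs ?w (?\<tau> i) = rs ?w (T (Suc N) (Suc k') (i + 1) \<cdot> \<delta>)"
      unfolding T1 Z_def by (simp add: A.l_distr ad bd A.a_ac mult_ac)
    finally show ?thesis unfolding Suc N1 by (simp add: add_ac)
  qed
qed

text \<open>For row 0 the remainder comes from the 1 in \<delta>\<alpha>, using the previous rule.
  In higher rows \<beta>\<alpha> is proportional to \<alpha>\<beta>, so row k' itself contributes no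
  new term. At k = N the factor \<open>num 0\<close> removes the nonexistent row of level N -
  1.\<close>

lemma contraction_alpha_beta:
  assumes "k \<le> N"
  shows "rs (num (int N - i)) (T N k i \<cdot> \<alpha>) =
         rs (ws (int N) i) (T N k (i + 1) \<cdot> \<beta>) \<uplus> rs (p powi (int k - i) * num (int N - int k)) (T (N - 1) k i)"
  using assms
proof (induction N arbitrary: k i)
  case 0
  have "ws 0 i = 0 \<or> i \<noteq> -1" by (cases "i = -1") (simp_all add: ws_def)
  moreover have "num (- i) = 0 \<or> i \<noteq> 0" by simp
  ultimately show ?case using 0 by (cases "i = 0"; cases "i = -1") (auto simp: T_outside)
next
  case (Suc N)
  have N1: "int (Suc N) = int N + 1" by simp
  show ?case
  proof (cases k)
    case 0
    have T0: "T (Suc N) 0 j = T N 0 (j - 1) \<cdot> \<gamma> \<uplus> rs (psi (int N) j) (T N 0 j \<cdot> \<delta>)" for j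
      using T_Suc_gamma_delta[of 0 N j] by (simp add: psi_def)
    have "xi n 0 = 0" for n by (simp add: xi_def)
    moreover have "rs (num (int N + 1 - i)) ((T N 0 (i - 1) \<cdot> \<gamma> \<uplus> rs (psi (int N) i) (T N 0 i \<cdot> \<delta>)) \<cdot> \<alpha>) =
      rs (ws (int N + 1) i) ((T N 0 i \<cdot> \<gamma> \<uplus> rs (psi (int N) (i + 1)) (T N 0 (i + 1) \<cdot> \<delta>)) \<cdot> \<beta>) \<uplus>
      rs (p powi (- i) * num (int N + 1)) (T N 0 i \<cdot> oneA) \<uplus> (zeroA \<cdot> \<alpha> \<uplus> rs (cc (int N) i) (zeroA \<cdot> \<beta>))"
      by (rule raising_step[where \<rho> = "\<lambda>_. zeroA" and a = \<alpha> and a' = \<gamma> and b = \<beta> and b' = \<delta>, OF T_homog A.zero_closed refl refl refl refl])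
         (use contraction_gamma_delta[of 0 N] in \<open>simp_all add: delta_alpha_det xi_def\<close>)
    ultimately show ?thesis unfolding 0 T0 N1 by simp
  next
    case (Suc k')
    hence k': "k' \<le> N" using Suc.prems by simp
    let ?\<tau> = "T N k'"
    define \<rho> where "\<rho> j = rs (p powi (int k' - j) * num (int N - int k')) (T (N - 1) k' j)" for j
    have [simp]: "\<rho> j \<in> carrier A" for j by (simp add: \<rho>_def)
    have T1: "T (Suc N) (Suc k') j = ?\<tau> (j - 1) \<cdot> \<alpha> \<uplus> rs (psi (int N) j) (?\<tau> j \<cdot> \<beta>)" for j
      using T_Suc_alpha_beta[OF k'] .
    have tail: "\<rho> (i - 1) \<cdot> \<alpha> \<uplus> rs (cc (int N) i) (\<rho> i \<cdot> \<beta>) =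
      rs (p powi (int k' + 1 - i) * num (int N - int k')) (T N (Suc k') i)"
    proof (cases "k' = N")
      case True
      thus ?thesis by (simp add: \<rho>_def)
    next
      case False
      with k' have "k' \<le> N - 1" "N > 0" by simp_all
      have e: "p powi (int k' + 1 - i) = p * p powi (int k' - i)" "p powi (int k' - (i - 1)) = p * p powi (int k' - i)"
        by (simp_all add: power_int_diff power_int_add)
      have "T N (Suc k') i = T (N - 1) k' (i - 1) \<cdot> \<alpha> \<uplus> rs (psi (int N - 1) i) (T (N - 1) k' i \<cdot> \<beta>)"
        using T_Suc_alpha_beta[OF \<open>k' \<le> N - 1\<close>, of i] \<open>N > 0\<close> by (simp add: of_nat_diff)
      thus ?thesis unfolding \<rho>_def cc_psi e by (simp add: mult_ac)
    qed
    have "rs (num (int N + 1 - i)) ((?\<tau> (i - 1) \<cdot> \<alpha> \<uplus> rs (psi (int N) i) (?\<tau> i \<cdot> \<beta>)) \<cdot> \<alpha>) =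
       rs (ws (int N + 1) i) ((?\<tau> i \<cdot> \<alpha> \<uplus> rs (psi (int N) (i + 1)) (?\<tau> (i + 1) \<cdot> \<beta>)) \<cdot> \<beta>) \<uplus>
       rs (p powi (- i) * num (int N + 1)) (?\<tau> i \<cdot> zeroA) \<uplus> (\<rho> (i - 1) \<cdot> \<alpha> \<uplus> rs (cc (int N) i) (\<rho> i \<cdot> \<beta>))"
      by (rule raising_step[where \<rho> = \<rho> and a = \<alpha> and a' = \<alpha> and b = \<beta> and b' = \<beta>, OF T_homog _ refl refl refl refl])
         (use Suc.IH[OF k'] in \<open>simp_all add: beta_alpha_comm \<rho>_def\<close>)
    thus ?thesis unfolding Suc T1 N1 tail by (simp add: add_ac)
  qed
qed

definition uu :: "nat \<Rightarrow> int \<Rightarrow> mero" where "uu N i = p powi i / num (int N + 1)"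

text \<open>Raising and contraction pair \<alpha> in column i with \<beta> in column i + 1, so the
  rule for \<beta> is read at i - 1; likewise for \<gamma> and \<delta>.\<close>

lemma T_alpha:
  assumes "k \<le> N"
  shows "T N k i \<cdot> \<alpha> = rs (uu N (i + 1) * ws (int N) i) (T (Suc N) (Suc k) (i + 1)) \<uplus>
     rs (uu N (i + 1) * psi (int N) (i + 1) * (p powi (int k - i) * num (int N - int k))) (T (N - 1) k i)"
  using decompose_product(2)[OF _ _ _ _ _ contraction_alpha_beta[OF assms, of i], of "T (Suc N) (Suc k) (i + 1)"]
    T_Suc_alpha_beta[OF assms, of "i + 1"]
  by (simp add: uu_def)

lemma T_beta:
  assumes "k \<le> N"
  shows "T N k i \<cdot> \<beta> = rs (uu N i * num (int N + 1 - i)) (T (Suc N) (Suc k) i) \<uplus>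
     rs (- uu N i * (p powi (int k + 1 - i) * num (int N - int k))) (T (N - 1) k (i - 1))"
  using decompose_product(1)[OF _ _ _ _ _ contraction_alpha_beta[OF assms, of "i - 1"], of "T (Suc N) (Suc k) i"]
    T_Suc_alpha_beta[OF assms, of i]
  by (simp add: uu_def algebra_simps)

lemma T_gamma:
  assumes "k \<le> N"
  shows "T N k i \<cdot> \<gamma> = rs (uu N (i + 1) * ws (int N) i) (ls (psi (int N) (int k)) (T (Suc N) k (i + 1))) \<uplus>
     rs (uu N (i + 1) * psi (int N) (i + 1) * p powi (- i)) (ls (xi (int N) (int k)) (T (N - 1) (k - 1) i))"
  using decompose_product(2)[OF _ _ _ _ _ contraction_gamma_delta[OF assms, of i], of "ls (psi (int N) (int k)) (T (Suc N) k (i + 1))"]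
    T_Suc_gamma_delta[OF assms, of "i + 1"]
  by (simp add: uu_def)

lemma T_delta:
  assumes "k \<le> N"
  shows "T N k i \<cdot> \<delta> = rs (uu N i * num (int N + 1 - i)) (ls (psi (int N) (int k)) (T (Suc N) k i)) \<uplus>
     rs (- uu N i * p powi (1 - i)) (ls (xi (int N) (int k)) (T (N - 1) (k - 1) (i - 1)))"
  using decompose_product(1)[OF _ _ _ _ _ contraction_gamma_delta[OF assms, of "i - 1"], of "ls (psi (int N) (int k)) (T (Suc N) k i)"]
    T_Suc_gamma_delta[OF assms, of i]
  by (simp add: uu_def algebra_simps)

end

section \<open>The norms\<close>

context quantum_parameter
begin

text \<open>This is (q^2; q^2)_n.\<close>

definition nfact :: "nat \<Rightarrow> mero" where "nfact n = (\<Prod>i<n. num (int i + 1))"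

lemma nfact_Suc: "nfact (Suc n) = num (int n + 1) * nfact n"
  by (simp add: nfact_def mult.commute)

lemma nfact_0 [simp]: "nfact 0 = 1"
  by (simp add: nfact_def)

lemma nfact_nz [simp]: "nfact n \<noteq> 0"
  by (simp add: nfact_def)

text \<open>Setting \<open>bi\<close> to zero at negative arguments makes both recursions hold for all integers.\<close>

definition bi :: "int \<Rightarrow> int \<Rightarrow> mero" where
  "bi n m = (if n \<ge> 0 \<and> m \<ge> 0 then
     p powi (- 2 * n * m) * (\<Prod>r<nat n. br (int r + 2) / br (int r + 1 - m)) / (nfact (nat m) * nfact (nat n)) else 0)"

text \<open>The \<lambda>-part of the asserted norm, and next to it the \<mu>-part. The constants
  are distributed so that each part satisfies a recursion of its own.\<close>

definition norm_l :: "nat \<Rightarrow> nat \<Rightarrow> mero" where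
  "norm_l N j = nfact j * nfact (N - j) * p powi (2 * int j * (int N + 1 - int j)) *
     (\<Prod>s<j. br (- int s) / br (int N + 1 - int j - int s))"

definition norm_r :: "nat \<Rightarrow> int \<Rightarrow> mero" where
  "norm_r N k = num 1 / num (int N + 1) * bi (int N - k) k"

text \<open>Lowering m by one shifts the denominators, and the product telescopes to a single
  quotient. At m = -1 the factor \<open>num 0\<close> accounts for the zero on the left.\<close>

lemma bi_right: "bi n m = p powi (2 * n) * num (m + 1) * br (- m) / br (n - m) * bi n (m + 1)"
proof -
  consider "n < 0" | "m < -1" | "m = -1" | "n \<ge> 0" "m \<ge> 0" by linarith
  thus ?thesis
  proof cases
    case 4
    define n' m' where "n' = nat n" and "m' = nat m"
    have n': "n = int n'" "m = int m'" using 4 by (simp_all add: n'_def m'_def)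
    have shift: "(\<Prod>r<n'. br (int r + 1 - int m')) * br (- int m') = (\<Prod>r<n'. br (int r - int m')) * br (int n' - int m')"
    proof (induction n')
      case (Suc n')
      have "(\<Prod>r<Suc n'. br (int r + 1 - int m')) * br (- int m') =
            ((\<Prod>r<n'. br (int r + 1 - int m')) * br (- int m')) * br (int n' + 1 - int m')"
        by simp
      thus ?case unfolding Suc by (simp add: add.commute)
    qed simp
    have "(\<Prod>r<n'. br (int r + 2) / br (int r + 1 - int m')) =
       br (- int m') / br (int n' - int m') * (\<Prod>r<n'. br (int r + 2) / br (int r - int m'))"
      using shift by (simp add: prod_dividef field_simps)
    moreover have "p powi (- 2 * n * m) = p powi (2 * n) * p powi (- 2 * n * (m + 1))"
      by (subst p_powi_add[symmetric], rule arg_cong[where f = "(powi) p"]) (simp add: algebra_simps)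
    moreover have "nat (m + 1) = Suc m'" "nat m = m'" "nat n = n'" using n' by simp_all
    ultimately show ?thesis
      using 4 unfolding bi_def by (simp add: n' nfact_Suc field_simps)
  qed (auto simp: bi_def)
qed

lemma bi_left: "bi n m = p powi (2 * m) * num (n + 1) * br (n + 1 - m) / br (n + 2) * bi (n + 1) m"
proof -
  consider "n < -1" | "m < 0" | "n = -1" | "n \<ge> 0" "m \<ge> 0" by linarith
  thus ?thesis
  proof cases
    case 4
    define n' where "n' = nat n"
    have n': "n = int n'" "nat (n + 1) = Suc n'" "nat n = n'" using 4 by (simp_all add: n'_def)
    have "p powi (- 2 * n * m) = p powi (2 * m) * p powi (- 2 * (n + 1) * m)"
      by (subst p_powi_add[symmetric], rule arg_cong[where f = "(powi) p"]) (simp add: algebra_simps)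
    thus ?thesis
      using 4 n' unfolding bi_def by (simp add: nfact_Suc field_simps)
  qed (auto simp: bi_def)
qed

text \<open>Both neighbours are multiples of one \<open>bi\<close> value; after division the claim
  is \<open>key_identity\<close> at (m - 1, n).\<close>

lemma norm_r_Suc:
  "num (int N + 2) * norm_r (Suc N) m =
     norm_r N (m - 1) + p * psi (int N) m * psi (int N + 1) (m + 1) * norm_r N m"
proof -
  define n where "n = int N + 1 - m"
  have 1: "bi n (m - 1) = p powi (2 * n) * num m * br (1 - m) / br (n + 1 - m) * bi n m"
    using bi_right[of n "m - 1"] by (simp add: algebra_simps)
  have 2: "bi (n - 1) m = p powi (2 * m) * num n * br (n - m) / br (n + 1) * bi n m"
    using bi_left[of "n - 1" m] by (simp add: algebra_simps)
  have "p * p powi (- m) * p powi (- (m + 1)) * p powi (2 * m) = p powi 1 * p powi (- m) * p powi (- (m + 1)) * p powi (2 * m)"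
    by simp
  also have "\<dots> = 1" unfolding p_powi_add[symmetric] by simp
  finally have e: "p * p powi (- m) * p powi (- (m + 1)) * p powi (2 * m) = 1" .
  have a: "int N - m + 2 = n + 1" "int N - 2 * m + 2 = n + 1 - m" "int N + 1 - (m + 1) + 2 = n + 1"
    "int N + 1 - 2 * (m + 1) + 2 = n - m + 0" "int N - (m - 1) = n" "int N - m = n - 1" "int (Suc N) - m = n"
    by (simp_all add: n_def)
  have "p * psi (int N) m * psi (int N + 1) (m + 1) * bi (n - 1) m =
     (p * p powi (- m) * p powi (- (m + 1)) * p powi (2 * m)) * (num n * br (n + 1) / br (n + 1 - m)) * bi n m"
    unfolding psi_def a 2 by (simp add: divide_inverse mult_ac add.commute[of 1 n]) (simp add: field_simps)
  hence 3: "p * psi (int N) m * psi (int N + 1) (m + 1) * bi (n - 1) m = num n * br (n + 1) / br (n + 1 - m) * bi n m"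
    unfolding e by simp
  have "num (int N + 1) * br (n + 1 - m) = p powi (2 * n) * num m * br (1 - m) + num n * br (n + 1)"
    using key_identity[of n "m - 1"] by (simp add: n_def algebra_simps)
  hence 4: "num (int N + 1) = (p powi (2 * n) * num m * br (1 - m) + num n * br (n + 1)) / br (n + 1 - m)"
    by (simp add: field_simps)
  have "bi n (m - 1) + p * psi (int N) m * psi (int N + 1) (m + 1) * bi (n - 1) m = num (int N + 1) * bi n m"
    unfolding 3 4 1 by (simp add: add_divide_distrib algebra_simps)
  moreover have "norm_r N (m - 1) + p * psi (int N) m * psi (int N + 1) (m + 1) * norm_r N m =
     num 1 / num (int N + 1) * (bi n (m - 1) + p * psi (int N) m * psi (int N + 1) (m + 1) * bi (n - 1) m)"
    unfolding norm_r_def a by (simp add: algebra_simps)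
  moreover have "num (int N + 2) * norm_r (Suc N) m = num 1 * bi n m"
    unfolding norm_r_def a by (simp add: add.commute)
  ultimately show ?thesis by simp
qed

text \<open>Relates neighbouring columns of one level. This is what makes the contributions of level
  M + 1 cancel in the orthogonality induction.\<close>

lemma norm_r_adjacent:
  "num (int N - i) * norm_r N i = p\<^sup>2 * psi (int N) (i + 1) * ws (int N - 1) i * norm_r N (i + 1)"
proof -
  define n where "n = int N - i"
  have 1: "bi n i = p powi (2 * n) * num (i + 1) * br (- i) / br (n - i) * bi n (i + 1)"
    by (rule bi_right)
  have 2: "bi (n - 1) (i + 1) = p powi (2 * (i + 1)) * num n * br (n - i - 1) / br (n + 1) * bi n (i + 1)"
    using bi_left[of "n - 1" "i + 1"] by (simp add: algebra_simps)
  have e: "p\<^sup>2 * p powi (- (i + 1)) * p powi (2 * (int N - 1) - 3 * i - 1) * p powi (2 * (i + 1)) = p powi (2 * n)"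
  proof -
    have "p\<^sup>2 = p powi 2" by simp
    thus ?thesis by (simp only: p_powi_add[symmetric]) (simp add: n_def)
  qed
  have a: "int N - (i + 1) + 2 = n + 1" "int N - 2 * (i + 1) + 2 = n - i" "int N - 1 - 2 * i = n - i - 1"
    "int N - (i + 1) = n - 1" "int N - i = n"
    by (simp_all add: n_def)
  have "p\<^sup>2 * psi (int N) (i + 1) * ws (int N - 1) i * bi (n - 1) (i + 1) =
     (p\<^sup>2 * p powi (- (i + 1)) * p powi (2 * (int N - 1) - 3 * i - 1) * p powi (2 * (i + 1))) *
     (num n * num (i + 1) * br (- i) / br (n - i)) * bi n (i + 1)"
    unfolding psi_def ws_def a 2 by (simp add: divide_inverse mult_ac add.commute[of 1 n])
  also have "\<dots> = num n * bi n i" unfolding e 1 by simp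
  finally show ?thesis unfolding norm_r_def a by (simp add: mult_ac)
qed

lemma norm_l_Suc_Suc: "l \<le> N \<Longrightarrow> norm_l (Suc N) (Suc l) = - p * xi (int N + 1) (int l + 1) * norm_l N l"
proof -
  assume l: "l \<le> N"
  have e: "p powi (2 * int (Suc l) * (int (Suc N) + 1 - int (Suc l))) = p powi (2 * int l * (int N + 1 - int l)) * p powi (2 * (int N + 1 - int l))"
    by (subst p_powi_add[symmetric], rule arg_cong[where f = "(powi) p"]) (simp add: algebra_simps)
  have e': "p * p powi (2 * (int N + 1) + 1 - 2 * (int l + 1)) = p powi (2 * (int N + 1 - int l))"
  proof -
    have 1: "p * x = p powi 1 * x" for x by simp
    show ?thesis unfolding 1 p_powi_add[symmetric] by (rule arg_cong[where f = "(powi) p"]) simp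
  qed
  have a: "int (Suc N) + 1 - int (Suc l) = int N + 1 - int l" "1 - (int l + 1) = - int l" "int N + 1 + 2 - 2 * (int l + 1) = int N + 1 - int l - int l"
    by simp_all
  have "norm_l (Suc N) (Suc l) = p powi (2 * (int N + 1 - int l)) * num (int l + 1) * br (- int l) / br (int N + 1 - int l - int l) * norm_l N l"
    unfolding norm_l_def e unfolding a prod.lessThan_Suc nfact_Suc diff_Suc_Suc by (simp add: divide_inverse mult_ac)
  also have "p powi (2 * (int N + 1 - int l)) * num (int l + 1) * br (- int l) / br (int N + 1 - int l - int l) = - p * xi (int N + 1) (int l + 1)"
    unfolding xi_def a e'[symmetric] by simp
  finally show ?thesis by simp
qed

lemma norm_l_Suc_0: "norm_l (Suc N) 0 = num (int N + 1) * norm_l N 0"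
  by (simp add: norm_l_def nfact_Suc)

lemma norm_r_outside: "\<not> (0 \<le> k \<and> k \<le> int N) \<Longrightarrow> norm_r N k = 0"
  by (auto simp: norm_r_def bi_def)

lemma norm_0: "norm_l 0 0 = 1" "norm_r 0 0 = 1"
  by (simp_all add: norm_l_def norm_r_def bi_def)

section \<open>Translation of the norms into q-shifted factorials\<close>

lemma qpoch_meromorphic: "(\<lambda>x. qpoch (qexp q (- 2 * (x + of_int a))) (qexp q 2) n) meromorphic_on UNIV"
proof -
  have "(\<lambda>x. qexp q (- 2 * (x + of_int a))) meromorphic_on UNIV"
    using qexp_meromorphic[of "-2" "- 2 * of_int a"] by (simp add: algebra_simps)
  thus ?thesis unfolding qpoch_def by (intro meromorphic_intros) auto
qed

text \<open>Negative exponents are removed factor by factor: 1 - 1/z = (z - 1)/z with z =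
  q^(2(x+a-s)).\<close>

lemma to_mero_qpoch:
  "to_mero (\<lambda>x. qpoch (qexp q (- 2 * (x + of_int a))) (qexp q 2) n) =
     (\<Prod>s<n. p powi (2 * int s - 2 * a) / Y * br (a - int s))"
proof (induction n)
  case 0
  show ?case by (simp add: qpoch_def)
next
  case (Suc n)
  have m: "(\<lambda>x. qexp q (- 2 * (x + of_int a)) * c) meromorphic_on UNIV" for c
    using qexp_meromorphic[of "-2" "- 2 * of_int a"] by (auto intro!: meromorphic_intros simp: algebra_simps)
  have m': "(\<lambda>x. qexp q (2 * (x + of_int a))) meromorphic_on UNIV"
    using qexp_meromorphic[of "2" "2 * of_int a"] by (simp add: algebra_simps)
  have "qexp q (- 2 * (x + of_int a)) = 1 / qexp q (2 * (x + of_int a))" for x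
  proof -
    have "- 2 * (x + of_int a) * of_real (ln q) = - (2 * (x + of_int a) * of_real (ln q))"
      by (simp add: algebra_simps)
    thus ?thesis by (simp only: qexp_def exp_minus) (simp add: divide_inverse)
  qed
  hence "to_mero (\<lambda>x. qexp q (- 2 * (x + of_int a)) * qexp q 2 ^ n) =
     to_mero (\<lambda>x. 1 / qexp q (2 * (x + of_int a)) * qexp q 2 ^ n)" by simp
  also have "\<dots> = 1 / (p powi (2 * a) * Y) * const_mero (qexp q 2 ^ n)"
    using m' by (subst to_mero_hom) (auto intro!: meromorphic_intros simp only: to_mero_hom to_mero_qexp to_mero_const const_mero_1 meromorphic_on_const)
  also have "const_mero (qexp q 2 ^ n) = p powi (2 * int n)"
  proof -
    have "qexp q 2 = of_real q ^ 2" using qexp_of_int[of 2] by simp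
    hence "qexp q 2 ^ n = of_real (q powi (2 * int n))"
      by (simp add: power_mult[symmetric] power_int_def nat_mult_distrib)
    thus ?thesis by (simp only: p_power_int_const)
  qed
  finally have 1: "to_mero (\<lambda>x. qexp q (- 2 * (x + of_int a)) * qexp q 2 ^ n) = p powi (2 * int n - 2 * a) / Y"
    by (simp add: power_int_diff)
  have "to_mero (\<lambda>x. qpoch (qexp q (- 2 * (x + of_int a))) (qexp q 2) (Suc n)) =
     to_mero (\<lambda>x. qpoch (qexp q (- 2 * (x + of_int a))) (qexp q 2) n) *
     to_mero (\<lambda>x. 1 - qexp q (- 2 * (x + of_int a)) * qexp q 2 ^ n)"
    using to_mero_hom(3)[OF qpoch_meromorphic[of a n] meromorphic_on_diff[OF meromorphic_on_const m], of 1 "qexp q 2 ^ n"]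
    by (simp add: qpoch_def)
  also have "to_mero (\<lambda>x. 1 - qexp q (- 2 * (x + of_int a)) * qexp q 2 ^ n) = 1 - p powi (2 * int n - 2 * a) / Y"
    using to_mero_hom(2)[OF meromorphic_on_const m, of 1 "qexp q 2 ^ n"] 1 by simp
  also have "1 - p powi (2 * int n - 2 * a) / Y = p powi (2 * int n - 2 * a) / Y * br (a - int n)"
  proof -
    have "p powi (2 * int n - 2 * a) * p powi (2 * (a - int n)) = 1"
      by (simp add: right_diff_distrib flip: p_powi_add)
    thus ?thesis by (simp add: br_def field_simps)
  qed
  finally show ?case by (simp only: Suc prod.lessThan_Suc)
qed

lemma prod_p_powi: "(\<Prod>s<n. p powi (2 * int s - a) / Y) = p powi (- a * int n) * (\<Prod>s<n. p powi (2 * int s) / Y)"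
proof (induction n)
  case (Suc n)
  have "p powi (- a * int n) * p powi (2 * int n - a) = p powi (- a * int (Suc n)) * p powi (2 * int n)"
    unfolding p_powi_add[symmetric] by (rule arg_cong[where f = "(powi) p"]) (simp add: algebra_simps)
  thus ?case using Suc by (simp add: divide_inverse mult_ac)
qed simp

text \<open>Numerator and denominator have equally many factors, so all powers of \<open>Y\<close>
  cancel and only a constant power of q survives.\<close>

lemma to_mero_qpoch_ratio:
  "to_mero (\<lambda>x. qpoch (qexp q (- 2 * (x + of_int a))) (qexp q 2) n / qpoch (qexp q (- 2 * (x + of_int b))) (qexp q 2) n) =
     p powi (2 * (b - a) * int n) * (\<Prod>s<n. br (a - int s) / br (b - int s))"
proof -
  define K where "K = (\<Prod>s<n. p powi (2 * int s) / Y)"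
  have "K \<noteq> 0" by (simp add: K_def)
  have "to_mero (\<lambda>x. qpoch (qexp q (- 2 * (x + of_int a))) (qexp q 2) n / qpoch (qexp q (- 2 * (x + of_int b))) (qexp q 2) n) =
    (p powi (- (2 * a) * int n) * K * (\<Prod>s<n. br (a - int s))) / (p powi (- (2 * b) * int n) * K * (\<Prod>s<n. br (b - int s)))"
    unfolding to_mero_hom(4)[OF qpoch_meromorphic qpoch_meromorphic] to_mero_qpoch prod.distrib prod_p_powi K_def ..
  also have "p powi (- (2 * a) * int n) = p powi (2 * (b - a) * int n) * p powi (- (2 * b) * int n)"
    unfolding p_powi_add[symmetric] by (rule arg_cong[where f = "(powi) p"]) (simp add: algebra_simps)
  finally show ?thesis using \<open>K \<noteq> 0\<close> by (simp add: prod_dividef)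
qed

lemma const_mero_qpoch: "const_mero (qpoch (qexp q 2) (qexp q 2) n) = nfact n"
proof (induction n)
  case (Suc n)
  have "qexp q 2 = of_real q ^ 2" using qexp_of_int[of 2] by simp
  hence "qexp q 2 * qexp q 2 ^ n = of_real (q ^ (2 * Suc n))"
    by (simp only: power_Suc[symmetric] power_mult of_real_power)
  also have "q ^ (2 * Suc n) = q powi int (2 * Suc n)" by (simp only: power_int_of_nat)
  also have "int (2 * Suc n) = 2 * (int n + 1)" by simp
  finally have "qexp q 2 * qexp q 2 ^ n = of_real (q powi (2 * (int n + 1)))" .
  hence "const_mero (1 - qexp q 2 * qexp q 2 ^ n) = num (int n + 1)"
    by (simp only: const_mero_hom p_power_int_const num_def const_mero_1)
  thus ?case using Suc by (simp add: qpoch_def nfact_Suc const_mero_hom mult.commute)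
qed (simp add: qpoch_def)

lemma norm_l_to_mero:
  assumes "j \<le> N"
  shows "norm_l N j = nfact j * nfact (N - j) *
    to_mero (\<lambda>x. qpoch (qexp q (- 2 * x)) (qexp q 2) j / qpoch (qexp q (- 2 * (x + of_nat N + 1 - of_nat j))) (qexp q 2) j)"
  using to_mero_qpoch_ratio[of 0 j "int N + 1 - int j"]
  by (simp add: norm_l_def add_diff_eq add.assoc mult_ac)

lemma norm_r_to_mero:
  assumes "k \<le> N"
  shows "norm_r N (int k) = p powi (2 * (int N - int k)) * num 1 / num (int N + 1) / (nfact k * nfact (N - k)) *
    to_mero (\<lambda>y. qpoch (qexp q (- 2 * (y + 1 + of_nat N - of_nat k))) (qexp q 2) (N - k) /
                 qpoch (qexp q (- 2 * (y + of_nat N - 2 * of_nat k))) (qexp q 2) (N - k))"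
proof -
  define n where "n = N - k"
  have n: "int N - int k = int n" "nat (int N - int k) = n" "complex_of_nat N = of_nat n + of_nat k"
    using assms by (simp_all add: n_def of_nat_diff)
  \<comment> \<open>The product in \<open>bi\<close> runs upwards, the q-shifted factorial
    downwards; the match is r = n - 1 - s.\<close>
  have rev: "(\<Prod>s<n. f (n - Suc s)) = (\<Prod>r<n. f r)" for f :: "nat \<Rightarrow> mero"
    by (rule prod.nat_diff_reindex)
  have "(\<Prod>s<n. br (int n + 1 - int s) / br (int n - int k - int s)) =
        (\<Prod>s<n. br (int (n - Suc s) + 2) / br (int (n - Suc s) + 1 - int k))"
    by (intro prod.cong refl arg_cong2[where f = "(/)"] arg_cong[where f = br]) (auto simp: of_nat_diff)
  also have "\<dots> = (\<Prod>r<n. br (int r + 2) / br (int r + 1 - int k))"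
    by (rule rev[of "\<lambda>r. br (int r + 2) / br (int r + 1 - int k)"])
  finally have 1: "(\<Prod>s<n. br (int n + 1 - int s) / br (int n - int k - int s)) = (\<Prod>r<n. br (int r + 2) / br (int r + 1 - int k))" .
  have "to_mero (\<lambda>y. qpoch (qexp q (- 2 * (y + 1 + of_nat N - of_nat k))) (qexp q 2) n /
                 qpoch (qexp q (- 2 * (y + of_nat N - 2 * of_nat k))) (qexp q 2) n) =
     p powi (2 * (int n - int k - (int n + 1)) * int n) * (\<Prod>r<n. br (int r + 2) / br (int r + 1 - int k))"
    using to_mero_qpoch_ratio[of "int n + 1" n "int n - int k"] unfolding 1
    by (simp add: n(3) algebra_simps)
  moreover have "p powi (- 2 * int n * int k) = p powi (2 * int n) * p powi (2 * (int n - int k - (int n + 1)) * int n)"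
    unfolding p_powi_add[symmetric] by (rule arg_cong[where f = "(powi) p"]) (simp add: algebra_simps)
  ultimately show ?thesis
    unfolding norm_r_def bi_def n n_def[symmetric] by (simp add: divide_inverse mult_ac)
qed

end

section \<open>Orthogonality\<close>

context dynamical_matrix_elements
begin

inductive_set t_span :: "fr_free set set" where
  t_span_zero: "zeroA \<in> t_span"
| t_span_T: "ls f (rs g (T N k i)) \<in> t_span"
| t_span_add: "x \<in> t_span \<Longrightarrow> y \<in> t_span \<Longrightarrow> x \<uplus> y \<in> t_span"

lemma t_span_closed: "x \<in> t_span \<Longrightarrow> x \<in> carrier A"
  by (induction rule: t_span.induct) auto

lemma t_span_ls_rs: "x \<in> t_span \<Longrightarrow> ls f (rs g x) \<in> t_span"
proof (induction rule: t_span.induct)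
  case (t_span_T f' g' N k i)
  have "ls f (rs g (ls f' (rs g' (T N k i)))) = ls (f * f') (rs (g * g') (T N k i))" by simp
  thus ?case using t_span.t_span_T by metis
qed (auto simp: t_span_closed intro: t_span.intros)

lemma t_span_gen: "x \<in> t_span \<Longrightarrow> x \<cdot> gen_cls q g \<in> t_span"
proof (induction rule: t_span.induct)
  case (t_span_T f' g' N k i)
  have T: "rs c (T M l j) \<in> t_span" "rs c (ls d (T M l j)) \<in> t_span" for c d M l j
    using t_span.t_span_T[of 1 c M l j] t_span.t_span_T[of d c M l j] by simp_all
  have "T N k i \<cdot> gen_cls q g \<in> t_span"
  proof (cases "k \<le> N")
    case True
    show ?thesis
    proof (cases g)
      case (MuL f)
      thus ?thesis using homog_shift(1)[OF T_homog, of N k i f] t_span.t_span_T[of _ 1 N k i] by (simp add: ls_def[symmetric])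
    next
      case (MuR f)
      thus ?thesis using homog_shift(2)[OF T_homog, of N k i f] T(1) by (simp add: rs_def[symmetric])
    qed (use True in \<open>auto simp only: T_alpha T_beta T_gamma T_delta intro!: T t_span_add\<close>)
  qed (auto simp: T_outside t_span_zero)
  thus ?case using t_span_ls_rs by simp
qed (auto simp: t_span_closed A.l_distr intro: t_span.intros)

text \<open>A word is reached from 1 = \<open>T 0 0 0\<close> by multiplying with its letters on the
  right.\<close>

lemma t_span_UNIV: "x \<in> carrier A \<Longrightarrow> x \<in> t_span"
proof -
  have word: "y \<in> t_span \<Longrightarrow> y \<cdot> cls q (prod_list (map gen gs)) \<in> t_span" for y gs
  proof (induction gs arbitrary: y)
    case (Cons g gs)
    have "y \<cdot> cls q (prod_list (map gen (g # gs))) = (y \<cdot> gen_cls q g) \<cdot> cls q (prod_list (map gen gs))"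
      using t_span_closed[OF Cons.prems] by (simp add: cls_mult cls_gen A.m_assoc)
    thus ?case using Cons.IH[OF t_span_gen[OF Cons.prems]] by simp
  qed (use t_span_closed in \<open>auto simp: cls_simps\<close>)
  have one: "oneA \<in> t_span" using t_span.t_span_T[of 1 1 0 0 0] by (simp add: T_0_0_0)
  have single: "cls q (Poly_Mapping.single w c) \<in> t_span" for w c
  proof (cases w)
    case (Word gs)
    have "ls 1 (rs (const_mero c) (oneA \<cdot> cls q (prod_list (map gen gs)))) \<in> t_span"
      by (intro t_span_ls_rs word one)
    thus ?thesis by (simp add: Word single_Word cls_mult scal_cls_rs)
  qed
  assume "x \<in> carrier A"
  then obtain u where u: "x = cls q u" by (auto simp: FSL2_carrier)
  have "cls q (\<Sum>w\<in>K. Poly_Mapping.single w (Poly_Mapping.lookup u w)) \<in> t_span" for K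
    by (induction K rule: infinite_finite_induct)
       (auto simp: cls_simps(4) cls_simps(2)[symmetric] intro: t_span.intros single)
  thus ?thesis using free_sum_words[of u] by (metis u)
qed

end

section \<open>The Haar functional and the involution\<close>

locale dynamical_haar = dynamical_matrix_elements +
  fixes star h :: "fr_free set \<Rightarrow> fr_free set"
  assumes star: "is_star q star" and haar: "is_haar q t h"
begin

lemma h_closed [simp]: "x \<in> carrier A \<Longrightarrow> h x \<in> carrier A"
  using haar by (auto simp: is_haar_def lam_mu_span_def)

lemma h_add: "x \<in> carrier A \<Longrightarrow> y \<in> carrier A \<Longrightarrow> h (x \<uplus> y) = h x \<uplus> h y"
  using haar by (simp add: is_haar_def)

lemma h_zero [simp]: "h zeroA = zeroA"
  using h_add[of zeroA zeroA] h_closed[of zeroA] by simp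

lemma h_T:
  "h (ls f (rs g (T N k i))) = ls f (rs g (if N = 0 \<and> k = 0 \<and> i = 0 then oneA else zeroA))"
proof (cases "k \<le> N \<and> 0 \<le> i \<and> i \<le> int N")
  case True
  hence "nat i \<le> N" by auto
  hence "h (L f \<cdot> R g \<cdot> t N k (nat i)) = L f \<cdot> R g \<cdot> scal_cls q (of_bool (N = 0))"
    using haar True unfolding is_haar_def by blast
  moreover have "L f \<cdot> R g \<cdot> x = ls f (rs g x)" if "x \<in> carrier A" for x
    using that by (simp add: ls_def rs_def A.m_assoc)
  moreover have "t N k (nat i) = T N k i" using True by (simp add: T_def)
  ultimately show ?thesis using True by (auto simp: scal_hom cls_simps)
next
  case False
  thus ?thesis by (auto simp: T_def)
qed

lemma h_linear: "x \<in> carrier A \<Longrightarrow> h (ls f (rs g x)) = ls f (rs g (h x))"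
proof -
  assume "x \<in> carrier A"
  hence "x \<in> t_span" by (rule t_span_UNIV)
  thus ?thesis
  proof (induction rule: t_span.induct)
    case (t_span_T f' g' N k i)
    have "ls f (rs g (ls f' (rs g' (T N k i)))) = ls (f * f') (rs (g * g') (T N k i))" by simp
    thus ?case by (simp add: h_T)
  qed (auto simp: h_add t_span_closed)
qed

lemma h_ls_rs:
  assumes "x \<in> carrier A"
  shows "h (ls f x) = ls f (h x)" "h (rs g x) = rs g (h x)"
  using h_linear[OF assms, of f 1] h_linear[OF assms, of 1 g] assms by simp_all

lemma star_closed [simp]: "x \<in> carrier A \<Longrightarrow> star x \<in> carrier A"
  using star by (simp add: is_star_def)

lemma star_hom:
  assumes "x \<in> carrier A" "y \<in> carrier A"
  shows "star (x \<uplus> y) = star x \<uplus> star y" "star (x \<cdot> y) = star y \<cdot> star x"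
  using assms star by (simp_all add: is_star_def)

lemma star_L_R: "star (L f) = L (cnj_mero f)" "star (R f) = R (cnj_mero f)"
  using star by (simp_all add: is_star_def)

lemma star_gens: "star \<alpha> = \<delta>" "star \<beta> = rs (- p) \<gamma>" "star \<gamma> = rs (- inverse p) \<beta>" "star \<delta> = \<alpha>"
  using star unfolding is_star_def
  by (simp_all add: scal_cls_rs p_def const_mero_uminus const_mero_inverse)

lemma star_zero_one: "star zeroA = zeroA" "star oneA = oneA"
  using star_L_R(1)[of 0] star_L_R(1)[of 1] by (simp_all add: L_hom(3))

text \<open>The involution reverses products, so the coefficient is first moved behind x, which
  shifts it by b; \<open>psi\<close> itself is real.\<close>

lemma star_rs_psi:
  assumes "x \<in> homog q a b"
  shows   "star (rs (psi N m) x) = rs (sh b (psi N m)) (star x)"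
proof -
  have "rs (psi N m) x = x \<cdot> R (sh b (psi N m))"
    using homog_shift(2)[OF assms, of "sh b (psi N m)"] by (simp add: rs_def)
  moreover have "cnj_mero (sh b (psi N m)) = sh b (psi N m)"
    by (simp add: psi_def sh_hom cnj_mero_hom cnj_mero_power_int)
  ultimately show ?thesis
    using homogD[OF assms] by (simp add: star_hom star_L_R rs_def)
qed

lemma star_T_Suc:
  assumes "l \<le> N"
  shows "star (T (Suc N) (Suc l) m) = \<delta> \<cdot> star (T N l (m - 1)) \<uplus>
           rs (- p * sh (2 * m - int N - 1) (psi (int N) m)) (\<gamma> \<cdot> star (T N l m))"
proof -
  have "T N l m \<cdot> \<beta> \<in> homog q (2 * int l - int N + 1) (2 * m - int N - 1)"
    using homog_mult[OF T_homog[of N l m] gen_homog[of Beta]] by simp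
  from star_rs_psi[OF this] show ?thesis
    unfolding T_Suc_alpha_beta[OF assms] by (simp add: star_hom star_gens mult.commute)
qed

lemma star_T_0:
  "star (T (Suc N) 0 m) = rs (- inverse p) (\<beta> \<cdot> star (T N 0 (m - 1))) \<uplus>
     rs (sh (2 * m - int N - 1) (psi (int N) m)) (\<alpha> \<cdot> star (T N 0 m))"
proof -
  have hom: "T N 0 m \<cdot> \<delta> \<in> homog q (- int N - 1) (2 * m - int N - 1)"
    using homog_mult[OF T_homog[of N 0 m] gen_homog[of Delta]] by simp
  have "T (Suc N) 0 m = T N 0 (m - 1) \<cdot> \<gamma> \<uplus> rs (psi (int N) m) (T N 0 m \<cdot> \<delta>)"
    using T_Suc_gamma_delta[of 0 N m] by (simp add: psi_def)
  thus ?thesis using star_rs_psi[OF hom] by (simp add: star_hom star_gens)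
qed

lemma T_mult_rs: "y \<in> carrier A \<Longrightarrow> T M j k \<cdot> rs f y = rs (sh (int M - 2 * k) f) (T M j k \<cdot> y)"
  using homog_ls_rs(2)[OF T_homog, of y M j k f] by simp

section \<open>The pairing, its recursion, and orthogonality\<close>

definition pairing :: "nat \<Rightarrow> nat \<Rightarrow> int \<Rightarrow> nat \<Rightarrow> nat \<Rightarrow> int \<Rightarrow> fr_free set" where
  "pairing M j k N l m = h (T M j k \<cdot> star (T N l m))"

lemma pairing_closed [simp]: "pairing M j k N l m \<in> carrier A"
  by (simp add: pairing_def)

text \<open>The starred generators \<delta> and -q\<gamma> are absorbed into the first argument and
  expanded by the product rules. The compound shift of \<open>psi\<close> is zero in every case that
  survives.\<close>

lemma pairing_Suc_Suc:
  assumes "j \<le> M" "l \<le> N"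
  shows "pairing M j k (Suc N) (Suc l) m =
    (rs (uu M k * num (int M + 1 - k)) (ls (psi (int M) (int j)) (pairing (Suc M) j k N l (m - 1))) \<uplus>
     rs (- uu M k * p powi (1 - k)) (ls (xi (int M) (int j)) (pairing (M - 1) (j - 1) (k - 1) N l (m - 1)))) \<uplus>
    rs (- p * sh (2 * m - int N - 1 + int M - 2 * k) (psi (int N) m))
    (rs (uu M (k + 1) * ws (int M) k) (ls (psi (int M) (int j)) (pairing (Suc M) j (k + 1) N l m)) \<uplus>
     rs (uu M (k + 1) * psi (int M) (k + 1) * p powi (- k)) (ls (xi (int M) (int j)) (pairing (M - 1) (j - 1) k N l m)))"
proof -
  have sh: "sh (int M - 2 * k) (- p * sh (2 * m - int N - 1) (psi (int N) m)) =
      - p * sh (2 * m - int N - 1 + int M - 2 * k) (psi (int N) m)"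
    by (simp add: sh_hom algebra_simps)
  have "pairing M j k (Suc N) (Suc l) m = h ((T M j k \<cdot> \<delta>) \<cdot> star (T N l (m - 1)) \<uplus>
      rs (- p * sh (2 * m - int N - 1 + int M - 2 * k) (psi (int N) m)) ((T M j k \<cdot> \<gamma>) \<cdot> star (T N l m)))"
    unfolding pairing_def star_T_Suc[OF assms(2)] 
    by (simp only: A.r_distr T_closed star_closed cls_closed rs_closed A.m_closed T_mult_rs sh A.m_assoc)
  also have "\<dots> = h ((T M j k \<cdot> \<delta>) \<cdot> star (T N l (m - 1))) \<uplus>
      rs (- p * sh (2 * m - int N - 1 + int M - 2 * k) (psi (int N) m)) (h ((T M j k \<cdot> \<gamma>) \<cdot> star (T N l m)))"
    by (simp only: h_add h_ls_rs T_closed star_closed cls_closed rs_closed A.m_closed)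
  finally show ?thesis
    unfolding T_gamma[OF assms(1)] T_delta[OF assms(1)] pairing_def
    by (simp only: A.l_distr ls_rs_distrib h_add h_ls_rs T_closed star_closed cls_closed rs_closed ls_closed A.m_closed)
qed

lemma pairing_Suc_0:
  assumes "j \<le> M"
  shows "pairing M j k (Suc N) 0 m =
    rs (- inverse p) (rs (uu M k * num (int M + 1 - k)) (pairing (Suc M) (Suc j) k N 0 (m - 1)) \<uplus>
     rs (- uu M k * (p powi (int j + 1 - k) * num (int M - int j))) (pairing (M - 1) j (k - 1) N 0 (m - 1))) \<uplus>
    rs (sh (2 * m - int N - 1 + int M - 2 * k) (psi (int N) m))
    (rs (uu M (k + 1) * ws (int M) k) (pairing (Suc M) (Suc j) (k + 1) N 0 m) \<uplus>
     rs (uu M (k + 1) * psi (int M) (k + 1) * (p powi (int j - k) * num (int M - int j))) (pairing (M - 1) j k N 0 m))"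
proof -
  have sh: "sh (int M - 2 * k) (sh (2 * m - int N - 1) (psi (int N) m)) =
      sh (2 * m - int N - 1 + int M - 2 * k) (psi (int N) m)"
    "sh (int M - 2 * k) (- inverse p) = - inverse p"
    by (simp_all add: sh_hom algebra_simps)
  have "pairing M j k (Suc N) 0 m = h (rs (- inverse p) ((T M j k \<cdot> \<beta>) \<cdot> star (T N 0 (m - 1))) \<uplus>
      rs (sh (2 * m - int N - 1 + int M - 2 * k) (psi (int N) m)) ((T M j k \<cdot> \<alpha>) \<cdot> star (T N 0 m)))"
    unfolding pairing_def star_T_0
    by (simp only: A.r_distr T_closed star_closed cls_closed rs_closed A.m_closed T_mult_rs sh A.m_assoc)
  also have "\<dots> = rs (- inverse p) (h ((T M j k \<cdot> \<beta>) \<cdot> star (T N 0 (m - 1)))) \<uplus>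
      rs (sh (2 * m - int N - 1 + int M - 2 * k) (psi (int N) m)) (h ((T M j k \<cdot> \<alpha>) \<cdot> star (T N 0 m)))"
    by (simp only: h_add h_ls_rs T_closed star_closed cls_closed rs_closed A.m_closed)
  finally show ?thesis
    unfolding T_alpha[OF assms(1)] T_beta[OF assms(1)] pairing_def
    by (simp only: A.l_distr ls_rs_distrib h_add h_ls_rs T_closed star_closed cls_closed rs_closed ls_closed A.m_closed)
qed

lemma uu_p_powi:
  "uu M k * p powi (1 - k) = p / num (int M + 1)"
  "uu M (k + 1) * x * p powi (- k) = p / num (int M + 1) * x"
proof -
  have "p powi k * p powi (1 - k) = p" "p powi (k + 1) * p powi (- k) = p"
    by (simp_all flip: p_powi_add)
  thus "uu M k * p powi (1 - k) = p / num (int M + 1)" "uu M (k + 1) * x * p powi (- k) = p / num (int M + 1) * x"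
    by (simp_all add: uu_def divide_inverse mult_ac)
qed

text \<open>The right coefficients that occur for M - 1 = N, collected into
  \<open>norm_r_Suc\<close>; the factor -q stems from the star of \<beta> and is absorbed by
  \<open>norm_l_Suc_Suc\<close>.\<close>

lemma norm_r_raise:
  "- uu (Suc N) m * p powi (1 - m) * norm_r N (m - 1) +
     - p * psi (int N) m * (uu (Suc N) (m + 1) * psi (int (Suc N)) (m + 1) * p powi (- m)) * norm_r N m = - p * norm_r (Suc N) m"
proof -
  have "norm_r (Suc N) m = (norm_r N (m - 1) + p * psi (int N) m * psi (int N + 1) (m + 1) * norm_r N m) / num (int N + 2)"
    using norm_r_Suc[of N m] by (simp add: field_simps)
  moreover have "int (Suc N) = int N + 1" "int (Suc N) + 1 = int N + 2" by simp_all
  ultimately show ?thesis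
    using uu_p_powi(1)[of "Suc N" m] uu_p_powi(2)[of "Suc N" m "psi (int (Suc N)) (m + 1)"]
    by (simp only: mult_minus_left) (simp add: algebra_simps add_divide_distrib)
qed

text \<open>The right coefficients that occur for M + 1 = N: the two levels differ by two, and the
  contributions cancel.\<close>

lemma norm_r_cancel:
  "uu M (m - 1) * num (int M + 1 - (m - 1)) * norm_r (Suc M) (m - 1) +
     - p * psi (int (Suc M)) m * (uu M m * ws (int M) (m - 1)) * norm_r (Suc M) m = 0"
proof -
  have "p * uu M (m - 1) = uu M m"
    using p_powi_add[of 1 "m - 1"] by (simp add: uu_def)
  moreover have "num (int M + 1 - (m - 1)) * norm_r (Suc M) (m - 1) = p\<^sup>2 * psi (int (Suc M)) m * ws (int M) (m - 1) * norm_r (Suc M) m"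
    using norm_r_adjacent[of "Suc M" "m - 1"] by (simp add: add.commute)
  hence "uu M (m - 1) * (num (int M + 1 - (m - 1)) * norm_r (Suc M) (m - 1)) =
     p * (p * uu M (m - 1)) * psi (int (Suc M)) m * ws (int M) (m - 1) * norm_r (Suc M) m"
    by (simp add: power2_eq_square mult_ac)
  ultimately show ?thesis by (simp add: mult_ac)
qed

lemma norm_r_raise_0:
  "- inverse p * (- uu (Suc N) m * (p powi (1 - m) * num (int N + 1))) * norm_r N (m - 1) +
     psi (int N) m * (uu (Suc N) (m + 1) * psi (int (Suc N)) (m + 1) * (p powi (- m) * num (int N + 1))) * norm_r N m =
     num (int N + 1) * norm_r (Suc N) m"
proof -
  have "norm_r (Suc N) m = inverse p * (p * norm_r (Suc N) m)" by simp
  also have "p * norm_r (Suc N) m = uu (Suc N) m * p powi (1 - m) * norm_r N (m - 1) +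
     p * psi (int N) m * (uu (Suc N) (m + 1) * psi (int (Suc N)) (m + 1) * p powi (- m)) * norm_r N m"
    using norm_r_raise[of N m] by (simp add: algebra_simps)
  finally show ?thesis by (simp only: distrib_left mult_ac) (simp add: mult_ac distrib_left)
qed

definition orth :: "nat \<Rightarrow> nat \<Rightarrow> int \<Rightarrow> nat \<Rightarrow> nat \<Rightarrow> int \<Rightarrow> fr_free set" where
  "orth M j k N l m = (if M = N \<and> j = l \<and> k = m then ls (norm_l N l) (rs (norm_r N m) oneA) else zeroA)"

theorem pairing_eq: "l \<le> N \<Longrightarrow> pairing M j k N l m = orth M j k N l m"
proof (induction N arbitrary: M j k l m)
  case 0
  have "pairing M j k 0 0 m = orth M j k 0 0 m"
  proof (cases "m = 0")
    case True
    thus ?thesis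
      using h_T[of 1 1 M j k] by (auto simp: pairing_def orth_def T_0_0_0 star_zero_one norm_0)
  next
    case False
    thus ?thesis by (auto simp: pairing_def orth_def T_outside star_zero_one norm_r_outside)
  qed
  thus ?case using 0 by simp
next
  case (Suc N)
  have zero: "j > M \<Longrightarrow> ?case"
    using Suc.prems by (auto simp: pairing_def orth_def T_outside)
  have xi0: "xi a 0 = 0" for a by (simp add: xi_def)
  show ?case
  proof (cases "j \<le> M")
    case j: True
    show ?thesis
    proof (cases l)
      case (Suc l')
      hence l': "l' \<le> N" using Suc.prems by simp
      note eq = pairing_Suc_Suc[OF j l', of k m, unfolded Suc.IH[OF l']]
      \<comment> \<open>Truncated subtraction could match M = 0 or j = 0 by accident;
        \<open>xi\<close> vanishes at j = 0, so the exact conditions may be used.\<close>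
      have down: "ls (xi (int M) (int j)) (orth (M - 1) (j - 1) k' N l' m') =
         ls (xi (int M) (int j)) (if M = Suc N \<and> j = Suc l' \<and> k' = m' then ls (norm_l N l') (rs (norm_r N m') oneA) else zeroA)" for k' m'
        using j by (cases j; cases M) (auto simp: orth_def xi0)
      consider "Suc M = N" "j = l'" "k = m - 1" | "M = Suc N" "j = Suc l'" "k = m"
        | "\<not> (Suc M = N \<and> j = l' \<and> k = m - 1)" "\<not> (M = Suc N \<and> j = Suc l' \<and> k = m)" by blast
      thus ?thesis
      proof cases
        case 1
        have s: "2 * m - int N - 1 + int M - 2 * k = 0" "k + 1 = m" using 1 by auto
        have "pairing M j k (Suc N) (Suc l') m = ls (psi (int M) (int j) * norm_l N l')
          (rs (uu M (m - 1) * num (int M + 1 - (m - 1)) * norm_r (Suc M) (m - 1) +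
            - p * psi (int (Suc M)) m * (uu M m * ws (int M) (m - 1)) * norm_r (Suc M) m) oneA)"
          unfolding eq down unfolding s using 1 by (simp add: orth_def rs_add rs_diff mult_ac)
        thus ?thesis using 1 unfolding norm_r_cancel by (simp add: Suc orth_def)
      next
        case 2
        have s: "2 * m - int N - 1 + int M - 2 * k = 0" using 2 by auto
        have "pairing M j k (Suc N) (Suc l') m = ls (xi (int N + 1) (int l' + 1) * norm_l N l')
          (rs (- uu (Suc N) m * p powi (1 - m) * norm_r N (m - 1) +
     - p * psi (int N) m * (uu (Suc N) (m + 1) * psi (int (Suc N)) (m + 1) * p powi (- m)) * norm_r N m) oneA)"
          unfolding eq down unfolding s using 2 by (simp add: orth_def rs_add rs_diff mult_ac add.commute)
        also have "\<dots> = rs (- p) (ls (xi (int N + 1) (int l' + 1) * norm_l N l') (rs (norm_r (Suc N) m) oneA))"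
          unfolding norm_r_raise by simp
        also have "\<dots> = ls (norm_l (Suc N) (Suc l')) (rs (norm_r (Suc N) m) oneA)"
          unfolding norm_l_Suc_Suc[OF l'] by (simp only: ls_uminus_p[symmetric] rs_closed A.one_closed mult.assoc)
        finally show ?thesis using 2 by (simp add: Suc orth_def)
      next
        case 3
        hence z: "orth (Suc M) j k N l' (m - 1) = zeroA" "orth (Suc M) j (k + 1) N l' m = zeroA"
          by (auto simp: orth_def)
        show ?thesis unfolding Suc eq down z using 3 by (auto simp: orth_def)
      qed
    next
      case 0
      note eq = pairing_Suc_0[OF j, of k N m, unfolded Suc.IH[OF le0]]
      \<comment> \<open>Here M = 0 forces j = 0, and \<open>num 0\<close> removes the accidental
        match M - 1 = N.\<close>
      have down: "rs (a * (b * num (int M - int j))) (orth (M - 1) j k' N 0 m') =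
         rs (a * (b * num (int M - int j))) (if M = Suc N \<and> j = 0 \<and> k' = m' then ls (norm_l N 0) (rs (norm_r N m') oneA) else zeroA)" for a b k' m'
        using j by (cases M) (auto simp: orth_def)
      have up: "orth (Suc M) (Suc j) k' N 0 m' = zeroA" for k' m' by (simp add: orth_def)
      show ?thesis
      proof (cases "M = Suc N \<and> j = 0 \<and> k = m")
        case True
        hence s: "2 * m - int N - 1 + int M - 2 * k = 0" by auto
        have "pairing M j k (Suc N) 0 m = ls (norm_l N 0)
          (rs (- inverse p * (- uu (Suc N) m * (p powi (1 - m) * num (int N + 1))) * norm_r N (m - 1) +
     psi (int N) m * (uu (Suc N) (m + 1) * psi (int (Suc N)) (m + 1) * (p powi (- m) * num (int N + 1))) * norm_r N m) oneA)"
          unfolding eq down up s using True by (simp add: rs_add mult_ac add.commute)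
        also have "\<dots> = rs (num (int N + 1)) (ls (norm_l N 0) (rs (norm_r (Suc N) m) oneA))"
          unfolding norm_r_raise_0 by simp
        also have "\<dots> = ls (norm_l (Suc N) 0) (rs (norm_r (Suc N) m) oneA)"
          unfolding norm_l_Suc_0 by (simp only: ls_num_mult rs_closed A.one_closed)
        finally show ?thesis using True by (simp add: 0 orth_def)
      next
        case False
        thus ?thesis unfolding 0 eq down up by (auto simp: orth_def)
      qed
    qed
  qed (use zero in simp)
qed

text \<open>The constants in the \<lambda>-part are carried to the \<mu>-side, where they merge with
  those of \<open>norm_r\<close> into one scalar.\<close>

lemma norm_product:
  assumes "j \<le> M" "k \<le> M"
  shows "ls (norm_l M j) (rs (norm_r M (int k)) oneA) =
       scal_cls q (qexp q (2 * (of_nat M - of_nat k)) *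
           ((1 - qexp q 2) / (1 - qexp q (2 * (of_nat M + 1)))) *
           (qpoch (qexp q 2) (qexp q 2) j * qpoch (qexp q 2) (qexp q 2) (M - j) /
            (qpoch (qexp q 2) (qexp q 2) k * qpoch (qexp q 2) (qexp q 2) (M - k))))
       \<cdot> L (to_mero (\<lambda>x.
           qpoch (qexp q (- 2 * x)) (qexp q 2) j /
           qpoch (qexp q (- 2 * (x + of_nat M + 1 - of_nat j))) (qexp q 2) j))
       \<cdot> R (to_mero (\<lambda>y.
           qpoch (qexp q (- 2 * (y + 1 + of_nat M - of_nat k))) (qexp q 2) (M - k) /
           qpoch (qexp q (- 2 * (y + of_nat M - 2 * of_nat k))) (qexp q 2) (M - k)))"
    (is "_ = scal_cls q ?c \<cdot> L ?f \<cdot> R ?g")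
proof -
  have e: "const_mero (qexp q (2 * (of_nat M - of_nat k))) = p powi (2 * (int M - int k))"
    "const_mero (1 - qexp q 2) = num 1" "const_mero (1 - qexp q (2 * (of_nat M + 1))) = num (int M + 1)"
    using const_mero_qexp[of "2 * (int M - int k)"] const_mero_qexp[of 2] const_mero_qexp[of "2 * (int M + 1)"]
    by (simp_all add: num_def const_mero_hom)
  have c: "const_mero ?c = p powi (2 * (int M - int k)) * (num 1 / num (int M + 1)) * (nfact j * nfact (M - j) / (nfact k * nfact (M - k)))"
    by (simp only: const_mero_hom(3,4) e const_mero_qpoch)
  have ncom: "ls (nfact n * x) y = rs (nfact n) (ls x y)" if "y \<in> carrier A" for n x y
  proof (induction n arbitrary: x)
    case (Suc n)
    have "ls (nfact (Suc n) * x) y = ls (num (int n + 1) * (nfact n * x)) y" by (simp add: nfact_Suc mult.assoc)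
    thus ?case using that Suc by (simp add: ls_num_mult nfact_Suc del: ls_rs_simps(1))
  qed (use that in simp)
  have "ls (norm_l M j) (rs (norm_r M (int k)) oneA) = rs (nfact j * nfact (M - j)) (ls ?f (rs (norm_r M (int k)) oneA))"
    unfolding norm_l_to_mero[OF assms(1)] by (simp only: mult.assoc ncom rs_closed A.one_closed ls_closed) (simp add: mult.assoc)
  also have "\<dots> = rs (const_mero ?c) (ls ?f (rs ?g oneA))"
  proof -
    have "nfact j * nfact (M - j) * norm_r M (int k) = const_mero ?c * ?g"
      unfolding c norm_r_to_mero[OF assms(2)] by (simp add: divide_inverse mult_ac)
    thus ?thesis by simp
  qed
  also have "\<dots> = scal_cls q ?c \<cdot> L ?f \<cdot> R ?g"
    by (simp only: rs_def R_hom(4)) (simp add: ls_def A.m_assoc)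
  finally show ?thesis .
qed

end

theorem theorem7p2:
  fixes q :: real
    and D :: "fr_free set \<Rightarrow> fr_pairs set"
    and t :: "nat \<Rightarrow> nat \<Rightarrow> nat \<Rightarrow> fr_free set"
    and star h :: "fr_free set \<Rightarrow> fr_free set"
    and M N j k l m :: nat
  assumes "0 < q" "q < 1"
    and "is_coproduct q D"
    and "is_matrix_elements q D t"
    and "is_star q star"
    and "is_haar q t h"
    and "j \<le> M" "k \<le> M" "l \<le> N" "m \<le> N"
  shows
    "h (t M j k \<otimes>\<^bsub>FSL2 q\<^esub> star (t N l m)) =
       scal_cls q (of_bool (M = N) * of_bool (j = l) * of_bool (k = m) *
           qexp q (2 * (of_nat M - of_nat k)) *
           ((1 - qexp q 2) / (1 - qexp q (2 * (of_nat M + 1)))) *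
           (qpoch (qexp q 2) (qexp q 2) j * qpoch (qexp q 2) (qexp q 2) (M - j) /
            (qpoch (qexp q 2) (qexp q 2) k * qpoch (qexp q 2) (qexp q 2) (M - k))))
       \<otimes>\<^bsub>FSL2 q\<^esub> lam_cls q (to_mero (\<lambda>x.
           qpoch (qexp q (- 2 * x)) (qexp q 2) j /
           qpoch (qexp q (- 2 * (x + of_nat M + 1 - of_nat j))) (qexp q 2) j))
       \<otimes>\<^bsub>FSL2 q\<^esub> mu_cls q (to_mero (\<lambda>y.
           qpoch (qexp q (- 2 * (y + 1 + of_nat M - of_nat k))) (qexp q 2) (M - k) /
           qpoch (qexp q (- 2 * (y + of_nat M - 2 * of_nat k))) (qexp q 2) (M - k)))"
proof -
  interpret dynamical_haar q D t star h
    by unfold_locales (use assms in auto)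
  have T: "t M j k = T M j (int k)" "t N l m = T N l (int m)"
    using assms by (simp_all add: T_def)
  have main: "h (t M j k \<otimes>\<^bsub>FSL2 q\<^esub> star (t N l m)) = orth M j (int k) N l (int m)"
    using pairing_eq[of l N M j "int k" "int m"] assms(9) by (simp add: pairing_def T)
  show ?thesis
  proof (cases "M = N \<and> j = l \<and> k = m")
    case True
    thus ?thesis
      unfolding main using norm_product[OF assms(7,8)] by (simp add: orth_def mult.assoc)
  next
    case False
    thus ?thesis
      unfolding main by (auto simp: orth_def scal_hom(4) cls_simps(4))
  qed
qed

end
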